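(* There is an algorithm that, given a positive integer $k$ and a rooted digraph $D=(V+r,A)$ with $n$ vertices, decides in time $2^{O(k^2 \log k)}\cdot n^{O(1)}$ whether $D$ contains two arc-disjoint $k$-safe spanning $r$-arborescences, and, if they exist, computes two such arc-disjoint $k$-safe spanning $r$-arborescences within the same running time. In particular, this decision problem is fixed-parameter tractable with parameter $k$.
   Context: Digraphs are loopless but may have parallel arcs. A rooted digraph $D=(V+r,A)$ is a digraph with vertex set $V\cup\{r\}$ and a special vertex $r$ (the root) of in-degree $0$. An $r$-arborescence is a digraph $X=(V'+r,A')$ whose underlying graph is a tree, in which $r$ has in-degree $0$ and every other vertex has in-degree $1$. For $v\in V'$, $B_X^v$ denotes the subarborescence of $X$ rooted at $v$ (i.e., $v$ together with all vertices reachable from $v$ in $X$). An $r$-arborescence $X$ with $N$ vertices is $k$-safe if $N-|V(B_X^v)|\ge k$ for all $v\in V'$. An $r$-arborescence that is a subdigraph of $D$ is spanning if it has the same vertex set as $D$. A problem is fixed-parameter tractable (FPT) with parameter $k$ if it can be solved in time $f(k)\cdot |I|^{c}$ for a computable $f$ and constant $c$, where $|I|$ is the input size. *)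

theory Defs
  imports
    "HOL-Library.Landau_Symbols"
    "HOL-Library.Log_Nat"
    "Graph_Theory.Graph_Theory"
begin

section \<open>Arborescences in digraphs with parallel arcs\<close>

definition rooted_digraph :: "('a, 'b) pre_digraph \<Rightarrow> 'a \<Rightarrow> bool" where
  "rooted_digraph D r \<longleftrightarrow>
     fin_digraph D \<and> loopfree_digraph D \<and> r \<in> verts D \<and> in_degree D r = 0"

text \<open>
  The predicates \<open>forest\<close> and \<open>tree\<close> of the library only exclude directed cycles.
  Here we need cycles of the underlying undirected multigraph: the \<open>i\<close>-th edge joins the
  \<open>i\<close>-th vertex to its cyclic successor, in either direction. Two parallel or
  antiparallel arcs form such a cycle of length 2.
\<close>

definition underlying_cycle :: "('a, 'b) pre_digraph \<Rightarrow> 'a list \<Rightarrow> 'b list \<Rightarrow> bool" where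
  "underlying_cycle X vs es \<longleftrightarrow>
     vs \<noteq> [] \<and> length es = length vs \<and> distinct vs \<and> distinct es \<and> set es \<subseteq> arcs X \<and>
     (\<forall>i < length vs. {tail X (es ! i), head X (es ! i)} = {vs ! i, vs ! (Suc i mod length vs)})"

definition underlying_tree :: "('a, 'b) pre_digraph \<Rightarrow> bool" where
  "underlying_tree X \<longleftrightarrow> connected X \<and> (\<nexists>vs es. underlying_cycle X vs es)"

definition arborescence :: "'a \<Rightarrow> ('a, 'b) pre_digraph \<Rightarrow> bool" where
  "arborescence r X \<longleftrightarrow>
     fin_digraph X \<and> underlying_tree X \<and> r \<in> verts X \<and> in_degree X r = 0 \<and>
     (\<forall>v \<in> verts X - {r}. in_degree X v = 1)"

definition subarborescence :: "('a, 'b) pre_digraph \<Rightarrow> 'a \<Rightarrow> ('a, 'b) pre_digraph" where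
  "subarborescence X v = X \<restriction> {w. v \<rightarrow>\<^sup>*\<^bsub>X\<^esub> w}"

definition safe :: "nat \<Rightarrow> 'a \<Rightarrow> ('a, 'b) pre_digraph \<Rightarrow> bool" where
  "safe k r X \<longleftrightarrow>
     (\<forall>v \<in> verts X - {r}. card (verts X) - card (verts (subarborescence X v)) \<ge> k)"

definition safe_spanning_arborescence ::
    "nat \<Rightarrow> ('a, 'b) pre_digraph \<Rightarrow> 'a \<Rightarrow> ('a, 'b) pre_digraph \<Rightarrow> bool" where
  "safe_spanning_arborescence k D r X \<longleftrightarrow> spanning X D \<and> arborescence r X \<and> safe k r X"

definition safe_packing ::
    "nat \<Rightarrow> ('a, 'b) pre_digraph \<Rightarrow> 'a \<Rightarrow> ('a, 'b) pre_digraph \<Rightarrow> ('a, 'b) pre_digraph \<Rightarrow> bool" where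
  "safe_packing k D r X Y \<longleftrightarrow>
     safe_spanning_arborescence k D r X \<and> safe_spanning_arborescence k D r Y \<and>
     arcs X \<inter> arcs Y = {}"


section \<open>A random access machine\<close>

text \<open>
  Algorithms are structured programs over finitely many infinite arrays of natural numbers
  (a scalar is cell 0 of an array). The cost measure is uniform: every constant, cell
  access, arithmetic operation, comparison and command costs one unit. As the
  only arithmetic operations are addition and truncated subtraction, a computation of \<open>t\<close>
  steps only produces numbers with at most \<open>t\<close> bits more than the longest
  initial number or program constant, so uniform time is polynomially related to Turing
  machine time with respect to the bit length of the input.
\<close>

type_synonym name = string
type_synonym state = "name \<Rightarrow> nat \<Rightarrow> nat"

datatype aexp =
    Const nat
  | Cell name aexp
  | Add aexp aexp
  | Sub aexp aexp

datatype bexp =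
    Less aexp aexp
  | Neg bexp
  | Conj bexp bexp

datatype com =
    Skip
  | Store name aexp aexp
  | Seq com com
  | Cond bexp com com
  | While bexp com

primrec aval :: "aexp \<Rightarrow> state \<Rightarrow> nat" where
  "aval (Const c) s = c"
| "aval (Cell x a) s = s x (aval a s)"
| "aval (Add a b) s = aval a s + aval b s"
| "aval (Sub a b) s = aval a s - aval b s"

primrec bval :: "bexp \<Rightarrow> state \<Rightarrow> bool" where
  "bval (Less a b) s \<longleftrightarrow> aval a s < aval b s"
| "bval (Neg b) s \<longleftrightarrow> \<not> bval b s"
| "bval (Conj b c) s \<longleftrightarrow> bval b s \<and> bval c s"

primrec acost :: "aexp \<Rightarrow> nat" where
  "acost (Const c) = 1"
| "acost (Cell x a) = acost a + 1"
| "acost (Add a b) = acost a + acost b + 1"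
| "acost (Sub a b) = acost a + acost b + 1"

primrec bcost :: "bexp \<Rightarrow> nat" where
  "bcost (Less a b) = acost a + acost b + 1"
| "bcost (Neg b) = bcost b + 1"
| "bcost (Conj b c) = bcost b + bcost c + 1"

text \<open>
  \<open>exec p s t s'\<close>: started in state \<open>s\<close>, program \<open>p\<close> terminates in state \<open>s'\<close> after exactly
  \<open>t\<close> time units. The command \<open>Store x a b\<close> performs the assignment \<open>x[a] := b\<close>.
\<close>

inductive exec :: "com \<Rightarrow> state \<Rightarrow> nat \<Rightarrow> state \<Rightarrow> bool" where
  Skip: "exec Skip s 1 s"
| Store: "exec (Store x a b) s (acost a + acost b + 1)
            (s(x := (s x)(aval a s := aval b s)))"
| Seq: "exec p s t s' \<Longrightarrow> exec q s' u s'' \<Longrightarrow> exec (Seq p q) s (t + u + 1) s''"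
| CondTrue: "bval b s \<Longrightarrow> exec p s t s' \<Longrightarrow> exec (Cond b p q) s (bcost b + t + 1) s'"
| CondFalse: "\<not> bval b s \<Longrightarrow> exec q s t s' \<Longrightarrow> exec (Cond b p q) s (bcost b + t + 1) s'"
| WhileFalse: "\<not> bval b s \<Longrightarrow> exec (While b p) s (bcost b + 1) s"
| WhileTrue: "bval b s \<Longrightarrow> exec p s t s' \<Longrightarrow> exec (While b p) s' u s'' \<Longrightarrow>
            exec (While b p) s (bcost b + t + u + 1) s''"

inductive_cases SkipE: "exec Skip s t s'"
  and StoreE: "exec (Store x a b) s t s'"
  and SeqE: "exec (Seq p q) s t s'"
  and CondE: "exec (Cond b p q) s t s'"
  and WhileE: "exec (While b p) s t s'"

lemma exec_deterministic:
  "exec p s t s' \<Longrightarrow> exec p s u s'' \<Longrightarrow> u = t \<and> s'' = s'"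
proof (induction arbitrary: u s'' rule: exec.induct)
  case (Skip s)
  from Skip show ?case by (rule SkipE) simp
next
  case (Store x a b s)
  from Store show ?case by (rule StoreE) simp
next
  case (Seq p s t s1 q t' s2)
  from Seq.prems show ?case
    by (rule SeqE) (auto dest!: Seq.IH)
next
  case (CondTrue b s p t s1 q)
  from CondTrue.prems show ?case
    by (rule CondE) (use CondTrue.hyps in \<open>auto dest!: CondTrue.IH\<close>)
next
  case (CondFalse b s q t s1 p)
  from CondFalse.prems show ?case
    by (rule CondE) (use CondFalse.hyps in \<open>auto dest!: CondFalse.IH\<close>)
next
  case (WhileFalse b s p)
  from WhileFalse.prems show ?case
    by (rule WhileE) (use WhileFalse.hyps in simp_all)
next
  case (WhileTrue b s p t s1 t' s2)
  from WhileTrue.prems show ?case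
    by (rule WhileE) (use WhileTrue.hyps in \<open>auto dest!: WhileTrue.IH\<close>)
qed

definition computable :: "(nat \<Rightarrow> nat) \<Rightarrow> bool" where
  "computable f \<longleftrightarrow>
     (\<exists>P. \<forall>x. \<exists>t s'. exec P (\<lambda>y i. if y = ''x'' \<and> i = 0 then x else 0) t s' \<and>
        s' ''ans'' 0 = f x)"

text \<open>
  A parameterized (promise) problem is given by its valid instances, their encoding as
  initial states, their input size, their parameter, and the yes-instances among them.
\<close>

definition fixed_parameter_tractable ::
    "'i set \<Rightarrow> ('i \<Rightarrow> state) \<Rightarrow> ('i \<Rightarrow> nat) \<Rightarrow> ('i \<Rightarrow> nat) \<Rightarrow> ('i \<Rightarrow> bool) \<Rightarrow> bool" where
  "fixed_parameter_tractable valid enc sz param yes \<longleftrightarrow>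
     (\<exists>P f c. computable f \<and>
        (\<forall>I \<in> valid. \<exists>t s'. exec P (enc I) t s' \<and> t \<le> f (param I) * sz I ^ c \<and>
           s' ''ans'' 0 = (if yes I then 1 else 0)))"


section \<open>Instances and solutions\<close>

text \<open>
  The digraph with vertices \<open>0, \<dots>, n - 1\<close> and \<open>m u v\<close> parallel arcs from \<open>u\<close>
  to \<open>v\<close>, which are named \<open>(u, v, 0), (u, v, 1), \<dots>\<close>. Up to isomorphism,
  these are all finite digraphs.
\<close>

definition multidigraph ::
    "nat \<Rightarrow> (nat \<Rightarrow> nat \<Rightarrow> nat) \<Rightarrow> (nat, nat \<times> nat \<times> nat) pre_digraph" where
  "multidigraph n m =
     \<lparr>verts = {..<n}, arcs = {(u, v, i). u < n \<and> v < n \<and> i < m u v},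
      tail = fst, head = fst \<circ> snd\<rparr>"

lemma (in fin_digraph) ex_iso_multidigraph:
  "\<exists>n m. digraph_iso G (multidigraph n m)"
proof -
  define n where "n = card (verts G)"
  obtain \<phi> where \<phi>: "bij_betw \<phi> (verts G) {..<n}"
    using ex_bij_betw_finite_nat[OF finite_verts] by (auto simp: n_def atLeast0LessThan)
  define F where "F u v = {e \<in> arcs G. \<phi> (tail G e) = u \<and> \<phi> (head G e) = v}" for u v
  define m where "m u v = card (F u v)" for u v
  have "\<exists>h. bij_betw h (F u v) {..<m u v}" for u v
    using ex_bij_betw_finite_nat[of "F u v"] finite_arcs
    by (auto simp: F_def m_def atLeast0LessThan)
  then obtain h where h: "\<And>u v. bij_betw (h u v) (F u v) {..<m u v}" by metis
  define \<psi> where "\<psi> e = (\<phi> (tail G e), \<phi> (head G e), h (\<phi> (tail G e)) (\<phi> (head G e)) e)" for e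
  define f where "f = \<lparr>iso_verts = \<phi>, iso_arcs = \<psi>, iso_head = fst \<circ> snd, iso_tail = fst\<rparr>"
  have lt: "\<phi> v < n" if "v \<in> verts G" for v
    using bij_betwE[OF \<phi>] that by auto
  have "inj_on \<psi> (arcs G)"
  proof (rule inj_onI)
    fix e e' assume e: "e \<in> arcs G" "e' \<in> arcs G" and eq: "\<psi> e = \<psi> e'"
    let ?u = "\<phi> (tail G e)" and ?v = "\<phi> (head G e)"
    from e eq have "e \<in> F ?u ?v" "e' \<in> F ?u ?v" "h ?u ?v e = h ?u ?v e'"
      by (auto simp: F_def \<psi>_def)
    then show "e = e'" using h[of ?u ?v] by (auto simp: bij_betw_def dest: inj_onD)
  qed
  then have iso: "digraph_isomorphism f"
    using \<phi> wf_digraph by (auto simp: digraph_isomorphism_def f_def \<psi>_def bij_betw_def)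
  have "\<psi> ` arcs G = {(u, v, i). u < n \<and> v < n \<and> i < m u v}"
  proof (intro subset_antisym subsetI)
    fix x assume "x \<in> \<psi> ` arcs G"
    then obtain e where e: "e \<in> arcs G" "x = \<psi> e" by auto
    have "e \<in> F (\<phi> (tail G e)) (\<phi> (head G e))" using e by (auto simp: F_def)
    then show "x \<in> {(u, v, i). u < n \<and> v < n \<and> i < m u v}"
      using bij_betwE[OF h] e lt by (auto simp: \<psi>_def)
  next
    fix x assume "x \<in> {(u, v, i). u < n \<and> v < n \<and> i < m u v}"
    then obtain u v i where x: "x = (u, v, i)" "i < m u v" by auto
    then have "i \<in> h u v ` F u v" using h[of u v] by (auto simp: bij_betw_def)
    then obtain e where "e \<in> F u v" "i = h u v e" by auto
    then show "x \<in> \<psi> ` arcs G" using x by (auto simp: F_def \<psi>_def image_iff)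
  qed
  then have "multidigraph n m = app_iso f G"
    using \<phi> by (auto simp: multidigraph_def app_iso_def f_def bij_betw_def)
  with iso show ?thesis by (auto simp: digraph_iso_def)
qed

text \<open>
  An instance \<open>(k, n, r, m)\<close> consists of the parameter, the number of vertices, the root
  and the multiplicities of the arcs. The program reads the matrix \<open>m\<close> row by row from
  one array.
\<close>

type_synonym packing_instance = "nat \<times> nat \<times> nat \<times> (nat \<Rightarrow> nat \<Rightarrow> nat)"

definition valid_instances :: "packing_instance set" where
  "valid_instances = {(k, n, r, m). k > 0 \<and> rooted_digraph (multidigraph n m) r}"

fun encode :: "packing_instance \<Rightarrow> state" where
  "encode (k, n, r, m) =
     (\<lambda>x i. if x = ''k'' \<and> i = 0 then k
            else if x = ''n'' \<and> i = 0 then n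
            else if x = ''r'' \<and> i = 0 then r
            else if x = ''m'' \<and> i < n * n then m (i div n) (i mod n)
            else 0)"

text \<open>Number of binary digits, except that \<open>0\<close> has one digit.\<close>

definition bit_length :: "nat \<Rightarrow> nat" where
  "bit_length x = max 1 (floorlog 2 x)"

fun instance_size :: "packing_instance \<Rightarrow> nat" where
  "instance_size (k, n, r, m) =
     bit_length k + bit_length n + bit_length r + (\<Sum>u<n. \<Sum>v<n. bit_length (m u v))"

fun parameter :: "packing_instance \<Rightarrow> nat" where
  "parameter (k, n, r, m) = k"

fun has_safe_packing :: "packing_instance \<Rightarrow> bool" where
  "has_safe_packing (k, n, r, m) \<longleftrightarrow> (\<exists>X Y. safe_packing k (multidigraph n m) r X Y)"

text \<open>
  A spanning arborescence is output as two arrays: the unique arc entering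
  \<open>v \<noteq> r\<close> is the arc from \<open>p v\<close> to \<open>v\<close> with index \<open>i v\<close>.
\<close>

definition output_digraph ::
    "nat \<Rightarrow> nat \<Rightarrow> (nat \<Rightarrow> nat) \<Rightarrow> (nat \<Rightarrow> nat) \<Rightarrow> (nat, nat \<times> nat \<times> nat) pre_digraph" where
  "output_digraph n r p i =
     \<lparr>verts = {..<n}, arcs = (\<lambda>v. (p v, v, i v)) ` ({..<n} - {r}),
      tail = fst, head = fst \<circ> snd\<rparr>"

fun correct_output :: "packing_instance \<Rightarrow> state \<Rightarrow> bool" where
  "correct_output (k, n, r, m) s \<longleftrightarrow>
     s ''ans'' 0 = (if has_safe_packing (k, n, r, m) then 1 else 0) \<and>
     (has_safe_packing (k, n, r, m) \<longrightarrow>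
        safe_packing k (multidigraph n m) r
          (output_digraph n r (s ''p1'') (s ''i1''))
          (output_digraph n r (s ''p2'') (s ''i2'')))"

end

theory Submission
  imports Defs
begin

text \<open>
  A pair of arc-disjoint partial \<open>r\<close>-arborescences with vertex sets \<open>S\<close> and \<open>T\<close> extends to two
  arc-disjoint spanning ones iff every nonempty vertex set \<open>U\<close> is entered by at least as many
  unused arcs as there are sets among \<open>S, T\<close> disjoint from \<open>U\<close> (Edmonds). Moreover, a greedy
  extension succeeds: an arc leaving \<open>S\<close> may be added as long as all of \<open>S\<close> stays
  reachable from \<open>T\<close>.

  Removing leaves from a \<open>k\<close>-safe spanning arborescence yields a safe partial arborescence with at
  most \<open>2k\<close> vertices, whose spanning extensions are all safe. It remains to find two such kernels.
  By submodularity, if \<open>v \<in> S\<close> has more than \<open>card S\<close> suitable out-neighbours, then the arc to one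
  of them can be added to \<open>S\<close>. Hence an arc of a kernel leaving a vertex \<open>v\<close> with many
  out-neighbours can be exchanged: a leaf below it is replaced by a new leaf attached to \<open>v\<close>, where
  only the first \<open>6k\<close> out-neighbours of \<open>v\<close> need to be considered. So it
  suffices to try all pairs of partial arborescences with at most \<open>2k\<close> vertices each that are grown
  from \<open>r\<close> along such arcs, with at most \<open>12k\<^sup>2\<close> choices in each step. This
  makes \<open>(12k\<^sup>2 + 1)\<^bsup>4k\<^esup>\<close> attempts, each followed by a greedy extension.
\<close>

section \<open>Bounded loops on the random access machine\<close>

text \<open>Kernels are small, but their vertices may have arbitrarily many out-neighbours. A bound
  in \<open>k\<close> alone on the number of attempts therefore depends on the exchange argument,
  which treats each tree while the other one is held fixed. Safety is expressed by counting, for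
  each child \<open>c\<close> of \<open>r\<close>, the vertices outside the branch of
  \<open>c\<close>. It is settled in the kernels; the greedy phase then looks at cuts only. An
  exchange preserves it because the new leaf lies in the branch of the deleted one or forms a branch
  of its own. An attempt may guess a pair that cannot be extended, and the guess is not tested for
  feasibility. Hence the program is analysed in two strengths: \<open>tree_inv\<close> survives all
  guesses and makes each reported answer correct, while \<open>full_inv\<close> includes feasibility
  and shows that the right guess succeeds. Loops whose bound is fixed on entry make termination and
  cost syntactic; in return, division, powers and early exit have to be imitated by
  counting.\<close>

datatype prog =
    PSkip
  | PStore name aexp aexp
  | PSeq prog prog (infixr \<open>;;\<close> 60)
  | PCond bexp prog prog
  | PFor name name prog

primrec compile :: "prog \<Rightarrow> com" where
  "compile PSkip = Skip"
| "compile (PStore x a b) = Store x a b"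
| "compile (p ;; q) = Seq (compile p) (compile q)"
| "compile (PCond b p q) = Cond b (compile p) (compile q)"
| "compile (PFor x y p) =
     Seq (Store x (Const 0) (Const 0))
       (While (Less (Cell x (Const 0)) (Cell y (Const 0)))
         (Seq (compile p) (Store x (Const 0) (Add (Cell x (Const 0)) (Const 1)))))"

definition upd :: "name \<Rightarrow> nat \<Rightarrow> nat \<Rightarrow> state \<Rightarrow> state" where
  "upd x i v s = s(x := (s x)(i := v))"

lemma upd_apply: "upd x i v s y = (if y = x then (s x)(i := v) else s y)"
  by (simp add: upd_def)

lemma upd_same [simp]: "upd x i v s x = (s x)(i := v)"
  and upd_other [simp]: "y \<noteq> x \<Longrightarrow> upd x i v s y = s y"
  by (simp_all add: upd_def)

text \<open>A total state transformer: \<open>PFor\<close> iterates as often as its bound says on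
  entry. The compiled loop rereads the bound in each round, so the two are matched only when a body
  leaves counter and bound alone, which is what \<open>safe_loops\<close> and the disjointness of
  \<open>bounds\<close> and \<open>writes\<close> express.\<close>

primrec sem :: "prog \<Rightarrow> state \<Rightarrow> state" where
  "sem PSkip = (\<lambda>s. s)"
| "sem (PStore x a b) = (\<lambda>s. upd x (aval a s) (aval b s) s)"
| "sem (p ;; q) = (\<lambda>s. sem q (sem p s))"
| "sem (PCond b p q) = (\<lambda>s. if bval b s then sem p s else sem q s)"
| "sem (PFor x y p) =
     (\<lambda>s. ((\<lambda>s. upd x 0 (Suc (sem p s x 0)) (sem p s)) ^^ (s y 0)) (upd x 0 0 s))"

primrec writes :: "prog \<Rightarrow> name set" where
  "writes PSkip = {}"
| "writes (PStore x a b) = {x}"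
| "writes (p ;; q) = writes p \<union> writes q"
| "writes (PCond b p q) = writes p \<union> writes q"
| "writes (PFor x y p) = insert x (writes p)"

primrec bounds :: "prog \<Rightarrow> name set" where
  "bounds PSkip = {}"
| "bounds (PStore x a b) = {}"
| "bounds (p ;; q) = bounds p \<union> bounds q"
| "bounds (PCond b p q) = bounds p \<union> bounds q"
| "bounds (PFor x y p) = insert y (bounds p)"

primrec safe_loops :: "prog \<Rightarrow> bool" where
  "safe_loops PSkip = True"
| "safe_loops (PStore x a b) = True"
| "safe_loops (p ;; q) = (safe_loops p \<and> safe_loops q)"
| "safe_loops (PCond b p q) = (safe_loops p \<and> safe_loops q)"
| "safe_loops (PFor x y p) = (x \<notin> writes p \<and> safe_loops p)"

text \<open>A round of a loop costs 13 on top of its body: 5 for the test, 6 for the increment of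
  the counter, 1 each for the sequence and the loop command. The 10 consists of 3 for the initial
  store, 6 for the failing test and 1 for the sequence.\<close>

primrec cost_bound :: "prog \<Rightarrow> (name \<Rightarrow> nat) \<Rightarrow> nat" where
  "cost_bound PSkip \<beta> = 1"
| "cost_bound (PStore x a b) \<beta> = acost a + acost b + 1"
| "cost_bound (p ;; q) \<beta> = cost_bound p \<beta> + cost_bound q \<beta> + 1"
| "cost_bound (PCond b p q) \<beta> = bcost b + (cost_bound p \<beta> + cost_bound q \<beta>) + 1"
| "cost_bound (PFor x y p) \<beta> = \<beta> y * (cost_bound p \<beta> + 13) + 10"

lemma sem_other: "y \<notin> writes p \<Longrightarrow> sem p s y = s y"
proof (induction p arbitrary: s)
  case (PFor x z p)
  have "((\<lambda>s. upd x 0 (Suc (sem p s x 0)) (sem p s)) ^^ k) s' y = s' y" for k s'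
    using PFor by (induction k) auto
  with PFor show ?case by simp
qed auto

text \<open>As no loop bound is ever written, the values of the bounds in the initial state stay
  valid throughout, and the cost can be evaluated there although later parts start from other
  states.\<close>

lemma exec_compile:
  assumes "safe_loops p" "bounds p \<inter> writes p = {}"
  shows "\<exists>t. exec (compile p) s t (sem p s) \<and> t \<le> cost_bound p (\<lambda>y. s y 0)"
  using assms
proof (induction p arbitrary: s)
  case PSkip
  then show ?case by (auto intro: exec.Skip)
next
  case (PStore x a b)
  have "exec (compile (PStore x a b)) s (acost a + acost b + 1) (sem (PStore x a b) s)"
    unfolding compile.simps sem.simps upd_def by (rule exec.Store)
  moreover have "acost a + acost b + 1 \<le> cost_bound (PStore x a b) (\<lambda>y. s y 0)" by simp
  ultimately show ?case by blast
next
  case (PSeq p q)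
  have sl: "safe_loops p" "safe_loops q" "bounds p \<inter> writes p = {}" "bounds q \<inter> writes q = {}"
    "bounds q \<inter> writes p = {}"
    using PSeq.prems by auto
  from PSeq.IH(1)[OF sl(1,3), of s] obtain t
    where t: "exec (compile p) s t (sem p s)" "t \<le> cost_bound p (\<lambda>y. s y 0)" by blast
  from PSeq.IH(2)[OF sl(2,4), of "sem p s"] obtain u
    where u: "exec (compile q) (sem p s) u (sem q (sem p s))"
     "u \<le> cost_bound q (\<lambda>y. sem p s y 0)" by blast
  have c: "cost_bound q \<beta> = cost_bound q \<beta>'" if "\<And>y. y \<in> bounds q \<Longrightarrow> \<beta> y = \<beta>' y" for \<beta> \<beta>'
    using that by (induction q) auto
  have "cost_bound q (\<lambda>y. sem p s y 0) = cost_bound q (\<lambda>y. s y 0)"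
  proof (rule c)
    fix y assume "y \<in> bounds q"
    with sl(5) have "y \<notin> writes p" by blast
    then show "sem p s y 0 = s y 0" by (simp add: sem_other)
  qed
  with t(2) u(2) have "t + u + 1 \<le> cost_bound (p ;; q) (\<lambda>y. s y 0)" by simp
  with exec.Seq[OF t(1) u(1)] show ?case by auto
next
  case (PCond b p q)
  have sl: "safe_loops p" "safe_loops q" "bounds p \<inter> writes p = {}" "bounds q \<inter> writes q = {}"
    using PCond.prems by auto
  show ?case
  proof (cases "bval b s")
    case True
    from PCond.IH(1)[OF sl(1,3), of s] obtain t
      where t: "exec (compile p) s t (sem p s)" "t \<le> cost_bound p (\<lambda>y. s y 0)" by blast
    have "bcost b + t + 1 \<le> cost_bound (PCond b p q) (\<lambda>y. s y 0)" using t(2) by simp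
    with exec.CondTrue[where q = "compile q", OF True t(1)] True show ?thesis by auto
  next
    case False
    from PCond.IH(2)[OF sl(2,4), of s] obtain t
      where t: "exec (compile q) s t (sem q s)" "t \<le> cost_bound q (\<lambda>y. s y 0)" by blast
    have "bcost b + t + 1 \<le> cost_bound (PCond b p q) (\<lambda>y. s y 0)" using t(2) by simp
    with exec.CondFalse[where p = "compile p", OF False t(1)] False show ?thesis by auto
  qed
next
  case (PFor x y p)
  let ?b = "Less (Cell x (Const 0)) (Cell y (Const 0))"
  let ?c = "Seq (compile p) (Store x (Const 0) (Add (Cell x (Const 0)) (Const 1)))"
  let ?g = "\<lambda>s. upd x 0 (Suc (sem p s x 0)) (sem p s)"
  let ?T = "cost_bound p (\<lambda>y. s y 0)"
  from PFor.prems have ne: "x \<noteq> y" and xw: "x \<notin> writes p" and yw: "y \<notin> writes p"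
    and fr: "\<And>z. z \<in> bounds p \<Longrightarrow> z \<noteq> x \<and> z \<notin> writes p" by auto
  have c: "cost_bound p \<beta> = cost_bound p \<beta>'" if "\<And>y. y \<in> bounds p \<Longrightarrow> \<beta> y = \<beta>' y" for \<beta> \<beta>'
    using that by (induction p) auto
  \<comment> \<open>The induction over the remaining rounds \<open>k\<close> must speak about
    arbitrary intermediate states; the cost of the body stays \<open>?T\<close> because it depends
    only on names in \<open>bounds p\<close>.\<close>
  have loop: "\<exists>t. exec (While ?b ?c) s' t ((?g ^^ k) s') \<and> t \<le> k * (?T + 13) + 6"
    if "s' y 0 = s' x 0 + k" "\<And>z. z \<in> bounds p \<Longrightarrow> s' z = s z" for k s'
    using that
  proof (induction k arbitrary: s')
    case 0
    then have "\<not> bval ?b s'" by simp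
    from exec.WhileFalse[OF this, of ?c] show ?case by auto
  next
    case (Suc k)
    then have b: "bval ?b s'" by simp
    have pf: "cost_bound p (\<lambda>y. s' y 0) = ?T" by (rule c) (simp add: Suc.prems)
    have "safe_loops p" "bounds p \<inter> writes p = {}" using PFor.prems by auto
    from PFor.IH[OF this, of s'] pf obtain t where
      t: "exec (compile p) s' t (sem p s')" "t \<le> ?T" by auto
    have st: "exec ?c s' (t + 6 + 1) (?g s')"
      using exec.Seq[OF t(1) exec.Store[of x "Const 0" "Add (Cell x (Const 0)) (Const 1)" "sem p s'"]]
      by (simp add: upd_def numeral_eq_Suc)
    have "\<exists>u. exec (While ?b ?c) (?g s') u ((?g ^^ k) (?g s')) \<and> u \<le> k * (?T + 13) + 6"
    proof (rule Suc.IH)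
      show "?g s' y 0 = ?g s' x 0 + k" using Suc.prems(1) ne xw yw by (simp add: sem_other)
      show "?g s' z = s z" if "z \<in> bounds p" for z
        using Suc.prems(2) fr that by (simp add: sem_other)
    qed
    then obtain u where u: "exec (While ?b ?c) (?g s') u ((?g ^^ k) (?g s'))"
       "u \<le> k * (?T + 13) + 6" by auto
    have "(?g ^^ k) (?g s') = (?g ^^ Suc k) s'" by (simp only: funpow_Suc_right comp_apply)
    moreover have "bcost ?b + (t + 6 + 1) + u + 1 \<le> Suc k * (?T + 13) + 6" using t(2) u(2) by simp
    moreover note exec.WhileTrue[OF b st u(1)]
    ultimately show ?case by (intro exI conjI) (assumption | simp only:)+
  qed
  have "\<exists>t. exec (While ?b ?c) (upd x 0 0 s) t ((?g ^^ (s y 0)) (upd x 0 0 s))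
      \<and> t \<le> s y 0 * (?T + 13) + 6"
    by (rule loop) (use ne fr in auto)
  then obtain t where t: "exec (While ?b ?c) (upd x 0 0 s) t ((?g ^^ (s y 0)) (upd x 0 0 s))"
    "t \<le> s y 0 * (?T + 13) + 6" by auto
  have "exec (Store x (Const 0) (Const 0)) s 3 (upd x 0 0 s)"
    using exec.Store[of x "Const 0" "Const 0" s] by (simp add: upd_def numeral_eq_Suc)
  from exec.Seq[OF this t(1)] have "exec (compile (PFor x y p)) s (3 + t + 1) (sem (PFor x y p) s)"
    by simp
  moreover have "3 + t + 1 \<le> cost_bound (PFor x y p) (\<lambda>y. s y 0)" using t(2) by simp
  ultimately show ?case by blast
qed

section \<open>Polynomial cost bounds\<close>

primrec cost_coeff :: "prog \<Rightarrow> nat" where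
  "cost_coeff PSkip = 1"
| "cost_coeff (PStore x a b) = acost a + acost b + 1"
| "cost_coeff (p ;; q) = cost_coeff p + cost_coeff q + 1"
| "cost_coeff (PCond b p q) = bcost b + (cost_coeff p + cost_coeff q) + 1"
| "cost_coeff (PFor x y p) = cost_coeff p + 23"

primrec cost_degree :: "prog \<Rightarrow> nat" where
  "cost_degree PSkip = 0"
| "cost_degree (PStore x a b) = 0"
| "cost_degree (p ;; q) = max (cost_degree p) (cost_degree q)"
| "cost_degree (PCond b p q) = max (cost_degree p) (cost_degree q)"
| "cost_degree (PFor x y p) = Suc (cost_degree p)"

text \<open>Every level of nesting contributes one factor \<open>Z\<close>. The coefficient of a
  loop grows by \<open>23 = 13 + 10\<close>, because \<open>Z \<ge> 1\<close> allows both constants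
  to be multiplied by the power.\<close>

lemma cost_bound_le:
  assumes "\<And>y. y \<in> bounds p \<Longrightarrow> \<beta> y \<le> Z" "Z \<ge> 1"
  shows "cost_bound p \<beta> \<le> cost_coeff p * Z ^ cost_degree p"
  using assms(1)
proof (induction p)
  case (PSeq p q)
  have "cost_coeff p * Z ^ cost_degree p \<le> cost_coeff p * Z ^ max (cost_degree p) (cost_degree q)"
    "cost_coeff q * Z ^ cost_degree q \<le> cost_coeff q * Z ^ max (cost_degree p) (cost_degree q)"
    "1 \<le> Z ^ max (cost_degree p) (cost_degree q)"
    using assms(2) by (auto intro!: power_increasing)
  moreover from PSeq have "cost_bound p \<beta> \<le> cost_coeff p * Z ^ cost_degree p"
    "cost_bound q \<beta> \<le> cost_coeff q * Z ^ cost_degree q" by auto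
  ultimately show ?case
    by (simp only: cost_bound.simps cost_coeff.simps cost_degree.simps add_mult_distrib mult_1
        mult_1_right)
next
  case (PCond b p q)
  have "cost_coeff p * Z ^ cost_degree p \<le> cost_coeff p * Z ^ max (cost_degree p) (cost_degree q)"
    "cost_coeff q * Z ^ cost_degree q \<le> cost_coeff q * Z ^ max (cost_degree p) (cost_degree q)"
    "1 \<le> Z ^ max (cost_degree p) (cost_degree q)"
    "bcost b * 1 \<le> bcost b * Z ^ max (cost_degree p) (cost_degree q)"
    using assms(2) by (auto intro!: power_increasing)
  moreover from PCond have "cost_bound p \<beta> \<le> cost_coeff p * Z ^ cost_degree p"
    "cost_bound q \<beta> \<le> cost_coeff q * Z ^ cost_degree q" by auto
  ultimately show ?case
    by (simp only: cost_bound.simps cost_coeff.simps cost_degree.simps add_mult_distrib mult_1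
        mult_1_right)
next
  case (PFor x y p)
  then have "cost_bound p \<beta> \<le> cost_coeff p * Z ^ cost_degree p" by auto
  moreover have "1 \<le> Z ^ cost_degree p" using assms(2) by auto
  ultimately have a: "cost_bound p \<beta> + 13 \<le> (cost_coeff p + 13) * Z ^ cost_degree p"
    by (simp add: algebra_simps)
  have "\<beta> y \<le> Z" using PFor.prems by auto
  from mult_le_mono[OF this a]
  have "\<beta> y * (cost_bound p \<beta> + 13) \<le> (cost_coeff p + 13) * Z ^ Suc (cost_degree p)"
    by (simp add: ac_simps)
  moreover have "10 * 1 \<le> 10 * Z ^ Suc (cost_degree p)" using assms(2) by (intro mult_le_mono) auto
  ultimately have "\<beta> y * (cost_bound p \<beta> + 13) + 10
      \<le> (cost_coeff p + 13) * Z ^ Suc (cost_degree p) + 10 * Z ^ Suc (cost_degree p)" by linarith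
  also have "\<dots> = (cost_coeff p + 23) * Z ^ Suc (cost_degree p)" by (simp add: algebra_simps)
  finally show ?case by simp
qed (use assms(2) in auto)

lemma exec_compile_poly:
  assumes "safe_loops p" "bounds p \<inter> writes p = {}"
    and "\<And>y. y \<in> bounds p \<Longrightarrow> s y 0 \<le> Z" "Z \<ge> 1"
  shows "\<exists>t. exec (compile p) s t (sem p s) \<and> t \<le> cost_coeff p * Z ^ cost_degree p"
proof -
  obtain t where t: "exec (compile p) s t (sem p s)" "t \<le> cost_bound p (\<lambda>y. s y 0)"
    using exec_compile[OF assms(1,2)] by blast
  have "cost_bound p (\<lambda>y. s y 0) \<le> cost_coeff p * Z ^ cost_degree p"
    by (rule cost_bound_le) (use assms in auto)
  with t show ?thesis by (meson le_trans)
qed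

text \<open>The step hypothesis already supplies that all names outside \<open>writes p\<close>,
  except the counter, still have their values from \<open>s\<close>, so an invariant only describes
  what the body changes. It is indexed by the number of completed rounds, and
  \<open>I (Suc i)\<close> is demanded after the counter has been advanced.\<close>

lemma For_rule:
  assumes "x \<notin> writes p"
    and "I 0 (upd x 0 0 s)"
    and "\<And>i s'. i < s y 0 \<Longrightarrow> s' x 0 = i \<Longrightarrow> (\<And>z. z \<notin> writes p \<Longrightarrow> z \<noteq> x \<Longrightarrow> s' z = s z) \<Longrightarrow>
           I i s' \<Longrightarrow> I (Suc i) (upd x 0 (Suc i) (sem p s'))"
  shows "I (s y 0) (sem (PFor x y p) s)"
proof -
  let ?g = "\<lambda>s. upd x 0 (Suc (sem p s x 0)) (sem p s)"
  have "I k ((?g ^^ k) (upd x 0 0 s)) \<and> (?g ^^ k) (upd x 0 0 s) x 0 = k \<and>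
      (\<forall>z. z \<notin> writes p \<longrightarrow> z \<noteq> x \<longrightarrow> (?g ^^ k) (upd x 0 0 s) z = s z)" if "k \<le> s y 0" for k
    using that
  proof (induction k)
    case 0
    then show ?case using assms(2) by auto
  next
    case (Suc k)
    let ?s = "(?g ^^ k) (upd x 0 0 s)"
    from Suc have IH: "I k ?s" "?s x 0 = k" "\<forall>z. z \<notin> writes p \<longrightarrow> z \<noteq> x \<longrightarrow> ?s z = s z" by auto
    have "sem p ?s x 0 = k" using assms(1) IH(2) by (simp add: sem_other)
    moreover have "I (Suc k) (upd x 0 (Suc k) (sem p ?s))"
      by (rule assms(3)) (use IH Suc.prems in auto)
    ultimately show ?case using IH(3) by (auto simp: sem_other)
  qed
  then show ?thesis by simp
qed

text \<open>Two nested loops over all pairs \<open>(a, b)\<close>, with the pairs numbered by \<open>a * n + b\<close>.\<close>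

lemma For2_rule:
  assumes fresh: "v \<notin> writes p" "w \<notin> writes p" "v \<noteq> w"
    and bd: "y \<notin> writes p" "y \<noteq> v" "y \<noteq> w" "s y 0 = n"
    and ins: "\<And>i s' c. I i s' \<Longrightarrow> I i (upd v 0 c s')" "\<And>i s' c. I i s' \<Longrightarrow> I i (upd w 0 c s')"
    and init: "I 0 s"
    and step: "\<And>a b s'. a < n \<Longrightarrow> b < n \<Longrightarrow> s' v 0 = a \<Longrightarrow> s' w 0 = b \<Longrightarrow>
           (\<And>z. z \<notin> writes p \<Longrightarrow> z \<noteq> v \<Longrightarrow> z \<noteq> w \<Longrightarrow> s' z = s z) \<Longrightarrow>
           I (a * n + b) s' \<Longrightarrow> I (Suc (a * n + b)) (sem p s')"
  shows "I (n * n) (sem (PFor v y (PFor w y p)) s)"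
proof -
  have "I (s y 0 * n) (sem (PFor v y (PFor w y p)) s)"
  proof (rule For_rule[where I = "\<lambda>a s'. I (a * n) s'"])
    show "v \<notin> writes (PFor w y p)" using fresh by auto
    show "I (0 * n) (upd v 0 0 s)" using init ins by auto
    fix a s' assume a: "a < s y 0" "s' v 0 = a"
      and fr: "\<And>z. z \<notin> writes (PFor w y p) \<Longrightarrow> z \<noteq> v \<Longrightarrow> s' z = s z" and I: "I (a * n) s'"
    have yn: "s' y 0 = n" using fr bd by auto
    have "I (a * n + s' y 0) (sem (PFor w y p) s')"
    proof (rule For_rule[where I = "\<lambda>b s''. I (a * n + b) s''"])
      show "w \<notin> writes p" by fact
      show "I (a * n + 0) (upd w 0 0 s')" using I ins by auto
      fix b s'' assume b: "b < s' y 0" "s'' w 0 = b"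
        and fr': "\<And>z. z \<notin> writes p \<Longrightarrow> z \<noteq> w \<Longrightarrow> s'' z = s' z" and I': "I (a * n + b) s''"
      have "I (Suc (a * n + b)) (sem p s'')"
        by (rule step) (use a b yn bd fr' fr fresh I' in auto)
      then show "I (a * n + Suc b) (upd w 0 (Suc b) (sem p s''))" using ins by simp
    qed
    then show "I (Suc a * n) (upd v 0 (Suc a) (sem (PFor w y p) s'))" using ins yn by (simp add: ac_simps)
  qed
  then show ?thesis using bd by simp
qed

section \<open>Cuts and feasible pairs of vertex sets\<close>

definition cut_size :: "nat \<Rightarrow> (nat \<Rightarrow> nat \<Rightarrow> nat) \<Rightarrow> nat set \<Rightarrow> nat" where
  "cut_size n q U = (\<Sum>u<n. \<Sum>v<n. if u \<notin> U \<and> v \<in> U then q u v else 0)"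

definition use_arc :: "nat \<Rightarrow> nat \<Rightarrow> (nat \<Rightarrow> nat \<Rightarrow> nat) \<Rightarrow> nat \<Rightarrow> nat \<Rightarrow> nat" where
  "use_arc v w q = (\<lambda>a b. if a = v \<and> b = w then q a b - 1 else q a b)"

definition feasible :: "nat \<Rightarrow> nat set \<Rightarrow> nat set \<Rightarrow> (nat \<Rightarrow> nat \<Rightarrow> nat) \<Rightarrow> bool" where
  "feasible n S T q \<longleftrightarrow>
     (\<forall>U. U \<subseteq> {..<n} \<longrightarrow> U \<noteq> {} \<longrightarrow>
        of_bool (U \<inter> S = {}) + of_bool (U \<inter> T = {}) \<le> cut_size n q U)"

lemma feasible_commute: "feasible n S T q = feasible n T S q"
  by (auto simp: feasible_def add.commute)

lemma cut_size_cong: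
  "(\<And>u v. u < n \<Longrightarrow> v < n \<Longrightarrow> q u v = q' u v) \<Longrightarrow> cut_size n q U = cut_size n q' U"
  unfolding cut_size_def by (intro sum.cong) auto

lemma feasible_cong:
  "(\<And>u v. u < n \<Longrightarrow> v < n \<Longrightarrow> q u v = q' u v) \<Longrightarrow> feasible n S T q = feasible n S T q'"
  unfolding feasible_def using cut_size_cong[of n q q'] by auto

text \<open>The inequality holds arc by arc: no arc enters \<open>A \<inter> B\<close> and
  \<open>A \<union> B\<close> more often in total than it enters \<open>A\<close> and
  \<open>B\<close>.\<close>

lemma cut_size_submodular:
  "cut_size n q (A \<inter> B) + cut_size n q (A \<union> B) \<le> cut_size n q A + cut_size n q B"
  unfolding cut_size_def sum.distrib[symmetric] by (intro sum_mono) auto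

lemma cut_size_use_arc:
  assumes "v < n" "w < n" "q v w > 0"
  shows "cut_size n q U = cut_size n (use_arc v w q) U + of_bool (v \<notin> U \<and> w \<in> U)"
proof -
  have "of_bool (v \<notin> U \<and> w \<in> U) = (\<Sum>a<n. \<Sum>b<n. if a = v \<and> b = w \<and> v \<notin> U \<and> w \<in> U then 1 else 0::nat)"
  proof -
    have "(\<Sum>a<n. \<Sum>b<n. if a = v \<and> b = w \<and> v \<notin> U \<and> w \<in> U then 1 else 0::nat)
        = (\<Sum>a<n. if a = v then (\<Sum>b<n. if b = w then of_bool (v \<notin> U \<and> w \<in> U) else 0) else 0)"
      by (intro sum.cong) (auto intro!: sum.cong)
    also have "\<dots> = of_bool (v \<notin> U \<and> w \<in> U)" using assms by (simp add: sum.delta)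
    finally show ?thesis by simp
  qed
  moreover have "(if a \<notin> U \<and> b \<in> U then q a b else 0) =
      (if a \<notin> U \<and> b \<in> U then use_arc v w q a b else 0) +
      (if a = v \<and> b = w \<and> v \<notin> U \<and> w \<in> U then 1 else 0)" for a b
    using assms by (auto simp: use_arc_def)
  ultimately show ?thesis unfolding cut_size_def by (simp add: sum.distrib)
qed

lemma cut_size_pos_iff:
  "cut_size n q U > 0 \<longleftrightarrow> (\<exists>u<n. \<exists>v<n. u \<notin> U \<and> v \<in> U \<and> q u v > 0)"
proof -
  have "cut_size n q U = 0 \<longleftrightarrow> \<not> (\<exists>u<n. \<exists>v<n. u \<notin> U \<and> v \<in> U \<and> q u v > 0)"
  proof
    assume "cut_size n q U = 0"
    then have h: "\<forall>u\<in>{..<n}. \<forall>v\<in>{..<n}. (if u \<notin> U \<and> v \<in> U then q u v else 0) = 0"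
      unfolding cut_size_def by (simp add: sum_eq_0_iff)
    show "\<not> (\<exists>u<n. \<exists>v<n. u \<notin> U \<and> v \<in> U \<and> q u v > 0)"
    proof (intro notI, elim exE conjE)
      fix u v assume "u < n" "v < n" "u \<notin> U" "v \<in> U" "q u v > 0"
      with h[rule_format, of u v] show False by simp
    qed
  next
    assume "\<not> (\<exists>u<n. \<exists>v<n. u \<notin> U \<and> v \<in> U \<and> q u v > 0)"
    then show "cut_size n q U = 0" unfolding cut_size_def by (intro sum.neutral) auto
  qed
  then show ?thesis using neq0_conv[of "cut_size n q U"] by argo
qed

text \<open>After one copy of the arc to \<open>w\<close> has been removed, the arc to
  \<open>w'\<close> still keeps the cut positive.\<close>

lemma cut_size_ge_arcs:
  assumes "w \<noteq> w'" "v < n" "w < n" "w' < n" "v \<notin> U" "w \<in> U" "w' \<in> U" "q v w > 0" "q v w' > 0"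
  shows "cut_size n q U \<ge> 2"
proof -
  have "cut_size n q U = cut_size n (use_arc v w q) U + 1"
    using cut_size_use_arc[of v n w q U] assms by simp
  moreover have "cut_size n (use_arc v w q) U > 0"
    unfolding cut_size_pos_iff
    by (rule exI[of _ v], use assms in simp, rule exI[of _ w'], simp add: use_arc_def)
  ultimately show ?thesis by simp
qed

text \<open>Giving the arc back pays for the demand created by shrinking \<open>insert w S\<close>
  to \<open>S\<close>: a set containing \<open>w\<close> and missing \<open>S\<close> also misses
  \<open>v\<close>, so the returned arc enters it.\<close>

lemma feasible_remove:
  assumes f: "feasible n (insert w S) T (use_arc v w q)" and "v \<in> S" "v < n" "w < n" "q v w > 0"
  shows "feasible n S T q"
  unfolding feasible_def
proof (intro allI impI)
  fix U assume U: "U \<subseteq> {..<n}" "U \<noteq> {}"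
  have "of_bool (U \<inter> insert w S = {}) + of_bool (U \<inter> T = {}) \<le> cut_size n (use_arc v w q) U"
    using f U unfolding feasible_def by blast
  moreover have "cut_size n q U = cut_size n (use_arc v w q) U + of_bool (v \<notin> U \<and> w \<in> U)"
    by (rule cut_size_use_arc) (use assms in auto)
  moreover have "of_bool (U \<inter> S = {}) \<le> of_bool (U \<inter> insert w S = {}) + (of_bool (v \<notin> U \<and> w \<in> U) :: nat)"
    using \<open>v \<in> S\<close> by auto
  ultimately show "of_bool (U \<inter> S = {}) + of_bool (U \<inter> T = {}) \<le> cut_size n q U" by linarith
qed

text \<open>Only a set entered by the arc from \<open>v\<close> to \<open>w\<close> can become
  deficient. It contains \<open>w\<close>, so its remaining demand comes from \<open>T\<close> alone
  and is 1; hence the used arc was the only one entering it, and feasibility before the step shows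
  that it meets \<open>S\<close>.\<close>

lemma infeasible_tight_set:
  assumes f: "feasible n S T q" and "v \<in> S" "v < n" "w < n" "q v w > 0"
    and nf: "\<not> feasible n (insert w S) T (use_arc v w q)"
  obtains U where "U \<subseteq> {..<n}" "U \<inter> S \<noteq> {}" "U \<inter> T = {}" "v \<notin> U" "w \<in> U" "cut_size n q U = 1"
proof -
  from nf obtain U where U: "U \<subseteq> {..<n}" "U \<noteq> {}"
    and lt: "\<not> of_bool (U \<inter> insert w S = {}) + of_bool (U \<inter> T = {}) \<le> cut_size n (use_arc v w q) U"
    unfolding feasible_def by blast
  have c: "cut_size n q U = cut_size n (use_arc v w q) U + of_bool (v \<notin> U \<and> w \<in> U)"
    by (rule cut_size_use_arc) (use assms in auto)
  have fU: "of_bool (U \<inter> S = {}) + of_bool (U \<inter> T = {}) \<le> cut_size n q U"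
    using f U unfolding feasible_def by blast
  have enter: "v \<notin> U" "w \<in> U"
    using c fU lt by (auto simp: of_bool_def split: if_splits)
  then have "U \<inter> T = {}" "cut_size n (use_arc v w q) U = 0" using lt by (auto simp: of_bool_def split: if_splits)
  moreover from this c enter have "cut_size n q U = 1" by simp
  moreover from this fU \<open>U \<inter> T = {}\<close> have "U \<inter> S \<noteq> {}" by (auto simp: of_bool_def split: if_splits)
  ultimately show ?thesis using that U enter by blast
qed

lemma feasible_cut_pos:
  assumes "feasible n S T q" "U \<subseteq> {..<n}" "U \<noteq> {}" "U \<inter> T = {}"
  shows "cut_size n q U \<ge> 1"
  using assms unfolding feasible_def by (auto dest!: spec[of _ U])

lemma feasible_cut_two:
  assumes "feasible n S T q" "U \<subseteq> {..<n}" "U \<noteq> {}" "U \<inter> T = {}" "U \<inter> S = {}"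
  shows "cut_size n q U \<ge> 2"
  using assms unfolding feasible_def by (auto dest!: spec[of _ U])

text \<open>The inductive step in Lovasz's proof of Edmonds' disjoint branchings theorem.\<close>

lemma feasible_extend:
  assumes f: "feasible n S T q" and S: "S \<subset> {..<n}"
  shows "\<exists>v w. v \<in> S \<and> w < n \<and> w \<notin> S \<and> q v w > 0 \<and> feasible n (insert w S) T (use_arc v w q)"
proof -
  define tight where "tight U \<longleftrightarrow> U \<subseteq> {..<n} \<and> U \<inter> S \<noteq> {} \<and> U \<inter> T = {} \<and> \<not> U \<subseteq> S \<and> cut_size n q U = 1" for U
  have bad: "\<exists>U. tight U \<and> v \<notin> U \<and> w \<in> U"
    if "v \<in> S" "w < n" "w \<notin> S" "q v w > 0" "\<not> feasible n (insert w S) T (use_arc v w q)" for v w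
  proof -
    have "v < n" using that S by auto
    from infeasible_tight_set[OF f \<open>v \<in> S\<close> this \<open>w < n\<close> \<open>q v w > 0\<close> that(5)] show ?thesis
      unfolding tight_def using that(3) by (metis subsetD)
  qed
  show ?thesis
  proof (cases "\<exists>U. tight U")
    case False
    \<comment> \<open>With no tight set at all, every residual arc leaving \<open>S\<close> is
      admissible, and the complement of \<open>S\<close> supplies one.\<close>
    have "cut_size n q ({..<n} - S) > 0"
    proof -
      have "feasible n T S q" using f by (simp add: feasible_commute)
      moreover have "{..<n} - S \<noteq> {}" "({..<n} - S) \<inter> S = {}" using S by auto
      ultimately show ?thesis using feasible_cut_pos[of n T S q "{..<n} - S"] by auto
    qed
    then obtain v w where "v \<in> S" "w < n" "w \<notin> S" "q v w > 0" unfolding cut_size_pos_iff by auto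
    with bad False show ?thesis by blast
  next
    case True
    then obtain U where U: "tight U" and min: "\<And>W. tight W \<Longrightarrow> card U \<le> card W"
      using exists_least_iff[of "\<lambda>c. \<exists>U. tight U \<and> card U = c"] by (metis not_le)
    have Us: "U \<subseteq> {..<n}" and finU: "finite U" using U finite_subset unfolding tight_def by auto
    \<comment> \<open>\<open>U - S\<close> misses both trees and is entered by two units,
      \<open>U\<close> by one only; the difference comes from an arc running from
      \<open>U \<inter> S\<close> to \<open>U - S\<close>.\<close>
    have "cut_size n q (U - S) \<ge> 2"
      by (rule feasible_cut_two[OF f]) (use U in \<open>auto simp: tight_def\<close>)
    have "\<exists>v w. v \<in> U \<inter> S \<and> w \<in> U - S \<and> v < n \<and> w < n \<and> q v w > 0"
    proof (rule ccontr)
      assume *: "\<not> ?thesis"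
      have "cut_size n q (U - S) \<le> cut_size n q U"
        unfolding cut_size_def
      proof (intro sum_mono)
        fix a b assume "a \<in> {..<n}" "b \<in> {..<n}"
        with * show "(if a \<notin> U - S \<and> b \<in> U - S then q a b else 0) \<le> (if a \<notin> U \<and> b \<in> U then q a b else 0)"
          by auto
      qed
      with \<open>cut_size n q (U - S) \<ge> 2\<close> U show False by (simp add: tight_def)
    qed
    then obtain v w where vw: "v \<in> U" "v \<in> S" "w \<in> U" "w \<notin> S" "w < n" "q v w > 0" by auto
    have "feasible n (insert w S) T (use_arc v w q)"
    proof (rule ccontr)
      assume "\<not> ?thesis"
      \<comment> \<open>Uncrossing: \<open>U \<union> W\<close> still misses \<open>T\<close>, so
        submodularity leaves at most one unit for \<open>U \<inter> W\<close>. Hence the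
        intersection cannot miss \<open>S\<close>, and it is a tight set lacking \<open>v\<close>,
        against the minimality of \<open>U\<close>.\<close>
      with bad vw obtain W where W: "tight W" "v \<notin> W" "w \<in> W" by blast
      have cU: "cut_size n q U = 1" and cW: "cut_size n q W = 1" using U W by (auto simp: tight_def)
      have "cut_size n q (U \<union> W) \<ge> 1"
        by (rule feasible_cut_pos[OF f]) (use U W in \<open>auto simp: tight_def\<close>)
      with cut_size_submodular[of n q U W] cU cW have le1: "cut_size n q (U \<inter> W) \<le> 1" by linarith
      have "U \<inter> W \<inter> S \<noteq> {}"
      proof
        assume "U \<inter> W \<inter> S = {}"
        then have "cut_size n q (U \<inter> W) \<ge> 2"
          by (intro feasible_cut_two[OF f]) (use U W vw in \<open>auto simp: tight_def\<close>)
        with le1 show False by simp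
      qed
      moreover have "cut_size n q (U \<inter> W) \<ge> 1"
        by (rule feasible_cut_pos[OF f]) (use U W vw in \<open>auto simp: tight_def\<close>)
      ultimately have "tight (U \<inter> W)" unfolding tight_def using le1 U W vw by (auto simp: tight_def)
      from min[OF this] have "card U \<le> card (U \<inter> W)" .
      moreover have "U \<inter> W \<subset> U" using vw W by auto
      then have "card (U \<inter> W) < card U" using finU by (rule psubset_card_mono[rotated])
      ultimately show False by simp
    qed
    with vw show ?thesis by blast
  qed
qed

text \<open>
  Tight sets belonging to different heads of arcs leaving \<open>v\<close> meet \<open>S\<close> in disjoint sets, so at
  most \<open>card S\<close> of these arcs are blocked.
\<close>

lemma feasible_extend_from:
  assumes f: "feasible n S T q" and v: "v \<in> S" "v < n" and finS: "finite S" and W: "W \<subseteq> {..<n}"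
    and qW: "\<And>w. w \<in> W \<Longrightarrow> q v w > 0" and card: "card S < card W"
  shows "\<exists>w\<in>W. feasible n (insert w S) T (use_arc v w q)"
proof (rule ccontr)
  assume *: "\<not> ?thesis"
  have "\<exists>U. U \<subseteq> {..<n} \<and> U \<inter> S \<noteq> {} \<and> U \<inter> T = {} \<and> v \<notin> U \<and> w \<in> U \<and> cut_size n q U = 1"
    if "w \<in> W" for w
    using infeasible_tight_set[OF f v, of w] that * W qW by (metis lessThan_iff subsetD)
  then obtain U where U: "\<And>w. w \<in> W \<Longrightarrow> U w \<subseteq> {..<n} \<and> U w \<inter> S \<noteq> {} \<and> U w \<inter> T = {} \<and>
      v \<notin> U w \<and> w \<in> U w \<and> cut_size n q (U w) = 1" by metis
  then have "\<forall>w\<in>W. \<exists>x. x \<in> U w \<inter> S" by blast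
  then obtain x where x: "\<And>w. w \<in> W \<Longrightarrow> x w \<in> U w \<inter> S" by metis
  have "inj_on x W"
  proof (rule inj_onI, rule ccontr)
    fix w w' assume w: "w \<in> W" "w' \<in> W" "x w = x w'" "w \<noteq> w'"
    note Uw = U[OF w(1)] U[OF w(2)] and xw = x[OF w(1)] x[OF w(2)]
    \<comment> \<open>The intersection contains the shared vertex \<open>x w\<close> and misses
      \<open>T\<close>; the union is entered by both arcs from \<open>v\<close>. The cuts 1 and 2
      exceed the sum 1 + 1 allowed by submodularity.\<close>
    have "cut_size n q (U w \<inter> U w') \<ge> 1"
      by (rule feasible_cut_pos[OF f]) (use Uw xw w in auto)
    moreover have "cut_size n q (U w \<union> U w') \<ge> 2"
      by (rule cut_size_ge_arcs[of w w' v]) (use w Uw W qW v in auto)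
    ultimately show False using cut_size_submodular[of n q "U w" "U w'"] Uw by auto
  qed
  moreover have "x ` W \<subseteq> S" using x by auto
  ultimately have "card W \<le> card S" using finS by (metis card_inj_on_le)
  with card show False by simp
qed

text \<open>\<open>R\<close> is the set reachable from \<open>T\<close> once the arc is used; it is
  described by closure and minimality because the program delivers it in this form. A deficient set
  has cut 0 after the step, so its complement is closed, includes \<open>T\<close> and hence
  \<open>R\<close>, and \<open>w\<close> is not reached. Conversely, the complement of
  \<open>R\<close> misses \<open>T\<close> and is entered by nothing, so feasibility forces it to be
  empty.\<close>

lemma feasible_insert_iff_closure:
  assumes f: "feasible n S T q" and v: "v \<in> S" "v < n" "w < n" "q v w > 0" and S: "S \<subseteq> {..<n}"
    and R: "R \<subseteq> {..<n}" "T \<subseteq> R"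
    and closed: "\<And>a b. a \<in> R \<Longrightarrow> b < n \<Longrightarrow> use_arc v w q a b > 0 \<Longrightarrow> b \<in> R"
    and least: "\<And>X. X \<subseteq> {..<n} \<Longrightarrow> T \<subseteq> X \<Longrightarrow>
      (\<And>a b. a \<in> X \<Longrightarrow> b < n \<Longrightarrow> use_arc v w q a b > 0 \<Longrightarrow> b \<in> X) \<Longrightarrow> R \<subseteq> X"
  shows "feasible n (insert w S) T (use_arc v w q) \<longleftrightarrow> insert w S \<subseteq> R"
proof
  assume f': "feasible n (insert w S) T (use_arc v w q)"
  show "insert w S \<subseteq> R"
  proof (rule ccontr)
    assume "\<not> insert w S \<subseteq> R"
    then have ne: "{..<n} - R \<noteq> {}" using S v by auto
    have "cut_size n (use_arc v w q) ({..<n} - R) \<ge> 1"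
      by (rule feasible_cut_pos[OF f']) (use ne R in auto)
    then have "cut_size n (use_arc v w q) ({..<n} - R) > 0" by simp
    then show False unfolding cut_size_pos_iff using closed by auto
  qed
next
  assume sub: "insert w S \<subseteq> R"
  show "feasible n (insert w S) T (use_arc v w q)"
  proof (rule ccontr)
    assume "\<not> ?thesis"
    from infeasible_tight_set[OF f v this] obtain U where
      U: "U \<subseteq> {..<n}" "U \<inter> S \<noteq> {}" "U \<inter> T = {}" "v \<notin> U" "w \<in> U" "cut_size n q U = 1" by blast
    have "cut_size n q U = cut_size n (use_arc v w q) U + of_bool (v \<notin> U \<and> w \<in> U)"
      by (rule cut_size_use_arc) (use v in auto)
    with U have "\<not> cut_size n (use_arc v w q) U > 0" by simp
    then have "R \<subseteq> {..<n} - U"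
      unfolding cut_size_pos_iff using R U by (intro least) auto
    with sub U show False by auto
  qed
qed

section \<open>Partial arborescences\<close>

text \<open>
  A partial arborescence is given by its vertex set \<open>S\<close>, its parent function \<open>p\<close> and the labels
  \<open>l\<close>, where \<open>l v\<close> is the child of the root \<open>r\<close> above \<open>v\<close>. The labels make safety a
  matter of counting, see \<open>safe_labels\<close>.
\<close>

definition partial_tree :: "nat \<Rightarrow> nat set \<Rightarrow> (nat \<Rightarrow> nat) \<Rightarrow> (nat \<Rightarrow> nat) \<Rightarrow> bool" where
  "partial_tree r S p l \<longleftrightarrow> r \<in> S \<and> l r = r \<and>
     (\<exists>rk::nat \<Rightarrow> nat. \<forall>v\<in>S - {r}. p v \<in> S \<and> rk (p v) < rk v \<and> l v = (if p v = r then v else l (p v)))"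

lemma partial_tree_root: "partial_tree r S p l \<Longrightarrow> r \<in> S"
  and partial_tree_label_root: "partial_tree r S p l \<Longrightarrow> l r = r"
  and partial_tree_parent: "partial_tree r S p l \<Longrightarrow> v \<in> S \<Longrightarrow> v \<noteq> r \<Longrightarrow> p v \<in> S"
  and partial_tree_label: "partial_tree r S p l \<Longrightarrow> v \<in> S \<Longrightarrow> v \<noteq> r \<Longrightarrow>
    l v = (if p v = r then v else l (p v))"
  unfolding partial_tree_def by blast+

lemma partial_tree_singleton: "l r = r \<Longrightarrow> partial_tree r {r} p l"
  by (simp add: partial_tree_def)

lemma partial_tree_induct [consumes 3, case_names child step]:
  assumes t: "partial_tree r S p l" and "v \<in> S" "v \<noteq> r"
    and child: "\<And>v. v \<in> S \<Longrightarrow> v \<noteq> r \<Longrightarrow> p v = r \<Longrightarrow> P v"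
    and step: "\<And>v. v \<in> S \<Longrightarrow> v \<noteq> r \<Longrightarrow> p v \<noteq> r \<Longrightarrow> P (p v) \<Longrightarrow> P v"
  shows "P v"
proof -
  obtain rk :: "nat \<Rightarrow> nat" where rk: "\<And>v. v \<in> S \<Longrightarrow> v \<noteq> r \<Longrightarrow> p v \<in> S \<and> rk (p v) < rk v"
    using t unfolding partial_tree_def by blast
  show ?thesis using assms(2,3)
  proof (induction "rk v" arbitrary: v rule: less_induct)
    case less
    show ?case
    proof (cases "p v = r")
      case True
      with less.prems show ?thesis by (rule child)
    next
      case False
      have "P (p v)" using less.hyps[of "p v"] rk[OF less.prems] False by blast
      with less.prems False show ?thesis by (rule step)
    qed
  qed
qed

lemma partial_tree_label_in:
  assumes "partial_tree r S p l" "v \<in> S" "v \<noteq> r"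
  shows "l v \<in> S - {r}"
  using assms
proof (induction rule: partial_tree_induct)
  case (child v)
  then show ?case using partial_tree_label[OF assms(1)] by simp
next
  case (step v)
  then show ?case using partial_tree_label[OF assms(1)] by simp
qed

lemma partial_tree_insert:
  assumes t: "partial_tree r S p l" and v: "v \<in> S" and w: "w \<notin> S"
  shows "partial_tree r (insert w S) (p(w := v)) (l(w := if v = r then w else l v))"
proof -
  obtain rk :: "nat \<Rightarrow> nat" where rk: "\<forall>v\<in>S - {r}. p v \<in> S \<and> rk (p v) < rk v \<and>
      l v = (if p v = r then v else l (p v))"
    using t unfolding partial_tree_def by blast
  have "r \<in> S" "l r = r" using t by (auto simp: partial_tree_def)
  moreover have "\<forall>x\<in>insert w S - {r}. (p(w := v)) x \<in> insert w S \<and>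
      (rk(w := Suc (rk v))) ((p(w := v)) x) < (rk(w := Suc (rk v))) x \<and>
      (l(w := if v = r then w else l v)) x =
      (if (p(w := v)) x = r then x else (l(w := if v = r then w else l v)) ((p(w := v)) x))"
  proof
    fix x assume x: "x \<in> insert w S - {r}"
    show "(p(w := v)) x \<in> insert w S \<and>
      (rk(w := Suc (rk v))) ((p(w := v)) x) < (rk(w := Suc (rk v))) x \<and>
      (l(w := if v = r then w else l v)) x =
      (if (p(w := v)) x = r then x else (l(w := if v = r then w else l v)) ((p(w := v)) x))"
    proof (cases "x = w")
      case True
      then show ?thesis using v w by auto
    next
      case False
      then have "x \<in> S - {r}" using x by auto
      then have "p x \<in> S" "rk (p x) < rk x" "l x = (if p x = r then x else l (p x))"
        using rk by auto
      then show ?thesis using False w by auto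
    qed
  qed
  moreover from \<open>r \<in> S\<close> w have "r \<noteq> w" by blast
  ultimately show ?thesis unfolding partial_tree_def
    by (intro conjI exI[of _ "rk(w := Suc (rk v))"]) simp_all
qed

lemma partial_tree_remove_leaf:
  assumes t: "partial_tree r S p l" and x: "x \<noteq> r" and leaf: "\<And>y. y \<in> S \<Longrightarrow> y \<noteq> r \<Longrightarrow> p y \<noteq> x"
  shows "partial_tree r (S - {x}) p l"
proof -
  obtain rk :: "nat \<Rightarrow> nat" where rk: "\<forall>v\<in>S - {r}. p v \<in> S \<and> rk (p v) < rk v \<and>
      l v = (if p v = r then v else l (p v))"
    using t unfolding partial_tree_def by blast
  show ?thesis unfolding partial_tree_def
  proof (intro conjI exI[of _ rk] ballI)
    show "r \<in> S - {x}" "l r = r" using t x by (auto simp: partial_tree_def)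
    fix v assume "v \<in> S - {x} - {r}"
    then have v: "v \<in> S - {r}" by blast
    then show "p v \<in> S - {x}" using rk leaf by blast
    show "rk (p v) < rk v" "l v = (if p v = r then v else l (p v))" using rk v by blast+
  qed
qed

text \<open>A vertex of largest rank in \<open>A\<close> is a leaf, since a child would lie in
  \<open>A\<close> as well. It is applied to a whole branch and to the part of a kernel outside
  \<open>D\<close>.\<close>

lemma partial_tree_leaf:
  assumes t: "partial_tree r S p l" and A: "A \<subseteq> S - {r}" "A \<noteq> {}" "finite A"
    and closed: "\<And>y. y \<in> S \<Longrightarrow> y \<noteq> r \<Longrightarrow> p y \<in> A \<Longrightarrow> y \<in> A"
  shows "\<exists>x\<in>A. \<forall>y\<in>S - {r}. p y \<noteq> x"
proof -
  obtain rk :: "nat \<Rightarrow> nat" where rk: "\<forall>v\<in>S - {r}. rk (p v) < rk v"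
    using t unfolding partial_tree_def by blast
  have "Max (rk ` A) \<in> rk ` A" using A by (intro Max_in) auto
  then obtain x where x: "x \<in> A" "rk x = Max (rk ` A)" by auto
  have "p y \<noteq> x" if y: "y \<in> S - {r}" for y
  proof
    assume "p y = x"
    then have "y \<in> A" using closed x y by blast
    have "rk (p y) < rk y" using rk y by blast
    then have "rk x < rk y" using \<open>p y = x\<close> by simp
    then show False using \<open>y \<in> A\<close> x(2) A(3) by (metis Max_ge finite_imageI image_eqI not_le)
  qed
  with x show ?thesis by blast
qed

text \<open>The arc along which a tree path leaves \<open>D\<close>; it allows a known tree to be
  rebuilt from \<open>r\<close> one arc at a time.\<close>

lemma partial_tree_exit:
  assumes t: "partial_tree r S p l" and D: "r \<in> D" "D \<subset> S"
  shows "\<exists>w\<in>S - D. p w \<in> D"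
proof -
  obtain w where w: "w \<in> S - D" using D by blast
  have "w \<in> S" "w \<noteq> r" using w D by auto
  from t this have "w \<notin> D \<longrightarrow> ?thesis"
  proof (induction rule: partial_tree_induct)
    case (child v)
    then show ?case using D by auto
  next
    case (step v)
    then show ?case by auto
  qed
  with w show ?thesis by blast
qed

text \<open>The vertex at which the path from \<open>r\<close> to \<open>x\<close> leaves
  \<open>D\<close> qualifies: all vertices of this path other than \<open>r\<close> share one
  label.\<close>

lemma partial_tree_exit_label:
  assumes t: "partial_tree r S p l" and D: "r \<in> D" "D \<subseteq> S" and x: "x \<in> S - D"
  shows "\<exists>y\<in>S - D. p y \<in> D \<and> l y = l x"
proof -
  have "x \<in> S" "x \<noteq> r" using x D by auto
  from t this have "x \<notin> D \<longrightarrow> ?thesis"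
  proof (induction rule: partial_tree_induct)
    case (child v)
    then show ?case using D by auto
  next
    case (step v)
    have "l v = l (p v)" using partial_tree_label[OF t] step by simp
    with step show ?case by (cases "p v \<in> D") auto
  qed
  with x show ?thesis by blast
qed

text \<open>If \<open>c\<close> is not a child of \<open>r\<close>, then no vertex has label \<open>c\<close> and the condition says \<open>k \<le> card S\<close>.\<close>

definition safe_labels :: "nat \<Rightarrow> nat \<Rightarrow> nat \<Rightarrow> nat set \<Rightarrow> (nat \<Rightarrow> nat) \<Rightarrow> bool" where
  "safe_labels k n r S l \<longleftrightarrow> (\<forall>c<n. c \<noteq> r \<longrightarrow> k \<le> card {x \<in> S. l x \<noteq> c})"

text \<open>The reason for measuring safety by labels: vertices outside a branch are never lost when
  a tree grows, so a safe kernel makes every extension safe.\<close>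

lemma safe_labels_mono:
  assumes "safe_labels k n r S l" "S \<subseteq> S'" "finite S'" "\<And>x. x \<in> S \<Longrightarrow> l' x = l x"
  shows "safe_labels k n r S' l'"
  unfolding safe_labels_def
proof (intro allI impI)
  fix c assume "c < n" "c \<noteq> r"
  then have "k \<le> card {x \<in> S. l x \<noteq> c}" using assms(1) by (auto simp: safe_labels_def)
  also have "\<dots> \<le> card {x \<in> S'. l' x \<noteq> c}" using assms by (intro card_mono) auto
  finally show "k \<le> card {x \<in> S'. l' x \<noteq> c}" .
qed

definition uses_arc :: "nat \<Rightarrow> nat set \<Rightarrow> (nat \<Rightarrow> nat) \<Rightarrow> nat \<Rightarrow> nat \<Rightarrow> nat" where
  "uses_arc r S p u v = of_bool (v \<in> S \<and> v \<noteq> r \<and> p v = u)"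

section \<open>Initial segments of finite sets of numbers\<close>

lemma rank_in_set_bij:
  fixes A :: "nat set"
  assumes "finite A"
  shows "bij_betw (\<lambda>w. card {x \<in> A. x < w}) A {..<card A}"
proof -
  let ?f = "\<lambda>w. card {x \<in> A. x < w}"
  have lt: "?f w < ?f w'" if "w \<in> A" "w < w'" for w w'
  proof (rule psubset_card_mono)
    show "finite {x \<in> A. x < w'}" using assms by simp
    have "w \<in> {x \<in> A. x < w'}" "w \<notin> {x \<in> A. x < w}" using that by auto
    moreover have "{x \<in> A. x < w} \<subseteq> {x \<in> A. x < w'}" using that by auto
    ultimately show "{x \<in> A. x < w} \<subset> {x \<in> A. x < w'}" by blast
  qed
  have inj: "inj_on ?f A"
  proof (rule inj_onI)
    fix w w' assume "w \<in> A" "w' \<in> A" "?f w = ?f w'"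
    then show "w = w'" using lt[of w w'] lt[of w' w] by (metis less_irrefl nat_neq_iff)
  qed
  have "?f ` A \<subseteq> {..<card A}"
  proof
    fix y assume "y \<in> ?f ` A"
    then obtain w where w: "w \<in> A" "y = ?f w" by auto
    have "{x \<in> A. x < w} \<subset> A" using w by blast
    then show "y \<in> {..<card A}" using w assms by (simp add: psubset_card_mono)
  qed
  moreover have "card (?f ` A) = card {..<card A}" using inj by (simp add: card_image)
  ultimately have "?f ` A = {..<card A}" by (intro card_subset_eq) auto
  with inj show ?thesis by (simp add: bij_betw_def)
qed

lemma card_first_elements:
  fixes A :: "nat set"
  assumes "finite A"
  shows "card {w \<in> A. card {x \<in> A. x < w} < M} = min (card A) M"
proof -
  let ?f = "\<lambda>w. card {x \<in> A. x < w}"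
  note b = rank_in_set_bij[OF assms]
  have "?f ` {w \<in> A. ?f w < M} = {..<card A} \<inter> {..<M}"
    using b unfolding bij_betw_def by auto
  moreover have "inj_on ?f {w \<in> A. ?f w < M}"
    using b unfolding bij_betw_def by (auto intro: inj_on_subset)
  then have "card (?f ` {w \<in> A. ?f w < M}) = card {w \<in> A. ?f w < M}" by (rule card_image)
  ultimately have "card {w \<in> A. ?f w < M} = card ({..<card A} \<inter> {..<M})" by simp
  also have "{..<card A} \<inter> {..<M} = {..<min (card A) M}" by auto
  finally show ?thesis by simp
qed

section \<open>Extendable pairs of partial arborescences and their kernels\<close>

locale packing =
  fixes k n r :: nat and m :: "nat \<Rightarrow> nat \<Rightarrow> nat"
  assumes k_pos: "k > 0" and r_less: "r < n"
begin

text \<open>Disjointness up to the choice among parallel arcs: only the number of trees using a pair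
  \<open>(u, v)\<close> matters, and concrete indices are assigned in
  \<open>solution_imp_safe_packing\<close>.\<close>

definition packed :: "nat set \<Rightarrow> (nat \<Rightarrow> nat) \<Rightarrow> nat set \<Rightarrow> (nat \<Rightarrow> nat) \<Rightarrow> bool" where
  "packed S p T p' \<longleftrightarrow> (\<forall>u<n. \<forall>v<n. uses_arc r S p u v + uses_arc r T p' u v \<le> m u v)"

definition residual :: "nat set \<Rightarrow> (nat \<Rightarrow> nat) \<Rightarrow> nat set \<Rightarrow> (nat \<Rightarrow> nat) \<Rightarrow> nat \<Rightarrow> nat \<Rightarrow> nat" where
  "residual S p T p' u v = m u v - (uses_arc r S p u v + uses_arc r T p' u v)"

definition good ::
    "nat set \<Rightarrow> (nat \<Rightarrow> nat) \<Rightarrow> (nat \<Rightarrow> nat) \<Rightarrow> nat set \<Rightarrow> (nat \<Rightarrow> nat) \<Rightarrow> (nat \<Rightarrow> nat) \<Rightarrow> bool" where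
  "good S p l T p' l' \<longleftrightarrow> S \<subseteq> {..<n} \<and> T \<subseteq> {..<n} \<and> partial_tree r S p l \<and> partial_tree r T p' l' \<and>
     packed S p T p' \<and> feasible n S T (residual S p T p')"

lemma packed_commute: "packed S p T p' = packed T p' S p"
  by (simp add: packed_def add.commute)

lemma residual_commute: "residual S p T p' = residual T p' S p"
  by (simp add: residual_def fun_eq_iff add.commute)

lemma good_commute: "good S p l T p' l' = good T p' l' S p l"
  using feasible_commute residual_commute packed_commute unfolding good_def by metis

lemma good_finite: "good S p l T p' l' \<Longrightarrow> finite S \<and> finite T"
  unfolding good_def using finite_subset[of _ "{..<n}"] by auto

text \<open>Deleting a leaf reverses the addition of its arc: the old residual is
  \<open>use_arc\<close> applied to the new one, which is the situation of
  \<open>feasible_remove\<close>.\<close>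

lemma good_remove_leaf:
  assumes g: "good S p l T p' l'" and x: "x \<in> S" "x \<noteq> r"
    and leaf: "\<And>y. y \<in> S \<Longrightarrow> y \<noteq> r \<Longrightarrow> p y \<noteq> x"
  shows "good (S - {x}) p l T p' l'"
proof -
  from g have t: "partial_tree r S p l" and S: "S \<subseteq> {..<n}" and pk: "packed S p T p'"
    and f: "feasible n S T (residual S p T p')" by (auto simp: good_def)
  have px: "p x \<in> S" "p x \<noteq> x" using partial_tree_parent[OF t x] leaf x by auto
  have lt: "x < n" "p x < n" using px x S by auto
  have u: "uses_arc r S p a b = uses_arc r (S - {x}) p a b + of_bool (a = p x \<and> b = x)" for a b
    using x by (auto simp: uses_arc_def)
  have pk': "packed (S - {x}) p T p'"
    using pk unfolding packed_def u by force
  have le: "uses_arc r S p a b + uses_arc r T p' a b \<le> m a b" if "a < n" "b < n" for a b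
    using pk that unfolding packed_def by blast
  have "feasible n S T (residual S p T p') = feasible n S T (use_arc (p x) x (residual (S - {x}) p T p'))"
  proof (rule feasible_cong)
    fix a b assume "a < n" "b < n"
    from le[OF this] show "residual S p T p' a b = use_arc (p x) x (residual (S - {x}) p T p') a b"
      unfolding residual_def use_arc_def u by (auto simp: uses_arc_def)
  qed
  with f have "feasible n (insert x (S - {x})) T (use_arc (p x) x (residual (S - {x}) p T p'))"
    using x by (simp add: insert_absorb)
  then have "feasible n (S - {x}) T (residual (S - {x}) p T p')"
  proof (rule feasible_remove)
    show "residual (S - {x}) p T p' (p x) x > 0"
      using le[OF lt(2,1)] unfolding residual_def u by simp
  qed (use px lt in simp_all)
  moreover have "partial_tree r (S - {x}) p l" using t x(2) leaf by (rule partial_tree_remove_leaf)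
  ultimately show ?thesis using g pk' by (auto simp: good_def)
qed

lemma residual_insert:
  assumes "w \<notin> S" "w \<noteq> r"
  shows "residual (insert w S) (p(w := v)) T p' = use_arc v w (residual S p T p')"
proof (intro ext)
  fix a b
  have "uses_arc r (insert w S) (p(w := v)) a b = uses_arc r S p a b + of_bool (a = v \<and> b = w)"
    using assms by (auto simp: uses_arc_def)
  then show "residual (insert w S) (p(w := v)) T p' a b = use_arc v w (residual S p T p') a b"
    by (auto simp: residual_def use_arc_def)
qed

lemma packed_insert:
  assumes pk: "packed S p T p'" and w: "w \<notin> S" "w \<noteq> r" "residual S p T p' v w > 0"
  shows "packed (insert w S) (p(w := v)) T p'"
  unfolding packed_def
proof (intro allI impI)
  fix a b assume ab: "a < n" "b < n"
  have "uses_arc r (insert w S) (p(w := v)) a b = uses_arc r S p a b + of_bool (a = v \<and> b = w)"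
    using w by (auto simp: uses_arc_def)
  moreover have "uses_arc r S p a b + uses_arc r T p' a b \<le> m a b"
    using pk ab unfolding packed_def by blast
  ultimately show "uses_arc r (insert w S) (p(w := v)) a b + uses_arc r T p' a b \<le> m a b"
    using w(3) by (cases "a = v \<and> b = w") (auto simp: residual_def)
qed

lemma good_insert:
  assumes g: "good S p l T p' l'" and v: "v \<in> S" and w: "w < n" "w \<notin> S" "residual S p T p' v w > 0"
    and f: "feasible n (insert w S) T (use_arc v w (residual S p T p'))"
  shows "good (insert w S) (p(w := v)) (l(w := if v = r then w else l v)) T p' l'"
proof -
  have "w \<noteq> r" using g w partial_tree_root by (auto simp: good_def)
  then show ?thesis
    using g v w f partial_tree_insert[of r S p l v w] residual_insert packed_insert
    by (auto simp: good_def)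
qed

text \<open>The starting point of the reduction to kernels: when both trees span, every nonempty set
  meets both and demands nothing.\<close>

lemma good_spanning:
  assumes "partial_tree r {..<n} p l" "partial_tree r {..<n} p' l'" "packed {..<n} p {..<n} p'"
  shows "good {..<n} p l {..<n} p' l'"
  using assms unfolding good_def feasible_def by (auto simp: Int_absorb2)

text \<open>As long as there are at least \<open>2 * k + 1\<close> vertices, a leaf of a largest
  branch \<open>c0\<close> can be removed. The vertices outside \<open>c0\<close> are untouched; any
  other branch has at most half of the vertices other than \<open>r\<close>, so at least
  \<open>k\<close> vertices remain outside it after the deletion.\<close>

lemma safe_kernel:
  assumes "good S p l T p' l'" "safe_labels k n r S l" "n > 1"
  shows "\<exists>S'. good S' p l T p' l' \<and> safe_labels k n r S' l \<and> card S' \<le> 2 * k"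
  using assms(1,2)
proof (induction "card S" arbitrary: S rule: less_induct)
  case less
  show ?case
  proof (cases "card S \<le> 2 * k")
    case True
    with less.prems show ?thesis by blast
  next
    case False
    then have cS: "card S \<ge> 2 * k + 1" by simp
    have finS: "finite S" using good_finite less.prems by blast
    have t: "partial_tree r S p l" and Sn: "S \<subseteq> {..<n}" using less.prems by (auto simp: good_def)
    define N where "N c = card {x \<in> S. l x = c}" for c
    define C where "C = {..<n} - {r}"
    have r: "r \<in> S" "l r = r" using t partial_tree_root partial_tree_label_root by auto
    have "C \<noteq> {}"
    proof -
      have "(if r = 0 then 1 else 0) \<in> C" using assms(3) by (auto simp: C_def)
      then show ?thesis by blast
    qed
    then have "Max (N ` C) \<in> N ` C" by (intro Max_in) (auto simp: C_def)
    then obtain c0 where c0: "c0 \<in> C" "N c0 = Max (N ` C)" by auto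
    have max: "N c \<le> N c0" if "c \<in> C" for c using c0 that by (auto simp: C_def)
    have "\<not> S \<subseteq> {r}"
    proof
      assume "S \<subseteq> {r}"
      then have "card S \<le> 1" using card_mono[of "{r}" S] by simp
      with cS k_pos show False by simp
    qed
    then obtain v where v: "v \<in> S" "v \<noteq> r" by blast
    have "N (l v) > 0" using v finS by (auto simp: N_def card_gt_0_iff)
    moreover have "l v \<in> C" using partial_tree_label_in[OF t v] Sn by (auto simp: C_def)
    ultimately have "N c0 > 0" using max[of "l v"] by simp
    let ?A = "{x \<in> S. l x = c0}"
    have "\<exists>x\<in>?A. \<forall>y\<in>S - {r}. p y \<noteq> x"
    proof (rule partial_tree_leaf[OF t])
      show "?A \<subseteq> S - {r}" using r c0 by (auto simp: C_def)
      show "?A \<noteq> {}" using \<open>N c0 > 0\<close> by (auto simp: N_def card_gt_0_iff)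
      show "finite ?A" using finS by simp
      fix y assume y: "y \<in> S" "y \<noteq> r" "p y \<in> ?A"
      then have "p y \<noteq> r" using r c0 by (auto simp: C_def)
      then show "y \<in> ?A" using partial_tree_label[OF t y(1,2)] y by simp
    qed
    then obtain x where x: "x \<in> S" "l x = c0" and leaf: "\<And>y. y \<in> S \<Longrightarrow> y \<noteq> r \<Longrightarrow> p y \<noteq> x"
      by blast
    have "x \<noteq> r" using x r c0 by (auto simp: C_def)
    have g: "good (S - {x}) p l T p' l'"
      using less.prems(1) x(1) \<open>x \<noteq> r\<close> leaf by (rule good_remove_leaf)
    have "safe_labels k n r (S - {x}) l"
      unfolding safe_labels_def
    proof (intro allI impI)
      fix c assume c: "c < n" "c \<noteq> r"
      show "k \<le> card {y \<in> S - {x}. l y \<noteq> c}"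
      proof (cases "c = c0")
        case True
        then have "{y \<in> S - {x}. l y \<noteq> c} = {y \<in> S. l y \<noteq> c}" using x by auto
        then show ?thesis using less.prems(2) c by (auto simp: safe_labels_def)
      next
        case False
        have "c \<in> C" using c by (auto simp: C_def)
        let ?B = "{y \<in> S. l y = c}"
        have "card (?A \<union> ?B) = N c0 + N c"
          unfolding N_def using finS False by (intro card_Un_disjoint) auto
        moreover have "?A \<union> ?B \<subseteq> S - {r}" using r c c0 by (auto simp: C_def)
        then have "card (?A \<union> ?B) \<le> card (S - {r})" using finS by (intro card_mono) auto
        moreover have "card (S - {r}) = card S - 1" using r finS by simp
        ultimately have N2: "2 * N c + 1 \<le> card S" using max[OF \<open>c \<in> C\<close>] cS by simp
        have "{y \<in> S - {x}. l y \<noteq> c} = S - insert x ?B" by auto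
        moreover have "card (S - insert x ?B) = card S - card (insert x ?B)"
          using x finS by (intro card_Diff_subset) auto
        moreover have "card (insert x ?B) = N c + 1" using x False finS by (simp add: N_def)
        ultimately show ?thesis using N2 cS by simp
      qed
    qed
    moreover have "card (S - {x}) < card S" using x finS by (meson card_Diff1_less)
    ultimately show ?thesis using less.hyps[of "S - {x}"] g by blast
  qed
qed

text \<open>Out-neighbours are counted once whatever their multiplicity. The constant: of
  \<open>6 * k\<close> of them at most \<open>4 * k\<close> lie in the two kernels, and the
  remaining \<open>2 * k\<close> exceed the size of a kernel from which a leaf has been removed, as
  \<open>feasible_extend_from\<close> demands.\<close>

definition first_arc :: "nat \<Rightarrow> nat \<Rightarrow> bool" where
  "first_arc v w \<longleftrightarrow> m v w > 0 \<and> card {x. x < w \<and> m v x > 0} < 6 * k"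

lemma first_arcs_eq:
  "{w. w < n \<and> first_arc v w} =
     {w \<in> {x. x < n \<and> m v x > 0}. card {x \<in> {x. x < n \<and> m v x > 0}. x < w} < 6 * k}"
proof -
  have "{x. x < w \<and> m v x > 0} = {x \<in> {x. x < n \<and> m v x > 0}. x < w}" if "w < n" for w
    using that by auto
  then show ?thesis by (auto simp: first_arc_def)
qed

lemma card_first_arcs_le: "card {w. w < n \<and> first_arc v w} \<le> 6 * k"
  unfolding first_arcs_eq by (subst card_first_elements) auto

lemma card_first_arcs_ge:
  assumes "w < n" "m v w > 0" "\<not> first_arc v w"
  shows "card {w. w < n \<and> first_arc v w} \<ge> 6 * k"
proof -
  have "6 * k \<le> card {x. x < w \<and> m v x > 0}" using assms by (auto simp: first_arc_def)
  also have "\<dots> \<le> card {x. x < n \<and> m v x > 0}" using assms by (intro card_mono) auto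
  finally show ?thesis unfolding first_arcs_eq by (subst card_first_elements) auto
qed

text \<open>
  Exchange argument: \<open>D\<close> is a part of the tree that only uses first arcs. A leaf outside \<open>D\<close> is
  replaced by a new leaf attached, with a first arc, to a vertex of \<open>D\<close> of large out-degree.
\<close>

lemma exchange:
  assumes "good S p l T p' l'" "safe_labels k n r S l" "card S \<le> 2 * k" "card T \<le> 2 * k" "n > 1"
    and "r \<in> D" "D \<subseteq> S" "\<And>v. v \<in> D \<Longrightarrow> v \<noteq> r \<Longrightarrow> p v \<in> D \<and> first_arc (p v) v"
  shows "\<exists>S' q l''. good S' q l'' T p' l' \<and> safe_labels k n r S' l'' \<and> card S' \<le> 2 * k \<and>
           (\<forall>v\<in>S' - {r}. first_arc (q v) v)"
  using assms
proof (induction "card (S - D)" arbitrary: S p l D rule: less_induct)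
  case less
  note g = less.prems(1) and sf = less.prems(2) and cS = less.prems(3) and rD = less.prems(6)
    and DS = less.prems(7) and DD = less.prems(8)
  have fin: "finite S" "finite T" using good_finite g by blast+
  have t: "partial_tree r S p l" and Sn: "S \<subseteq> {..<n}" and pk: "packed S p T p'"
    using g by (auto simp: good_def)
  have mpos: "m (p v) v > 0" if "v \<in> S" "v \<noteq> r" for v
  proof -
    have "p v < n" "v < n" using partial_tree_parent[OF t that] that Sn by auto
    then have "uses_arc r S p (p v) v + uses_arc r T p' (p v) v \<le> m (p v) v"
      using pk unfolding packed_def by blast
    then show ?thesis using that by (simp add: uses_arc_def)
  qed
  show ?case
  proof (cases "S = D")
    case True
    then show ?thesis using g sf cS DD by blast
  next
    case False
    show ?thesis
    proof (cases "\<exists>v\<in>S - D. p v \<in> D \<and> first_arc (p v) v")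
      case True
      then obtain v where v: "v \<in> S - D" "p v \<in> D" "first_arc (p v) v" by blast
      have "card (S - insert v D) < card (S - D)"
        using v fin by (intro psubset_card_mono) auto
      then show ?thesis
        using v DD rD DS by (intro less.hyps[of S "insert v D" p l] g sf cS less.prems(4,5)) auto
    next
      case noext: False
      let ?A = "S - D"
      have "\<exists>x\<in>?A. \<forall>y\<in>S - {r}. p y \<noteq> x"
      proof (rule partial_tree_leaf[OF t])
        show "?A \<subseteq> S - {r}" "?A \<noteq> {}" "finite ?A" using rD False DS fin by auto
        fix y assume "y \<in> S" "y \<noteq> r" "p y \<in> ?A"
        then show "y \<in> ?A" using DD by auto
      qed
      then obtain x where x: "x \<in> S - D" and leaf: "\<And>y. y \<in> S \<Longrightarrow> y \<noteq> r \<Longrightarrow> p y \<noteq> x"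
        by blast
      have xr: "x \<noteq> r" using x rD by auto
      \<comment> \<open>The path from \<open>r\<close> to the leaf \<open>x\<close> leaves
        \<open>D\<close> through an arc that is not a first arc, so the tail of this arc has
        \<open>6 * k\<close> first arcs.\<close>
      obtain y where y: "y \<in> S - D" "p y \<in> D" "l y = l x"
        using partial_tree_exit_label[OF t rD DS x] by blast
      have yr: "y \<noteq> r" using y rD by auto
      define v where "v = p y"
      have v: "v \<in> S" "v \<in> D" "v < n" using y DS Sn by (auto simp: v_def)
      let ?S = "S - {x}"
      have gx: "good ?S p l T p' l'"
        using g _ xr leaf by (rule good_remove_leaf) (use x in auto)
      let ?q = "residual ?S p T p'"
      let ?W = "{w. w < n \<and> first_arc v w} - S - T"
      have "m v y > 0" "\<not> first_arc v y" using mpos[of y] noext y yr by (auto simp: v_def)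
      moreover have "y < n" using y Sn by auto
      ultimately have "card {w. w < n \<and> first_arc v w} \<ge> 6 * k" by (intro card_first_arcs_ge)
      moreover have "card {w. w < n \<and> first_arc v w} - card S \<le> card ({w. w < n \<and> first_arc v w} - S)"
        using fin by (intro diff_card_le_card_Diff) auto
      moreover have "card ({w. w < n \<and> first_arc v w} - S) - card T \<le> card ?W"
        using fin by (intro diff_card_le_card_Diff) auto
      ultimately have cW: "2 * k \<le> card ?W" using cS less.prems(4) by linarith
      have cx: "card ?S < card S" using x fin by (meson DiffD1 card_Diff1_less)
      have "\<exists>w\<in>?W. feasible n (insert w ?S) T (use_arc v w ?q)"
      proof (rule feasible_extend_from)
        show "feasible n ?S T ?q" using gx by (auto simp: good_def)
        show "v \<in> ?S" using v x by auto
        show "v < n" by fact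
        show "finite ?S" using fin by simp
        show "?W \<subseteq> {..<n}" by auto
        \<comment> \<open>\<open>w\<close> lies in neither tree, so no copy of an arc into
          \<open>w\<close> is in use.\<close>
        show "0 < ?q v w" if "w \<in> ?W" for w
          using that by (auto simp: residual_def uses_arc_def first_arc_def)
        show "card ?S < card ?W" using cx cW cS by linarith
      qed
      then obtain w where w: "w < n" "first_arc v w" "w \<notin> S" "w \<notin> T"
        and fw: "feasible n (insert w ?S) T (use_arc v w ?q)" by blast
      let ?p = "p(w := v)" and ?l = "l(w := if v = r then w else l v)"
      let ?S' = "insert w ?S"
      have g': "good ?S' ?p ?l T p' l'"
      proof (rule good_insert[OF gx])
        show "0 < ?q v w" using w by (auto simp: residual_def uses_arc_def first_arc_def)
      qed (use v x w fw in auto)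
      \<comment> \<open>The new leaf joins the branch of \<open>x\<close> or founds one: if
        \<open>v \<noteq> r\<close>, then \<open>v\<close>, \<open>y\<close> and \<open>x\<close>
        carry the same label. For every other branch it replaces \<open>x\<close> in the
        count.\<close>
      have lab: "?l w = w \<or> ?l w = l x"
      proof (cases "v = r")
        case False
        then have "l y = l v" using partial_tree_label[OF t, of y] y yr by (simp add: v_def)
        then show ?thesis using y False by simp
      qed simp
      have kx: "k \<le> card {y \<in> S. l y \<noteq> l x}"
      proof -
        have "l x \<in> S - {r}" using partial_tree_label_in[OF t _ xr] x by blast
        then show ?thesis using sf Sn by (auto simp: safe_labels_def)
      qed
      have sf': "safe_labels k n r ?S' ?l"
        unfolding safe_labels_def
      proof (intro allI impI)
        fix c assume c: "c < n" "c \<noteq> r"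
        have lS: "l z \<noteq> w" if "z \<in> S" for z
        proof (cases "z = r")
          case True
          then show ?thesis using partial_tree_label_root[OF t] that w by auto
        next
          case False
          then show ?thesis using partial_tree_label_in[OF t that False] w by auto
        qed
        show "k \<le> card {z \<in> ?S'. ?l z \<noteq> c}"
        proof (cases "c = w")
          case True
          \<comment> \<open>Only the new leaf can carry the label \<open>w\<close>; already the
            vertices outside the branch of \<open>x\<close>, all of which survive the exchange, give
            \<open>k\<close>.\<close>
          have "card {y \<in> S. l y \<noteq> l x} \<le> card {z \<in> ?S'. ?l z \<noteq> c}"
          proof (rule card_mono)
            show "{y \<in> S. l y \<noteq> l x} \<subseteq> {z \<in> ?S'. ?l z \<noteq> c}" using True lS w by auto
          qed (use fin in simp)
          with kx show ?thesis by simp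
        next
          case False
          have kc: "k \<le> card {z \<in> S. l z \<noteq> c}" using sf c by (auto simp: safe_labels_def)
          show ?thesis
          proof (cases "l x = c")
            case True
            have "card {z \<in> S. l z \<noteq> c} \<le> card {z \<in> ?S'. ?l z \<noteq> c}"
              by (rule card_mono) (use fin True w in auto)
            with kc show ?thesis by simp
          next
            case nc: False
            then have lw: "?l w \<noteq> c" using lab False by auto
            have "{z \<in> ?S'. ?l z \<noteq> c} = insert w ({z \<in> S. l z \<noteq> c} - {x})"
              using lw w by auto
            moreover have "card (insert w ({z \<in> S. l z \<noteq> c} - {x})) = card {z \<in> S. l z \<noteq> c}"
            proof -
              have "card (insert w ({z \<in> S. l z \<noteq> c} - {x})) = Suc (card ({z \<in> S. l z \<noteq> c} - {x}))"
                using fin w by (intro card_insert_disjoint) auto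
              also have "\<dots> = card {z \<in> S. l z \<noteq> c}"
                using fin x nc by (intro card_Suc_Diff1) auto
              finally show ?thesis .
            qed
            ultimately show ?thesis using kc by simp
          qed
        qed
      qed
      have "card ?S' = card S"
      proof -
        have "card ?S' = Suc (card (S - {x}))" using fin w by (intro card_insert_disjoint) auto
        also have "\<dots> = card S" using fin x by (intro card_Suc_Diff1) auto
        finally show ?thesis .
      qed
      then have cS': "card ?S' \<le> 2 * k" using cS by simp
      \<comment> \<open>\<open>x\<close> has left the part outside \<open>D\<close>, and the new
        leaf is put into \<open>D\<close> at once, its arc being a first arc.\<close>
      have "card (?S' - insert w D) < card (S - D)"
        using x fin w by (intro psubset_card_mono) auto
      then show ?thesis
      proof (rule less.hyps[OF _ g' sf' cS' less.prems(4,5)])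
        show "r \<in> insert w D" using rD by simp
        show "insert w D \<subseteq> ?S'" using DS x by auto
        show "?p z \<in> insert w D \<and> first_arc (?p z) z" if "z \<in> insert w D" "z \<noteq> r" for z
          using that DD v w by (cases "z = w") (auto simp: fun_upd_def)
      qed
    qed
  qed
qed

text \<open>Both requirements are met for one tree at a time. Each step changes one tree and keeps
  the pair \<open>good\<close>, so what was achieved for the other tree remains true;
  \<open>good_commute\<close> exchanges the roles.\<close>

lemma ex_small_kernels:
  assumes "partial_tree r {..<n} p l" "partial_tree r {..<n} p' l'" "packed {..<n} p {..<n} p'"
    and "safe_labels k n r {..<n} l" "safe_labels k n r {..<n} l'" "n > 1"
  obtains S q h T q' h' where "good S q h T q' h'" "safe_labels k n r S h" "safe_labels k n r T h'"
    "card S \<le> 2 * k" "card T \<le> 2 * k" "\<forall>v\<in>S - {r}. first_arc (q v) v" "\<forall>v\<in>T - {r}. first_arc (q' v) v"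
proof -
  note g0 = good_spanning[OF assms(1-3)]
  obtain S where S: "good S p l {..<n} p' l'" "safe_labels k n r S l" "card S \<le> 2 * k"
    using safe_kernel[OF g0 assms(4,6)] by blast
  obtain T where T: "good T p' l' S p l" "safe_labels k n r T l'" "card T \<le> 2 * k"
    using safe_kernel[OF _ assms(5,6)] S(1) good_commute by blast
  have g1: "good S p l T p' l'" using T(1) by (simp add: good_commute)
  have rS: "r \<in> S" "r \<in> T" using g1 partial_tree_root by (auto simp: good_def)
  obtain S' q h where S': "good S' q h T p' l'" "safe_labels k n r S' h" "card S' \<le> 2 * k"
      "\<forall>v\<in>S' - {r}. first_arc (q v) v"
    using exchange[OF g1 S(2,3) T(3) assms(6), of "{r}"] rS by auto
  have g2: "good T p' l' S' q h" using S'(1) by (simp add: good_commute)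
  obtain T' q' h' where T': "good T' q' h' S' q h" "safe_labels k n r T' h'" "card T' \<le> 2 * k"
      "\<forall>v\<in>T' - {r}. first_arc (q' v) v"
    using exchange[OF g2 T(2,3) S'(3) assms(6), of "{r}"] rS by auto
  have "good S' q h T' q' h'" using T'(1) by (simp add: good_commute)
  with S' T' that show ?thesis by blast
qed

end

section \<open>Arborescences as parent functions\<close>

text \<open>Turns a bare parent function into a partial tree. Instead of acyclicity it assumes that
  each parent-closed proper part around the root can be left along an arc, which is what
  connectivity provides; ranks and labels come from adding the vertices in this order.\<close>

lemma ex_partial_tree:
  assumes "finite V" "r \<in> V" and exit: "\<And>S. r \<in> S \<Longrightarrow> S \<subset> V \<Longrightarrow>
      (\<And>v. v \<in> S \<Longrightarrow> v \<noteq> r \<Longrightarrow> p v \<in> S) \<Longrightarrow> \<exists>w\<in>V - S. p w \<in> S"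
  shows "\<exists>l. partial_tree r V p l"
proof -
  have "\<exists>l. partial_tree r V p l" if "partial_tree r S p l" "S \<subseteq> V" for S l
    using that
  proof (induction "card (V - S)" arbitrary: S l rule: less_induct)
    case less
    show ?case
    proof (cases "S = V")
      case True
      with less.prems show ?thesis by blast
    next
      case False
      have "\<exists>w\<in>V - S. p w \<in> S"
      proof (rule exit)
        show "r \<in> S" using less.prems(1) by (rule partial_tree_root)
        show "S \<subset> V" using less.prems(2) False by blast
        show "p v \<in> S" if "v \<in> S" "v \<noteq> r" for v
          using less.prems(1) that by (rule partial_tree_parent)
      qed
      then obtain w where w: "w \<in> V - S" "p w \<in> S" by blast
      let ?l = "l(w := if p w = r then w else l (p w))"
      have "partial_tree r (insert w S) (p(w := p w)) ?l"
        using partial_tree_insert[OF less.prems(1) w(2)] w(1) by blast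
      then have "partial_tree r (insert w S) p ?l" by (simp only: fun_upd_triv)
      moreover have "card (V - insert w S) < card (V - S)"
        using w assms(1) by (intro psubset_card_mono) auto
      ultimately show ?thesis using less.hyps[of "insert w S" ?l] w less.prems(2) by auto
    qed
  qed
  from this[OF partial_tree_singleton[of "\<lambda>x. x" r p]] assms(2) show ?thesis by simp
qed

lemma partial_tree_label_child:
  assumes "partial_tree r S p l" "v \<in> S" "v \<noteq> r"
  shows "p (l v) = r"
  using assms
proof (induction rule: partial_tree_induct)
  case (child v)
  then show ?case using partial_tree_label[OF assms(1)] by simp
next
  case (step v)
  then show ?case using partial_tree_label[OF assms(1)] by simp
qed

lemma reachable_label:
  assumes t: "partial_tree r V p l" and V: "verts X = V" and "wf_digraph X"
    and dom: "\<And>u v. u \<rightarrow>\<^bsub>X\<^esub> v \<longleftrightarrow> v \<in> V \<and> v \<noteq> r \<and> p v = u"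
    and reach: "v \<rightarrow>\<^sup>*\<^bsub>X\<^esub> w" and v: "v \<noteq> r"
  shows "w \<noteq> r \<and> l w = l v"
proof -
  interpret wf_digraph X by fact
  from reach show ?thesis
  proof (induction rule: reachable_induct)
    case base
    then show ?case using v by simp
  next
    case (step x y)
    then have "y \<in> V" "y \<noteq> r" "p y = x" using dom by auto
    then show ?case using partial_tree_label[OF t, of y] step by simp
  qed
qed

lemma reachable_child:
  assumes t: "partial_tree r V p l" and V: "verts X = V" and "wf_digraph X"
    and dom: "\<And>u v. u \<rightarrow>\<^bsub>X\<^esub> v \<longleftrightarrow> v \<in> V \<and> v \<noteq> r \<and> p v = u"
    and w: "w \<in> V" "w \<noteq> r"
  shows "l w \<rightarrow>\<^sup>*\<^bsub>X\<^esub> w"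
proof -
  interpret wf_digraph X by fact
  from t w show ?thesis
  proof (induction rule: partial_tree_induct)
    case (child v)
    then show ?case using partial_tree_label[OF t, of v] V by simp
  next
    case (step v)
    then have "p v \<rightarrow>\<^bsub>X\<^esub> v" "l v = l (p v)" using dom partial_tree_label[OF t, of v] by auto
    with step show ?case by (metis reachable_adj_trans)
  qed
qed

text \<open>For a child \<open>c\<close> of \<open>r\<close> the vertices not reachable from
  \<open>c\<close> are those with a label other than \<open>c\<close>. A deeper vertex reaches only
  part of its branch, so its condition follows from that of its label.\<close>

lemma safe_iff_safe_labels:
  assumes t: "partial_tree r {..<n} p l" and V: "verts X = {..<n}" and wf: "wf_digraph X"
    and dom: "\<And>u v. u \<rightarrow>\<^bsub>X\<^esub> v \<longleftrightarrow> v \<in> {..<n} \<and> v \<noteq> r \<and> p v = u"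
  shows "safe k r X \<longleftrightarrow> safe_labels k n r {..<n} l"
proof -
  have sub: "card (verts X) - card (verts (subarborescence X v)) = card ({..<n} - {w. v \<rightarrow>\<^sup>*\<^bsub>X\<^esub> w})" for v
  proof -
    have "{w. v \<rightarrow>\<^sup>*\<^bsub>X\<^esub> w} \<subseteq> {..<n}" using V reachable_in_vertsE by fastforce
    then show ?thesis by (simp add: subarborescence_def V card_Diff_subset finite_subset)
  qed
  have child: "{..<n} - {w. c \<rightarrow>\<^sup>*\<^bsub>X\<^esub> w} = {w \<in> {..<n}. l w \<noteq> c}" if c: "c < n" "c \<noteq> r" "p c = r" for c
  proof -
    have lc: "l c = c" using partial_tree_label[OF t, of c] c by simp
    have "c \<rightarrow>\<^sup>*\<^bsub>X\<^esub> w \<longleftrightarrow> l w = c" if w: "w < n" for w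
    proof
      assume "c \<rightarrow>\<^sup>*\<^bsub>X\<^esub> w"
      then show "l w = c" using reachable_label[OF t V wf dom _ c(2)] lc by simp
    next
      assume lw: "l w = c"
      then have "w \<noteq> r" using partial_tree_label_root[OF t] c by auto
      then show "c \<rightarrow>\<^sup>*\<^bsub>X\<^esub> w" using reachable_child[OF t V wf dom, of w] w lw by simp
    qed
    then show ?thesis by auto
  qed
  show ?thesis
  proof
    assume s: "safe k r X"
    have ch: "k \<le> card {w \<in> {..<n}. l w \<noteq> c}" if c: "c < n" "c \<noteq> r" "p c = r" for c
    proof -
      have "c \<in> verts X - {r}" using c V by simp
      then have "k \<le> card (verts X) - card (verts (subarborescence X c))"
        using s unfolding safe_def by blast
      then show ?thesis unfolding sub child[OF c] .
    qed
    show "safe_labels k n r {..<n} l"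
      unfolding safe_labels_def
    proof (intro allI impI)
      fix c assume c: "c < n" "c \<noteq> r"
      show "k \<le> card {x \<in> {..<n}. l x \<noteq> c}"
      proof (cases "p c = r")
        case True
        with ch c show ?thesis by blast
      next
        case False
        \<comment> \<open>A vertex \<open>c\<close> that is no child of \<open>r\<close> is nobody's
          label, so every vertex is counted; the condition for the branch containing
          \<open>c\<close> already provides \<open>k\<close> vertices.\<close>
        have ne: "l x \<noteq> c" if "x < n" for x
          using partial_tree_label_child[OF t, of x] partial_tree_label_root[OF t] False c that
          by (cases "x = r") auto
        have "l c < n" "l c \<noteq> r" "p (l c) = r"
          using partial_tree_label_in[OF t, of c] partial_tree_label_child[OF t, of c] c by auto
        from ch[OF this] have "k \<le> card {w \<in> {..<n}. l w \<noteq> l c}" .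
        also have "\<dots> \<le> card {x \<in> {..<n}. l x \<noteq> c}" using ne by (intro card_mono) auto
        finally show ?thesis .
      qed
    qed
  next
    assume sl: "safe_labels k n r {..<n} l"
    show "safe k r X"
      unfolding safe_def sub
    proof
      fix v assume "v \<in> verts X - {r}"
      then have v: "v < n" "v \<noteq> r" using V by auto
      have "l v < n" "l v \<noteq> r" using partial_tree_label_in[OF t, of v] v by auto
      then have "k \<le> card {x \<in> {..<n}. l x \<noteq> l v}" using sl unfolding safe_labels_def by blast
      also have "\<dots> \<le> card ({..<n} - {w. v \<rightarrow>\<^sup>*\<^bsub>X\<^esub> w})"
        using reachable_label[OF t V wf dom _ v(2)] by (intro card_mono) auto
      finally show "k \<le> card ({..<n} - {w. v \<rightarrow>\<^sup>*\<^bsub>X\<^esub> w})" .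
    qed
  qed
qed

text \<open>The parent is the tail of the unique entering arc. For a parent-closed set around
  \<open>r\<close>, an undirected path to a vertex outside crosses the boundary, and the crossing
  arc cannot point inwards, since its tail would be the parent of a vertex inside.\<close>

lemma arborescence_imp_partial_tree:
  assumes X: "safe_spanning_arborescence k (multidigraph n m) r X"
  shows "\<exists>p l i. partial_tree r {..<n} p l \<and> safe_labels k n r {..<n} l \<and>
    (\<forall>v<n. v \<noteq> r \<longrightarrow> (p v, v, i v) \<in> arcs X \<and> i v < m (p v) v)"
proof -
  from X have sp: "spanning X (multidigraph n m)" and arb: "arborescence r X" and sf: "safe k r X"
    by (auto simp: safe_spanning_arborescence_def)
  have V: "verts X = {..<n}" using sp unfolding spanning_def by (simp add: multidigraph_def)
  have sub: "subgraph X (multidigraph n m)" using sp unfolding spanning_def by blast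
  have tl: "tail X = fst" and hd: "head X = fst \<circ> snd"
    using sub unfolding subgraph_def compatible_def by (simp_all add: multidigraph_def)
  have arcsX: "arcs X \<subseteq> {(u, v, i). u < n \<and> v < n \<and> i < m u v}"
    using sub unfolding subgraph_def by (simp add: multidigraph_def)
  have wf: "wf_digraph X" using sub unfolding subgraph_def by blast
  interpret wf_digraph X by fact
  have conn: "strongly_connected (mk_symmetric X)" and r: "r < n" and r0: "in_degree X r = 0"
    and d1: "\<And>v. v < n \<Longrightarrow> v \<noteq> r \<Longrightarrow> in_degree X v = 1" and fin: "finite (arcs X)"
    using arb V unfolding arborescence_def underlying_tree_def connected_def
    by (simp_all add: fin_digraph.finite_arcs)
  have "\<exists>e. in_arcs X v = {e}" if "v < n" "v \<noteq> r" for v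
    using d1[OF that] by (auto simp: in_degree_def card_1_singleton_iff)
  then obtain e where e: "\<And>v. v < n \<Longrightarrow> v \<noteq> r \<Longrightarrow> in_arcs X v = {e v}" by metis
  define p where "p v = fst (e v)" for v
  define i where "i v = snd (snd (e v))" for v
  have ev: "e v \<in> arcs X \<and> e v = (p v, v, i v)" if v: "v < n" "v \<noteq> r" for v
  proof -
    have "e v \<in> in_arcs X v" using e[OF v] by simp
    then show ?thesis using hd by (cases "e v") (auto simp: p_def i_def)
  qed
  have noroot: "h \<noteq> r" if "(u, h, j) \<in> arcs X" for u h j
  proof
    assume "h = r"
    with that have "(u, h, j) \<in> in_arcs X r" using hd by simp
    moreover have "in_arcs X r = {}" using r0 fin by (simp add: in_degree_def in_arcs_def)
    ultimately show False by simp
  qed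
  have arc: "p h = u" if "(u, h, j) \<in> arcs X" for u h j
  proof -
    have "h < n" "h \<noteq> r" using that arcsX noroot by auto
    moreover have "(u, h, j) \<in> in_arcs X h" using that hd by simp
    ultimately have "(u, h, j) \<in> {e h}" using e[of h] by blast
    then have "e h = (u, h, j)" by simp
    then show ?thesis by (simp add: p_def)
  qed
  have dom: "u \<rightarrow>\<^bsub>X\<^esub> v \<longleftrightarrow> v \<in> {..<n} \<and> v \<noteq> r \<and> p v = u" for u v
  proof
    assume "u \<rightarrow>\<^bsub>X\<^esub> v"
    then obtain j where "(u, v, j) \<in> arcs X" using tl hd by (auto simp: arcs_ends_conv)
    then show "v \<in> {..<n} \<and> v \<noteq> r \<and> p v = u" using arc noroot arcsX by auto
  next
    assume "v \<in> {..<n} \<and> v \<noteq> r \<and> p v = u"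
    then have "(u, v, i v) \<in> arcs X" using ev[of v] by auto
    then show "u \<rightarrow>\<^bsub>X\<^esub> v" using tl hd by (force simp: arcs_ends_conv)
  qed
  have "\<exists>l. partial_tree r {..<n} p l"
  proof (rule ex_partial_tree)
    fix S assume S: "r \<in> S" "S \<subset> {..<n}" and cl: "\<And>v. v \<in> S \<Longrightarrow> v \<noteq> r \<Longrightarrow> p v \<in> S"
    show "\<exists>w\<in>{..<n} - S. p w \<in> S"
    proof (rule ccontr)
      assume no: "\<not> ?thesis"
      obtain w where w: "w < n" "w \<notin> S" using S by blast
      interpret M: pair_wf_digraph "mk_symmetric X" ..
      have "r \<rightarrow>\<^sup>*\<^bsub>with_proj (mk_symmetric X)\<^esub> w" using conn r w V unfolding strongly_connected_def by simp
      then have "(r, w) \<in> (parcs (mk_symmetric X))\<^sup>*" using reachable_rtranclI by fastforce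
      then have "w \<in> S \<or> (\<exists>a b. a \<in> S \<and> b \<notin> S \<and> (a, b) \<in> parcs (mk_symmetric X))"
        by (induction rule: rtrancl_induct) (use S in blast)+
      then obtain a b where ab: "a \<in> S" "b \<notin> S" "(a, b) \<in> parcs (mk_symmetric X)" using w by blast
      then have "a \<rightarrow>\<^bsub>X\<^esub> b \<or> b \<rightarrow>\<^bsub>X\<^esub> a" by (auto simp: parcs_mk_symmetric arcs_ends_conv)
      with dom have "(b < n \<and> p b = a) \<or> (a \<noteq> r \<and> a < n \<and> p a = b)" by auto
      with no cl ab show False by auto
    qed
  qed (use r in auto)
  then obtain l where l: "partial_tree r {..<n} p l" by blast
  have "safe_labels k n r {..<n} l" using safe_iff_safe_labels[OF l V wf dom] sf by simp
  moreover have "(p v, v, i v) \<in> arcs X \<and> i v < m (p v) v" if v: "v < n" "v \<noteq> r" for v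
  proof -
    have "(p v, v, i v) \<in> arcs X" using ev[OF v] by auto
    with arcsX show ?thesis by auto
  qed
  ultimately show ?thesis using l by blast
qed

lemma output_digraph_simps [simp]:
  "verts (output_digraph n r p i) = {..<n}"
  "arcs (output_digraph n r p i) = (\<lambda>v. (p v, v, i v)) ` ({..<n} - {r})"
  "tail (output_digraph n r p i) = fst"
  "head (output_digraph n r p i) = fst \<circ> snd"
  by (simp_all add: output_digraph_def)

lemma output_digraph_dominates:
  "u \<rightarrow>\<^bsub>output_digraph n r p i\<^esub> v \<longleftrightarrow> v \<in> {..<n} \<and> v \<noteq> r \<and> p v = u"
  by (auto simp: arcs_ends_conv image_iff)

text \<open>The vertex of largest rank of a cycle would be the head of two arcs.\<close>

lemma output_digraph_no_cycle:
  assumes rk: "\<And>v. v < n \<Longrightarrow> v \<noteq> r \<Longrightarrow> rk (p v) < (rk v :: nat)"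
  shows "\<not> underlying_cycle (output_digraph n r p i) vs es"
proof
  let ?X = "output_digraph n r p i"
  let ?L = "length vs"
  assume "underlying_cycle ?X vs es"
  then have ne: "vs \<noteq> []" and len: "length es = ?L" and dv: "distinct vs" and de: "distinct es"
    and es: "set es \<subseteq> arcs ?X"
    and ends: "\<And>j. j < ?L \<Longrightarrow> {tail ?X (es ! j), head ?X (es ! j)} = {vs ! j, vs ! (Suc j mod ?L)}"
    unfolding underlying_cycle_def by blast+
  have L: "?L > 0" using ne by simp
  have arc: "\<exists>v<n. v \<noteq> r \<and> es ! j = (p v, v, i v) \<and> {p v, v} = {vs ! j, vs ! (Suc j mod ?L)}"
    if j: "j < ?L" for j
  proof -
    have "es ! j \<in> arcs ?X" using es len j by (metis nth_mem subsetD)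
    then obtain v where "v < n" "v \<noteq> r" "es ! j = (p v, v, i v)" by auto
    with ends[OF j] show ?thesis by auto
  qed
  have "Max ((\<lambda>j. rk (vs ! j)) ` {..<?L}) \<in> (\<lambda>j. rk (vs ! j)) ` {..<?L}" using L by (intro Max_in) auto
  then obtain M where M: "M < ?L" "rk (vs ! M) = Max ((\<lambda>j. rk (vs ! j)) ` {..<?L})" by auto
  have max: "rk (vs ! j) \<le> rk (vs ! M)" if "j < ?L" for j using M that by auto
  \<comment> \<open>An edge of the cycle at the vertex of largest rank must have this vertex as its
    head, so it is the one arc entering it.\<close>
  have top: "es ! j = (p (vs ! M), vs ! M, i (vs ! M))"
    if j: "j < ?L" and inc: "M = j \<or> M = Suc j mod ?L" for j
  proof -
    obtain v where v: "v < n" "v \<noteq> r" "es ! j = (p v, v, i v)"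
      "{p v, v} = {vs ! j, vs ! (Suc j mod ?L)}" using arc[OF j] by blast
    have "Suc j mod ?L < ?L" using L by simp
    with max j have "rk x \<le> rk (vs ! M)" if "x \<in> {vs ! j, vs ! (Suc j mod ?L)}" for x using that by auto
    with v(4) have "rk v \<le> rk (vs ! M)" by blast
    moreover have "vs ! M \<in> {p v, v}" using v(4) inc by auto
    ultimately have "v = vs ! M" using rk[OF v(1,2)] by auto
    with v show ?thesis by simp
  qed
  \<comment> \<open>The cyclic predecessor of position \<open>M\<close>: the edges \<open>j\<close>
    and \<open>M\<close> both touch \<open>vs ! M\<close> and therefore coincide. As the edges are
    distinct, only a cycle of length 1 is left, a loop, which the ranks exclude.\<close>
  define j where "j = (if M = 0 then ?L - 1 else M - 1)"
  have j: "j < ?L" "Suc j mod ?L = M" using M(1) L by (auto simp: j_def)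
  have "es ! j = es ! M" using top[of j] top[of M] j M by simp
  then have "j = M" using de len j(1) M(1) by (simp add: nth_eq_iff_index_eq)
  then have "?L \<le> 1" using M by (auto simp: j_def split: if_splits)
  with L have "?L = 1" by linarith
  then have "M = 0" "Suc 0 mod ?L = 0" using M by auto
  then obtain v where "v < n" "v \<noteq> r" "{p v, v} = {vs ! 0}" using arc[OF L] by auto
  then show False using rk[of v] by auto
qed

lemma output_digraph_safe_spanning:
  assumes t: "partial_tree r {..<n} p l" and sl: "safe_labels k n r {..<n} l"
    and i: "\<And>v. v < n \<Longrightarrow> v \<noteq> r \<Longrightarrow> i v < m (p v) v"
  shows "safe_spanning_arborescence k (multidigraph n m) r (output_digraph n r p i)"
proof -
  let ?X = "output_digraph n r p i"
  have r: "r < n" using partial_tree_root[OF t] by simp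
  have pn: "p v < n" if "v < n" "v \<noteq> r" for v using partial_tree_parent[OF t, of v] that by simp
  have wf: "wf_digraph ?X" by unfold_locales (auto intro: pn)
  interpret wf_digraph ?X by fact
  interpret M: pair_wf_digraph "mk_symmetric ?X" ..
  have fin: "fin_digraph ?X" by unfold_locales auto
  have "wf_digraph (multidigraph n m)" by unfold_locales (auto simp: multidigraph_def)
  then have sp: "spanning ?X (multidigraph n m)"
    unfolding spanning_def subgraph_def compatible_def using wf pn i
    by (auto simp: multidigraph_def)
  have rr: "r \<rightarrow>\<^sup>*\<^bsub>?X\<^esub> v" if "v < n" for v
  proof (cases "v = r")
    case False
    have "v \<in> {..<n}" using that by simp
    from t this False show ?thesis
    proof (induction rule: partial_tree_induct)
      case (child v)
      then have "r \<rightarrow>\<^bsub>?X\<^esub> v" by (simp add: output_digraph_dominates)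
      then show ?case by (rule reachable_adjI)
    next
      case (step v)
      then have "p v \<rightarrow>\<^bsub>?X\<^esub> v" by (simp add: output_digraph_dominates)
      with step show ?case by (metis reachable_adj_trans)
    qed
  qed (use r in simp)
  have "strongly_connected (mk_symmetric ?X)"
  proof (rule strongly_connectedI)
    show "verts (mk_symmetric ?X) \<noteq> {}" using r by auto
    fix u v assume "u \<in> verts (mk_symmetric ?X)" "v \<in> verts (mk_symmetric ?X)"
    then have "r \<rightarrow>\<^sup>*\<^bsub>mk_symmetric ?X\<^esub> u" "r \<rightarrow>\<^sup>*\<^bsub>mk_symmetric ?X\<^esub> v"
      using rr reachable_mk_symmetricI by auto
    then show "u \<rightarrow>\<^sup>*\<^bsub>mk_symmetric ?X\<^esub> v"
      by (meson M.reachable_trans symmetric_mk_symmetric symmetric_reachable)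
  qed
  then have conn: "connected ?X" by (simp add: connected_def)
  obtain rk :: "nat \<Rightarrow> nat" where rk: "\<And>v. v < n \<Longrightarrow> v \<noteq> r \<Longrightarrow> rk (p v) < rk v"
    using t unfolding partial_tree_def by auto
  have tree: "underlying_tree ?X"
    unfolding underlying_tree_def using conn output_digraph_no_cycle[of n r rk p, OF rk] by blast
  have "in_arcs ?X r = {}" by (auto simp: in_arcs_def)
  moreover have "in_arcs ?X v = {(p v, v, i v)}" if "v < n" "v \<noteq> r" for v
    using that by (auto simp: in_arcs_def)
  ultimately have "arborescence r ?X"
    unfolding arborescence_def using fin tree r by (simp add: in_degree_def)
  moreover have "safe k r ?X"
    using safe_iff_safe_labels[OF t _ wf output_digraph_dominates] sl by simp
  ultimately show ?thesis using sp by (simp add: safe_spanning_arborescence_def)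
qed

section \<open>Packings as pairs of labelled parent functions\<close>

context packing
begin

definition solution :: "(nat \<Rightarrow> nat) \<Rightarrow> (nat \<Rightarrow> nat) \<Rightarrow> (nat \<Rightarrow> nat) \<Rightarrow> (nat \<Rightarrow> nat) \<Rightarrow> bool" where
  "solution p l p' l' \<longleftrightarrow> partial_tree r {..<n} p l \<and> partial_tree r {..<n} p' l' \<and>
     packed {..<n} p {..<n} p' \<and> safe_labels k n r {..<n} l \<and> safe_labels k n r {..<n} l'"

text \<open>The first tree takes index 0 everywhere, the second index 1 exactly where both trees use
  the same parent; there \<open>packed\<close> guarantees two parallel arcs.\<close>

lemma solution_imp_safe_packing:
  assumes s: "solution p l p' l'"
    and i: "\<And>v. i v = 0" "\<And>v. v < n \<Longrightarrow> i' v = (if p v = p' v then 1 else 0)"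
  shows "safe_packing k (multidigraph n m) r (output_digraph n r p i) (output_digraph n r p' i')"
proof -
  from s have t: "partial_tree r {..<n} p l" "partial_tree r {..<n} p' l'"
    and pk: "packed {..<n} p {..<n} p'"
    and sl: "safe_labels k n r {..<n} l" "safe_labels k n r {..<n} l'"
    by (auto simp: solution_def)
  have ub: "uses_arc r {..<n} p u v + uses_arc r {..<n} p' u v \<le> m u v" if "u < n" "v < n" for u v
    using pk that unfolding packed_def by blast
  have pn: "p v < n" "p' v < n" if "v < n" "v \<noteq> r" for v
    using partial_tree_parent[OF t(1), of v] partial_tree_parent[OF t(2), of v] that by auto
  have "i v < m (p v) v" if "v < n" "v \<noteq> r" for v
    using ub[of "p v" v] pn that i by (simp add: uses_arc_def)
  moreover have "i' v < m (p' v) v" if "v < n" "v \<noteq> r" for v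
    using ub[of "p' v" v] pn that i by (auto simp: uses_arc_def)
  moreover have "arcs (output_digraph n r p i) \<inter> arcs (output_digraph n r p' i') = {}"
    using i by auto
  ultimately show ?thesis unfolding safe_packing_def
    using output_digraph_safe_spanning[OF t(1) sl(1)] output_digraph_safe_spanning[OF t(2) sl(2)] by blast
qed

lemma safe_packing_imp_solution:
  assumes "safe_packing k (multidigraph n m) r X Y"
  shows "\<exists>p l p' l'. solution p l p' l'"
proof -
  from assms have X: "safe_spanning_arborescence k (multidigraph n m) r X"
    and Y: "safe_spanning_arborescence k (multidigraph n m) r Y" and dj: "arcs X \<inter> arcs Y = {}"
    by (auto simp: safe_packing_def)
  obtain p l i where p: "partial_tree r {..<n} p l" "safe_labels k n r {..<n} l"
    "\<forall>v<n. v \<noteq> r \<longrightarrow> (p v, v, i v) \<in> arcs X \<and> i v < m (p v) v"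
    using arborescence_imp_partial_tree[OF X] by blast
  obtain p' l' i' where p': "partial_tree r {..<n} p' l'" "safe_labels k n r {..<n} l'"
    "\<forall>v<n. v \<noteq> r \<longrightarrow> (p' v, v, i' v) \<in> arcs Y \<and> i' v < m (p' v) v"
    using arborescence_imp_partial_tree[OF Y] by blast
  have "packed {..<n} p {..<n} p'"
    unfolding packed_def
  proof (intro allI impI)
    fix u v assume uv: "u < n" "v < n"
    show "uses_arc r {..<n} p u v + uses_arc r {..<n} p' u v \<le> m u v"
    proof (cases "v \<noteq> r")
      case True
      note a = p(3)[rule_format, OF uv(2) True] p'(3)[rule_format, OF uv(2) True]
      \<comment> \<open>Two different indices below \<open>m u v\<close> show that
        \<open>m u v\<close> is at least 2.\<close>
      have "i v \<noteq> i' v" if "p v = u" "p' v = u" using a dj that by auto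
      with a show ?thesis by (auto simp: uses_arc_def)
    qed (simp add: uses_arc_def)
  qed
  with p p' show ?thesis unfolding solution_def by blast
qed

lemma has_safe_packing_iff: "has_safe_packing (k, n, r, m) \<longleftrightarrow> (\<exists>p l p' l'. solution p l p' l')"
proof
  assume "\<exists>p l p' l'. solution p l p' l'"
  then obtain p l p' l' where "solution p l p' l'" by blast
  from solution_imp_safe_packing[OF this, of "\<lambda>_. 0" "\<lambda>v. if p v = p' v then 1 else 0"]
  show "has_safe_packing (k, n, r, m)" by auto
qed (use safe_packing_imp_solution in auto)

end

section \<open>The algorithm: reachability\<close>

declare sem.simps(5) [simp del]

abbreviation var :: "name \<Rightarrow> aexp" where
  "var x \<equiv> Cell x (Const 0)"

text \<open>The machine cannot multiply, so the row offsets \<open>v * n\<close> are kept in the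
  table \<open>mul\<close>.\<close>

abbreviation arc_addr :: "name \<Rightarrow> name \<Rightarrow> aexp" where
  "arc_addr v w \<equiv> Add (Cell ''mul'' (var v)) (var w)"

abbreviation set_var :: "name \<Rightarrow> aexp \<Rightarrow> prog" where
  "set_var x \<equiv> PStore x (Const 0)"

abbreviation pos :: "aexp \<Rightarrow> bexp" where
  "pos e \<equiv> Less (Const 0) e"

abbreviation eq :: "aexp \<Rightarrow> aexp \<Rightarrow> bexp" where
  "eq a b \<equiv> Conj (Neg (Less a b)) (Neg (Less b a))"

definition reach_prog :: "name \<Rightarrow> prog" where
  "reach_prog t =
     PFor ''a'' ''n'' (PStore ''vis'' (var ''a'') (Cell t (var ''a''))) ;;
     PFor ''c'' ''n'' (PFor ''a'' ''n'' (PFor ''b'' ''n''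
       (PCond (Conj (pos (Cell ''vis'' (var ''a''))) (pos (Cell ''q'' (arc_addr ''a'' ''b''))))
          (PStore ''vis'' (var ''b'') (Const 1)) PSkip)))"

definition label_prog :: "name \<Rightarrow> prog" where
  "label_prog l =
     PCond (eq (var ''v'') (var ''r'')) (PStore l (var ''w'') (var ''w''))
       (PStore l (var ''w'') (Cell l (var ''v'')))"

text \<open>
  Adds the arc \<open>(v, w)\<close> to the tree \<open>t\<close> unless some vertex of \<open>t\<close> is then no longer reachable
  from the other tree \<open>t'\<close>.
\<close>

definition try_arc_prog :: "name \<Rightarrow> name \<Rightarrow> name \<Rightarrow> name \<Rightarrow> prog" where
  "try_arc_prog t p l t' =
     PCond (Conj (pos (Cell t (var ''v''))) (Conj (Neg (pos (Cell t (var ''w''))))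
         (pos (Cell ''q'' (arc_addr ''v'' ''w'')))))
       (PStore t (var ''w'') (Const 1) ;;
        PStore ''q'' (arc_addr ''v'' ''w'') (Sub (Cell ''q'' (arc_addr ''v'' ''w'')) (Const 1)) ;;
        reach_prog t' ;;
        set_var ''ok'' (Const 1) ;;
        PFor ''a'' ''n''
          (PCond (Conj (pos (Cell t (var ''a''))) (Neg (pos (Cell ''vis'' (var ''a'')))))
             (set_var ''ok'' (Const 0)) PSkip) ;;
        PCond (pos (var ''ok''))
          (PStore p (var ''w'') (var ''v'') ;; label_prog l)
          (PStore t (var ''w'') (Const 0) ;;
           PStore ''q'' (arc_addr ''v'' ''w'') (Add (Cell ''q'' (arc_addr ''v'' ''w'')) (Const 1))))
       PSkip"

definition extend_prog :: "name \<Rightarrow> name \<Rightarrow> name \<Rightarrow> name \<Rightarrow> prog" where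
  "extend_prog t p l t' =
     PFor ''i'' ''n'' (PFor ''v'' ''n'' (PFor ''w'' ''n'' (try_arc_prog t p l t')))"

text \<open>Each subprogram takes the names of the tree it works on and is verified once. This
  predicate lists the two assignments of roles and yields the inequalities of names needed to
  evaluate updates.\<close>

definition tree_names :: "name \<Rightarrow> name \<Rightarrow> name \<Rightarrow> name \<Rightarrow> name \<Rightarrow> name \<Rightarrow> bool" where
  "tree_names t p l t' p' l' \<longleftrightarrow> (t, p, l, t', p', l') \<in>
     {(''t1'', ''p1'', ''l1'', ''t2'', ''p2'', ''l2''), (''t2'', ''p2'', ''l2'', ''t1'', ''p1'', ''l1'')}"

lemma tree_names_neq:
  assumes "tree_names t p l t' p' l'"
  shows
    "t \<noteq> ''vis''" "t \<noteq> ''a''" "t \<noteq> ''b''" "t \<noteq> ''c''" "t \<noteq> ''v''"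
    "t \<noteq> ''w''" "t \<noteq> ''i''" "t \<noteq> ''j''" "t \<noteq> ''d''" "t \<noteq> ''q''"
    "t \<noteq> ''ok''" "t \<noteq> ''n''" "t \<noteq> ''r''" "t \<noteq> ''k''" "t \<noteq> ''mul''"
    "t \<noteq> ''m''" "t \<noteq> ''f''" "t \<noteq> ''K2''" "t \<noteq> ''B''" "t \<noteq> ''NI''"
    "t \<noteq> ''x''" "t \<noteq> ''y''" "t \<noteq> p" "t \<noteq> l" "t \<noteq> t'" "t \<noteq> p'"
    "t \<noteq> l'" "p \<noteq> ''vis''" "p \<noteq> ''a''" "p \<noteq> ''b''" "p \<noteq> ''c''"
    "p \<noteq> ''v''" "p \<noteq> ''w''" "p \<noteq> ''i''" "p \<noteq> ''j''" "p \<noteq> ''d''"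
    "p \<noteq> ''q''" "p \<noteq> ''ok''" "p \<noteq> ''n''" "p \<noteq> ''r''" "p \<noteq> ''k''"
    "p \<noteq> ''mul''" "p \<noteq> ''m''" "p \<noteq> ''f''" "p \<noteq> ''K2''" "p \<noteq> ''B''"
    "p \<noteq> ''NI''" "p \<noteq> ''x''" "p \<noteq> ''y''" "p \<noteq> l" "p \<noteq> t'" "p \<noteq> p'"
    "p \<noteq> l'" "l \<noteq> ''vis''" "l \<noteq> ''a''" "l \<noteq> ''b''" "l \<noteq> ''c''"
    "l \<noteq> ''v''" "l \<noteq> ''w''" "l \<noteq> ''i''" "l \<noteq> ''j''" "l \<noteq> ''d''"
    "l \<noteq> ''q''" "l \<noteq> ''ok''" "l \<noteq> ''n''" "l \<noteq> ''r''" "l \<noteq> ''k''"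
    "l \<noteq> ''mul''" "l \<noteq> ''m''" "l \<noteq> ''f''" "l \<noteq> ''K2''" "l \<noteq> ''B''"
    "l \<noteq> ''NI''" "l \<noteq> ''x''" "l \<noteq> ''y''" "l \<noteq> t'" "l \<noteq> p'" "l \<noteq> l'"
    "t' \<noteq> ''vis''" "t' \<noteq> ''a''" "t' \<noteq> ''b''" "t' \<noteq> ''c''" "t' \<noteq> ''v''"
    "t' \<noteq> ''w''" "t' \<noteq> ''i''" "t' \<noteq> ''j''" "t' \<noteq> ''d''" "t' \<noteq> ''q''"
    "t' \<noteq> ''ok''" "t' \<noteq> ''n''" "t' \<noteq> ''r''" "t' \<noteq> ''k''" "t' \<noteq> ''mul''"
    "t' \<noteq> ''m''" "t' \<noteq> ''f''" "t' \<noteq> ''K2''" "t' \<noteq> ''B''" "t' \<noteq> ''NI''"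
    "t' \<noteq> ''x''" "t' \<noteq> ''y''" "t' \<noteq> p'" "t' \<noteq> l'" "p' \<noteq> ''vis''"
    "p' \<noteq> ''a''" "p' \<noteq> ''b''" "p' \<noteq> ''c''" "p' \<noteq> ''v''" "p' \<noteq> ''w''"
    "p' \<noteq> ''i''" "p' \<noteq> ''j''" "p' \<noteq> ''d''" "p' \<noteq> ''q''" "p' \<noteq> ''ok''"
    "p' \<noteq> ''n''" "p' \<noteq> ''r''" "p' \<noteq> ''k''" "p' \<noteq> ''mul''" "p' \<noteq> ''m''"
    "p' \<noteq> ''f''" "p' \<noteq> ''K2''" "p' \<noteq> ''B''" "p' \<noteq> ''NI''" "p' \<noteq> ''x''"
    "p' \<noteq> ''y''" "p' \<noteq> l'" "l' \<noteq> ''vis''" "l' \<noteq> ''a''" "l' \<noteq> ''b''"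
    "l' \<noteq> ''c''" "l' \<noteq> ''v''" "l' \<noteq> ''w''" "l' \<noteq> ''i''" "l' \<noteq> ''j''"
    "l' \<noteq> ''d''" "l' \<noteq> ''q''" "l' \<noteq> ''ok''" "l' \<noteq> ''n''" "l' \<noteq> ''r''"
    "l' \<noteq> ''k''" "l' \<noteq> ''mul''" "l' \<noteq> ''m''" "l' \<noteq> ''f''" "l' \<noteq> ''K2''"
    "l' \<noteq> ''B''" "l' \<noteq> ''NI''" "l' \<noteq> ''x''" "l' \<noteq> ''y''"
  using assms by (auto simp: tree_names_def)

definition supp :: "nat \<Rightarrow> (nat \<Rightarrow> nat) \<Rightarrow> nat set" where
  "supp n f = {v. v < n \<and> 0 < f v}"

lemma in_supp: "v \<in> supp n f \<longleftrightarrow> v < n \<and> 0 < f v"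
  and supp_subset: "supp n f \<subseteq> {..<n}"
  and finite_supp [simp]: "finite (supp n f)"
  and supp_insert: "w < n \<Longrightarrow> 0 < c \<Longrightarrow> supp n (f(w := c)) = insert w (supp n f)"
  by (auto simp: supp_def)

lemma arc_index_eq_iff:
  fixes a b v w n :: nat
  assumes "b < n" "w < n"
  shows "a * n + b = v * n + w \<longleftrightarrow> a = v \<and> b = w"
proof
  assume h: "a * n + b = v * n + w"
  have "(a * n + b) div n = a" "(v * n + w) div n = v" "(a * n + b) mod n = b" "(v * n + w) mod n = w"
    using assms by auto
  with h show "a = v \<and> b = w" by metis
qed simp

lemma arc_index_less:
  fixes a b n :: nat
  assumes "a < n" "b < n"
  shows "a * n + b < n * n"
proof -
  have "a * n + b < a * n + n" using assms by simp
  also have "\<dots> = Suc a * n" by simp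
  also have "\<dots> \<le> n * n" using assms by (intro mult_le_mono1) simp
  finally show ?thesis .
qed

context packing
begin

text \<open>At most \<open>2 * k\<close> vertices with at most \<open>6 * k\<close> first arcs each
  give \<open>12 * k * k\<close> candidate arcs; the additional digit 0 stands for an idle
  round.\<close>

definition base :: nat where
  "base = 12 * k * k + 1"

definition env :: "state \<Rightarrow> bool" where
  "env s \<longleftrightarrow> s ''n'' 0 = n \<and> s ''r'' 0 = r \<and> s ''k'' 0 = k \<and> (\<forall>v<n. s ''mul'' v = v * n) \<and>
     (\<forall>v<n. \<forall>w<n. s ''m'' (v * n + w) = m v w) \<and>
     (\<forall>v<n. \<forall>w<n. 0 < s ''f'' (v * n + w) \<longleftrightarrow> first_arc v w) \<and>
     s ''K2'' 0 = 2 * k \<and> s ''B'' 0 = base \<and> s ''NI'' 0 = base ^ (4 * k)"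

definition env_vars :: "name set" where
  "env_vars = {''n'', ''r'', ''k'', ''mul'', ''m'', ''f'', ''K2'', ''B'', ''NI''}"

lemma env_cong:
  assumes "env s" "\<And>z. z \<in> env_vars \<Longrightarrow> s' z = s z"
  shows "env s'"
  using assms by (simp add: env_def env_vars_def)

lemma env_sem: "env s \<Longrightarrow> writes p \<inter> env_vars = {} \<Longrightarrow> env (sem p s)"
  by (erule env_cong) (rule sem_other, blast)

lemma env_upd: "env s \<Longrightarrow> x \<notin> env_vars \<Longrightarrow> env (upd x i v s)"
  by (erule env_cong) (auto simp: upd_apply)

definition resid :: "state \<Rightarrow> nat \<Rightarrow> nat \<Rightarrow> nat" where
  "resid s a b = s ''q'' (a * n + b)"

definition arc_closed :: "(nat \<Rightarrow> nat \<Rightarrow> nat) \<Rightarrow> nat set \<Rightarrow> bool" where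
  "arc_closed q X \<longleftrightarrow> (\<forall>a\<in>X. \<forall>b<n. q a b > 0 \<longrightarrow> b \<in> X)"

lemma reach_writes: "writes (reach_prog t) = {''vis'', ''a'', ''b'', ''c''}"
  by (auto simp: reach_prog_def)

text \<open>A sweep over all arcs either starts from a closed set or marks a new vertex, so after
  \<open>n\<close> sweeps the marked set is closed or contains all vertices. The three claims are
  those that \<open>feasible_insert_iff_closure\<close> asks of \<open>R\<close>.\<close>

lemma reach_spec:
  assumes e: "env s" and t: "t \<notin> {''vis'', ''a'', ''b'', ''c''}"
  defines "R \<equiv> supp n (sem (reach_prog t) s ''vis'')"
  shows "supp n (s t) \<subseteq> R" "arc_closed (resid s) R"
    "\<And>X. supp n (s t) \<subseteq> X \<Longrightarrow> arc_closed (resid s) X \<Longrightarrow> R \<subseteq> X"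
proof -
  let ?copy = "PStore ''vis'' (var ''a'') (Cell t (var ''a''))"
  let ?body = "PCond (Conj (pos (Cell ''vis'' (var ''a''))) (pos (Cell ''q'' (arc_addr ''a'' ''b''))))
      (PStore ''vis'' (var ''b'') (Const 1)) PSkip"
  let ?sweep = "PFor ''a'' ''n'' (PFor ''b'' ''n'' ?body)"
  define s1 where "s1 = sem (PFor ''a'' ''n'' ?copy) s"
  define s2 where "s2 = sem (PFor ''c'' ''n'' ?sweep) s1"
  have R: "R = supp n (s2 ''vis'')" by (simp add: R_def s2_def s1_def reach_prog_def)
  have "\<forall>a<s ''n'' 0. s1 ''vis'' a = s t a"
    unfolding s1_def
  proof (rule For_rule[where I = "\<lambda>i s'. \<forall>a<i. s' ''vis'' a = s t a"])
    fix i s' assume "s' ''a'' 0 = i" "\<And>z. z \<notin> writes ?copy \<Longrightarrow> z \<noteq> ''a'' \<Longrightarrow> s' z = s z"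
      "\<forall>a<i. s' ''vis'' a = s t a"
    then show "\<forall>a<Suc i. upd ''a'' 0 (Suc i) (sem ?copy s') ''vis'' a = s t a"
      using t by (auto simp: less_Suc_eq)
  qed simp_all
  then have sup1: "supp n (s1 ''vis'') = supp n (s t)"
    using e by (auto simp: env_def supp_def)
  have e1: "env s1" unfolding s1_def using e by (rule env_sem) (simp add: env_vars_def)
  have q1: "s1 ''q'' = s ''q''" unfolding s1_def by (rule sem_other) simp
  define Inv where "Inv s' \<longleftrightarrow> supp n (s t) \<subseteq> supp n (s' ''vis'') \<and>
     (\<forall>X. supp n (s t) \<subseteq> X \<longrightarrow> arc_closed (resid s) X \<longrightarrow> supp n (s' ''vis'') \<subseteq> X)" for s' :: state
  \<comment> \<open>Only successors of vertices marked at the beginning of the sweep are guaranteed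
    to be marked; successors of later marks may have to wait for the next sweep.\<close>
  have sweep: "supp n (s0 ''vis'') \<subseteq> supp n (sem ?sweep s0 ''vis'') \<and> Inv (sem ?sweep s0) \<and>
      (\<forall>a b. a * n + b < n * n \<longrightarrow> a \<in> supp n (s0 ''vis'') \<longrightarrow> b < n \<longrightarrow> resid s a b > 0 \<longrightarrow>
         b \<in> supp n (sem ?sweep s0 ''vis''))"
    if e0: "env s0" and q0: "s0 ''q'' = s ''q''" and I0: "Inv s0" for s0
  proof (rule For2_rule[where I = "\<lambda>i s'. supp n (s0 ''vis'') \<subseteq> supp n (s' ''vis'') \<and> Inv s' \<and>
      (\<forall>a b. a * n + b < i \<longrightarrow> a \<in> supp n (s0 ''vis'') \<longrightarrow> b < n \<longrightarrow> resid s a b > 0 \<longrightarrow>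
         b \<in> supp n (s' ''vis''))"])
    show "s0 ''n'' 0 = n" using e0 by (simp add: env_def)
    fix a b s' assume ab: "a < n" "b < n" "s' ''a'' 0 = a" "s' ''b'' 0 = b"
      and fr: "\<And>z. z \<notin> writes ?body \<Longrightarrow> z \<noteq> ''a'' \<Longrightarrow> z \<noteq> ''b'' \<Longrightarrow> s' z = s0 z"
      and J: "supp n (s0 ''vis'') \<subseteq> supp n (s' ''vis'') \<and> Inv s' \<and>
        (\<forall>c d. c * n + d < a * n + b \<longrightarrow> c \<in> supp n (s0 ''vis'') \<longrightarrow> d < n \<longrightarrow> resid s c d > 0 \<longrightarrow>
         d \<in> supp n (s' ''vis''))"
    have "s' ''mul'' = s0 ''mul''" "s' ''q'' = s ''q''" using fr q0 by auto
    then have test: "bval (Conj (pos (Cell ''vis'' (var ''a''))) (pos (Cell ''q'' (arc_addr ''a'' ''b'')))) s'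
        \<longleftrightarrow> a \<in> supp n (s' ''vis'') \<and> resid s a b > 0"
      using ab e0 by (simp add: env_def in_supp resid_def)
    let ?s = "sem ?body s'"
    have new: "supp n (?s ''vis'') =
        (if a \<in> supp n (s' ''vis'') \<and> resid s a b > 0 then insert b (supp n (s' ''vis'')) else supp n (s' ''vis''))"
      unfolding sem.simps test using ab by (simp add: supp_insert)
    have "Inv ?s"
      unfolding Inv_def
    proof (intro conjI allI impI)
      have "supp n (s t) \<subseteq> supp n (s' ''vis'')" using J unfolding Inv_def by blast
      then show "supp n (s t) \<subseteq> supp n (?s ''vis'')" unfolding new by auto
    next
      fix X assume X: "supp n (s t) \<subseteq> X" "arc_closed (resid s) X"
      then have "supp n (s' ''vis'') \<subseteq> X" using J unfolding Inv_def by blast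
      moreover from this have "b \<in> X" if "a \<in> supp n (s' ''vis'') \<and> resid s a b > 0"
        using that X(2) ab(2) unfolding arc_closed_def by blast
      ultimately show "supp n (?s ''vis'') \<subseteq> X" unfolding new by simp
    qed
    moreover have "d \<in> supp n (?s ''vis'')"
      if "c * n + d < Suc (a * n + b)" "c \<in> supp n (s0 ''vis'')" "d < n" "resid s c d > 0" for c d
    proof (cases "c * n + d < a * n + b")
      case True
      with J that show ?thesis unfolding new by auto
    next
      case False
      then have "c = a" "d = b" using that(1,3) ab(2) arc_index_eq_iff[of d n b c a] by auto
      with J that show ?thesis unfolding new by auto
    qed
    ultimately show "supp n (s0 ''vis'') \<subseteq> supp n (?s ''vis'') \<and> Inv ?s \<and>
        (\<forall>c d. c * n + d < Suc (a * n + b) \<longrightarrow> c \<in> supp n (s0 ''vis'') \<longrightarrow> d < n \<longrightarrow> resid s c d > 0 \<longrightarrow>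
         d \<in> supp n (?s ''vis''))"
      using J unfolding new by auto
  qed (use I0 in \<open>auto simp: Inv_def\<close>)
  have "Inv s2 \<and> (arc_closed (resid s) (supp n (s2 ''vis'')) \<or> s1 ''n'' 0 \<le> card (supp n (s2 ''vis'')))"
    unfolding s2_def
  proof (rule For_rule[where I = "\<lambda>i s'. Inv s' \<and>
      (arc_closed (resid s) (supp n (s' ''vis'')) \<or> i \<le> card (supp n (s' ''vis'')))"])
    show "Inv (upd ''c'' 0 0 s1) \<and> (arc_closed (resid s) (supp n (upd ''c'' 0 0 s1 ''vis'')) \<or>
        0 \<le> card (supp n (upd ''c'' 0 0 s1 ''vis'')))"
      by (simp add: Inv_def sup1)
    fix i s' assume fr: "\<And>z. z \<notin> writes ?sweep \<Longrightarrow> z \<noteq> ''c'' \<Longrightarrow> s' z = s1 z"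
      and J: "Inv s' \<and> (arc_closed (resid s) (supp n (s' ''vis'')) \<or> i \<le> card (supp n (s' ''vis'')))"
    have e': "env s'" using e1 by (rule env_cong) (rule fr, auto simp: env_vars_def)
    have q': "s' ''q'' = s ''q''" using fr q1 by simp
    let ?A = "supp n (s' ''vis'')" and ?B = "supp n (sem ?sweep s' ''vis'')"
    from sweep[OF e' q'] J have sw: "?A \<subseteq> ?B" "Inv (sem ?sweep s')"
      "\<And>a b. a * n + b < n * n \<Longrightarrow> a \<in> ?A \<Longrightarrow> b < n \<Longrightarrow> resid s a b > 0 \<Longrightarrow> b \<in> ?B" by blast+
    have "arc_closed (resid s) ?B \<or> Suc i \<le> card ?B"
    proof (cases "arc_closed (resid s) ?A")
      case True
      then have "?B \<subseteq> ?A" using sw(2) J unfolding Inv_def by blast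
      with sw(1) True show ?thesis by simp
    next
      case False
      then obtain a b where ab: "a \<in> ?A" "b < n" "resid s a b > 0" "b \<notin> ?A" unfolding arc_closed_def by blast
      have "a < n" using ab by (simp add: in_supp)
      then have "b \<in> ?B" using sw(3) ab arc_index_less[of a n b] by blast
      with ab sw(1) have "?A \<subset> ?B" by blast
      then have "card ?A < card ?B" by (intro psubset_card_mono) auto
      with False J show ?thesis by auto
    qed
    with sw(2) show "Inv (upd ''c'' 0 (Suc i) (sem ?sweep s')) \<and>
        (arc_closed (resid s) (supp n (upd ''c'' 0 (Suc i) (sem ?sweep s') ''vis'')) \<or>
         Suc i \<le> card (supp n (upd ''c'' 0 (Suc i) (sem ?sweep s') ''vis'')))"
      by (simp add: Inv_def)
  qed simp
  moreover have "s1 ''n'' 0 = n" using e1 by (simp add: env_def)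
  moreover have "arc_closed (resid s) (supp n (s2 ''vis''))" if "n \<le> card (supp n (s2 ''vis''))"
  proof -
    have "supp n (s2 ''vis'') = {..<n}" using that supp_subset by (intro card_seteq) auto
    then show ?thesis by (simp add: arc_closed_def)
  qed
  ultimately have "Inv s2" "arc_closed (resid s) (supp n (s2 ''vis''))" by auto
  then show "supp n (s t) \<subseteq> R" "arc_closed (resid s) R"
    "\<And>X. supp n (s t) \<subseteq> X \<Longrightarrow> arc_closed (resid s) X \<Longrightarrow> R \<subseteq> X"
    unfolding R Inv_def by blast+
qed

end

section \<open>The algorithm: greedy extension\<close>

context packing
begin

definition arc_candidate :: "name \<Rightarrow> nat \<Rightarrow> nat \<Rightarrow> state \<Rightarrow> bool" where
  "arc_candidate t v w s \<longleftrightarrow> v \<in> supp n (s t) \<and> w < n \<and> w \<notin> supp n (s t) \<and> resid s v w > 0"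

definition arc_added :: "name \<Rightarrow> name \<Rightarrow> name \<Rightarrow> nat \<Rightarrow> nat \<Rightarrow> state \<Rightarrow> state \<Rightarrow> bool" where
  "arc_added t p l v w s s' \<longleftrightarrow> s' t = (s t)(w := 1) \<and> s' p = (s p)(w := v) \<and>
     s' l = (s l)(w := if v = r then w else s l v) \<and>
     s' ''q'' = (s ''q'')(v * n + w := s ''q'' (v * n + w) - 1)"

definition same_tree :: "name \<Rightarrow> name \<Rightarrow> name \<Rightarrow> state \<Rightarrow> state \<Rightarrow> bool" where
  "same_tree t p l s s' \<longleftrightarrow> s' t = s t \<and> s' p = s p \<and> s' l = s l \<and> s' ''q'' = s ''q''"

lemma label_writes: "writes (label_prog l) = {l}"
  by (simp add: label_prog_def)

lemma try_arc_writes: "writes (try_arc_prog t p l t') =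
    {t, p, l, ''q'', ''vis'', ''a'', ''b'', ''c'', ''ok''}"
  by (auto simp: try_arc_prog_def reach_writes label_writes)

lemma label_spec:
  assumes "env s" "s ''v'' 0 = v" "s ''w'' 0 = w"
  shows "sem (label_prog l) s l = (s l)(w := if v = r then w else s l v)"
  using assms by (simp add: label_prog_def env_def)

lemma resid_use_arc:
  assumes "s' ''q'' = (s ''q'')(v * n + w := s ''q'' (v * n + w) - 1)" "b < n" "w < n"
  shows "resid s' a b = use_arc v w (resid s) a b"
  using assms arc_index_eq_iff[of b n w a v] by (auto simp: resid_def use_arc_def)

text \<open>\<open>P\<close> is the outcome of the test. The arrays change consistently in any case;
  only the reading of the test as feasibility of the enlarged pair presupposes a feasible pair.
  Guessed pairs need not be feasible, hence the two layers.\<close>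

lemma try_arc_spec:
  assumes e: "env s" and tn: "tree_names t p l t' p' l'"
    and vw: "s ''v'' 0 = v" "s ''w'' 0 = w" "v < n" "w < n"
  defines "s' \<equiv> sem (try_arc_prog t p l t') s"
  shows "\<not> arc_candidate t v w s \<Longrightarrow> same_tree t p l s s'"
    and "arc_candidate t v w s \<Longrightarrow> \<exists>P. (P \<longrightarrow> arc_added t p l v w s s') \<and> (\<not> P \<longrightarrow> same_tree t p l s s') \<and>
      (feasible n (supp n (s t)) (supp n (s t')) (resid s) \<longrightarrow>
         P = feasible n (insert w (supp n (s t))) (supp n (s t')) (use_arc v w (resid s)))"
proof -
  note nm = tree_names_neq[OF tn] tree_names_neq[OF tn, symmetric]
  have mul: "s ''mul'' v = v * n" using e vw by (simp add: env_def)
  have test: "bval (Conj (pos (Cell t (var ''v''))) (Conj (Neg (pos (Cell t (var ''w''))))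
         (pos (Cell ''q'' (arc_addr ''v'' ''w''))))) s \<longleftrightarrow> arc_candidate t v w s"
    using vw mul by (auto simp: arc_candidate_def in_supp resid_def)
  show "same_tree t p l s s'" if "\<not> arc_candidate t v w s"
    using that unfolding s'_def try_arc_prog_def sem.simps test by (simp add: same_tree_def)
  assume c: "arc_candidate t v w s"
  define s1 where "s1 = upd t w 1 s"
  define s2 where "s2 = upd ''q'' (v * n + w) (s ''q'' (v * n + w) - 1) s1"
  define s3 where "s3 = sem (reach_prog t') s2"
  define s4 where "s4 = upd ''ok'' 0 1 s3"
  let ?chk = "PCond (Conj (pos (Cell t (var ''a''))) (Neg (pos (Cell ''vis'' (var ''a'')))))
             (set_var ''ok'' (Const 0)) PSkip"
  define s5 where "s5 = sem (PFor ''a'' ''n'' ?chk) s4"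
  define P where "P \<longleftrightarrow> s5 ''ok'' 0 > 0"
  have e2: "env s2" unfolding s2_def s1_def using e by (intro env_upd) (simp_all add: env_vars_def nm)
  have e3: "env s3" unfolding s3_def using e2 by (rule env_sem) (auto simp: reach_writes env_vars_def)
  have e4: "env s4" unfolding s4_def using e3 by (intro env_upd) (auto simp: env_vars_def)
  have e5: "env s5" unfolding s5_def using e4 by (rule env_sem) (auto simp: env_vars_def)
  have fr3: "z \<notin> {''vis'', ''a'', ''b'', ''c''} \<Longrightarrow> s3 z = s2 z" for z
    unfolding s3_def by (rule sem_other) (simp add: reach_writes)
  have fr5: "z \<notin> {''a'', ''ok''} \<Longrightarrow> s5 z = s4 z" for z
    unfolding s5_def by (rule sem_other) simp
  have s5: "s5 t = (s t)(w := 1)" "s5 p = s p" "s5 l = s l" "s5 ''v'' = s ''v''" "s5 ''w'' = s ''w''"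
    "s5 ''q'' = (s ''q'')(v * n + w := s ''q'' (v * n + w) - 1)" "s5 ''vis'' = s3 ''vis''"
    by (simp_all add: fr5 fr3 s4_def s2_def s1_def nm fun_eq_iff)
  have fin: "s' = (if P then sem (PStore p (var ''w'') (var ''v'') ;; label_prog l) s5
      else upd ''q'' (v * n + w) (s5 ''q'' (v * n + w) + 1) (upd t w 0 s5))"
  proof -
    have m3: "s1 ''mul'' v = v * n" "s5 ''mul'' v = v * n" using mul e5 vw by (auto simp: s1_def nm env_def)
    have "sem (PStore t (var ''w'') (Const 1) ;;
        PStore ''q'' (arc_addr ''v'' ''w'') (Sub (Cell ''q'' (arc_addr ''v'' ''w'')) (Const 1)) ;;
        reach_prog t' ;; set_var ''ok'' (Const 1) ;; PFor ''a'' ''n'' ?chk) s = s5"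
      using vw m3 by (simp add: s5_def s4_def s3_def s2_def s1_def nm)
    moreover have "bval (pos (var ''ok'')) s5 = P" by (simp add: P_def)
    ultimately show ?thesis
      using c vw m3 s5 test unfolding s'_def try_arc_prog_def
      by (simp add: nm)
  qed
  have "arc_added t p l v w s s'" if P
  proof -
    let ?s = "upd p w v s5"
    have "s' = sem (label_prog l) ?s" using that vw s5 by (simp add: fin)
    moreover have "sem (label_prog l) ?s l = (?s l)(w := if v = r then w else ?s l v)"
      by (rule label_spec) (use e5 vw s5 in \<open>auto intro!: env_upd simp: env_vars_def nm\<close>)
    moreover have "z \<noteq> l \<Longrightarrow> sem (label_prog l) ?s z = ?s z" for z
      by (rule sem_other) (simp add: label_writes)
    ultimately show ?thesis using s5 by (simp add: arc_added_def nm fun_upd_def cong: if_cong)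
  qed
  \<comment> \<open>The rollback is exact: a candidate arc has a positive entry in \<open>q\<close>,
    so the truncated subtraction is undone by adding 1, and its head had the entry 0 in
    \<open>t\<close>.\<close>
  moreover have "same_tree t p l s s'" if "\<not> P"
    using that c vw s5 by (auto simp: nm fin same_tree_def arc_candidate_def in_supp resid_def fun_eq_iff)
  moreover have "P = feasible n (insert w (supp n (s t))) (supp n (s t')) (use_arc v w (resid s))"
    if f: "feasible n (supp n (s t)) (supp n (s t')) (resid s)"
  proof -
    define R where "R = supp n (s3 ''vis'')"
    have "t' \<notin> {''vis'', ''a'', ''b'', ''c''}" by (simp add: nm)
    note rs = reach_spec[OF e2 this, folded s3_def, folded R_def]
    have q2: "resid s2 a b = use_arc v w (resid s) a b" if "b < n" for a b
      by (rule resid_use_arc) (use that vw in \<open>simp_all add: s2_def s1_def nm\<close>)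
    have t2: "s2 t' = s t'" by (simp add: s2_def s1_def nm)
    have "feasible n (insert w (supp n (s t))) (supp n (s t')) (use_arc v w (resid s)) \<longleftrightarrow>
        insert w (supp n (s t)) \<subseteq> R"
    proof (rule feasible_insert_iff_closure[OF f])
      show "v \<in> supp n (s t)" "v < n" "w < n" "0 < resid s v w"
        using c vw by (auto simp: arc_candidate_def)
      show "supp n (s t) \<subseteq> {..<n}" "R \<subseteq> {..<n}" by (auto simp: R_def in_supp)
      show "supp n (s t') \<subseteq> R" using rs(1) t2 by simp
      show "b \<in> R" if "a \<in> R" "b < n" "0 < use_arc v w (resid s) a b" for a b
        using rs(2) that q2 unfolding arc_closed_def by auto
      show "R \<subseteq> X" if "supp n (s t') \<subseteq> X"
        "\<And>a b. a \<in> X \<Longrightarrow> b < n \<Longrightarrow> 0 < use_arc v w (resid s) a b \<Longrightarrow> b \<in> X" for X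
      proof (rule rs(3))
        show "supp n (s2 t') \<subseteq> X" using that t2 by simp
        show "arc_closed (resid s2) X" using that(2) q2 unfolding arc_closed_def by auto
      qed
    qed
    also have "\<dots> \<longleftrightarrow> (\<forall>a<n. s5 t a > 0 \<longrightarrow> a \<in> R)"
      using vw s5 by (auto simp: in_supp)
    also have "\<dots> \<longleftrightarrow> P"
    proof -
      have "s5 ''ok'' 0 > 0 \<longleftrightarrow> (\<forall>a<s4 ''n'' 0. s4 t a > 0 \<longrightarrow> s4 ''vis'' a > 0)"
        unfolding s5_def
      proof (rule For_rule[where I = "\<lambda>i s'. s' ''ok'' 0 > 0 \<longleftrightarrow> (\<forall>a<i. s4 t a > 0 \<longrightarrow> s4 ''vis'' a > 0)"])
        show "0 < upd ''a'' 0 0 s4 ''ok'' 0 \<longleftrightarrow> (\<forall>a<0. s4 t a > 0 \<longrightarrow> s4 ''vis'' a > 0)"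
          by (simp add: s4_def)
        fix i s' assume "s' ''a'' 0 = i" "\<And>z. z \<notin> writes ?chk \<Longrightarrow> z \<noteq> ''a'' \<Longrightarrow> s' z = s4 z"
          "s' ''ok'' 0 > 0 \<longleftrightarrow> (\<forall>a<i. s4 t a > 0 \<longrightarrow> s4 ''vis'' a > 0)"
        then show "upd ''a'' 0 (Suc i) (sem ?chk s') ''ok'' 0 > 0 \<longleftrightarrow>
            (\<forall>a<Suc i. s4 t a > 0 \<longrightarrow> s4 ''vis'' a > 0)"
          by (auto simp: less_Suc_eq nm)
      qed simp
      moreover have "s4 ''n'' 0 = n" using e4 by (simp add: env_def)
      moreover have "s4 t = s5 t" "s4 ''vis'' = s3 ''vis''" by (simp_all add: fr5 nm s4_def)
      ultimately show ?thesis by (auto simp: P_def R_def in_supp)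
    qed
    finally show ?thesis by blast
  qed
  ultimately show "\<exists>P. (P \<longrightarrow> arc_added t p l v w s s') \<and> (\<not> P \<longrightarrow> same_tree t p l s s') \<and>
      (feasible n (supp n (s t)) (supp n (s t')) (resid s) \<longrightarrow>
         P = feasible n (insert w (supp n (s t))) (supp n (s t')) (use_arc v w (resid s)))"
    by blast
qed

text \<open>Says nothing about cuts, so it is preserved whatever arcs are guessed; together with the
  final checks it makes every reported pair a solution.\<close>

definition tree_inv :: "name \<Rightarrow> name \<Rightarrow> name \<Rightarrow> name \<Rightarrow> name \<Rightarrow> name \<Rightarrow> state \<Rightarrow> bool" where
  "tree_inv t p l t' p' l' s \<longleftrightarrow>
     partial_tree r (supp n (s t)) (s p) (s l) \<and> partial_tree r (supp n (s t')) (s p') (s l') \<and>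
     packed (supp n (s t)) (s p) (supp n (s t')) (s p') \<and>
     (\<forall>a<n. \<forall>b<n. resid s a b = residual (supp n (s t)) (s p) (supp n (s t')) (s p') a b)"

text \<open>From such a state success is certain: the cut condition lets both trees grow until they
  span, and the labels stay safe.\<close>

definition full_inv :: "name \<Rightarrow> name \<Rightarrow> name \<Rightarrow> name \<Rightarrow> name \<Rightarrow> name \<Rightarrow> state \<Rightarrow> bool" where
  "full_inv t p l t' p' l' s \<longleftrightarrow> tree_inv t p l t' p' l' s \<and>
     feasible n (supp n (s t)) (supp n (s t')) (resid s) \<and>
     safe_labels k n r (supp n (s t)) (s l) \<and> safe_labels k n r (supp n (s t')) (s l')"

lemma tree_inv_swap: "tree_inv t p l t' p' l' s \<longleftrightarrow> tree_inv t' p' l' t p l s"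
  unfolding tree_inv_def using packed_commute residual_commute by metis

lemma full_inv_swap: "full_inv t p l t' p' l' s \<longleftrightarrow> full_inv t' p' l' t p l s"
  unfolding full_inv_def using tree_inv_swap feasible_commute by metis

lemma tree_inv_cong:
  "(\<And>z. z \<in> {t, p, l, t', p', l', ''q''} \<Longrightarrow> s' z = s z) \<Longrightarrow>
     tree_inv t p l t' p' l' s' = tree_inv t p l t' p' l' s"
  by (simp add: tree_inv_def resid_def)

lemma full_inv_cong:
  assumes "\<And>z. z \<in> {t, p, l, t', p', l', ''q''} \<Longrightarrow> s' z = s z"
  shows "full_inv t p l t' p' l' s' = full_inv t p l t' p' l' s"
proof -
  have "resid s' = resid s" using assms by (simp add: resid_def fun_eq_iff)
  with tree_inv_cong[of t p l t' p' l' s' s] assms show ?thesis by (simp add: full_inv_def)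
qed

lemma same_tree_inv:
  assumes "same_tree t p l s s'" "s' t' = s t'" "s' p' = s p'" "s' l' = s l'"
  shows "tree_inv t p l t' p' l' s' = tree_inv t p l t' p' l' s"
    and "full_inv t p l t' p' l' s' = full_inv t p l t' p' l' s"
proof -
  have *: "s' z = s z" if "z \<in> {t, p, l, t', p', l', ''q''}" for z
    using assms that by (auto simp: same_tree_def)
  show "tree_inv t p l t' p' l' s' = tree_inv t p l t' p' l' s" by (rule tree_inv_cong) (rule *)
  show "full_inv t p l t' p' l' s' = full_inv t p l t' p' l' s" by (rule full_inv_cong) (rule *)
qed

lemma arc_added_supp:
  "arc_added t p l v w s s' \<Longrightarrow> w < n \<Longrightarrow> supp n (s' t) = insert w (supp n (s t))"
  by (simp add: arc_added_def supp_insert)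

lemma tree_inv_added:
  assumes i: "tree_inv t p l t' p' l' s" and c: "arc_candidate t v w s" and a: "arc_added t p l v w s s'"
    and o: "s' t' = s t'" "s' p' = s p'" "s' l' = s l'"
  shows "tree_inv t p l t' p' l' s'"
proof -
  have vw: "v \<in> supp n (s t)" "v < n" "w < n" "w \<notin> supp n (s t)" "resid s v w > 0"
    using c by (auto simp: arc_candidate_def in_supp)
  note S = arc_added_supp[OF a vw(3)]
  have wr: "w \<noteq> r" using i partial_tree_root vw(4) by (auto simp: tree_inv_def)
  have pl: "s' p = (s p)(w := v)" "s' l = (s l)(w := if v = r then w else s l v)"
    using a by (auto simp: arc_added_def)
  have "residual (supp n (s t)) (s p) (supp n (s t')) (s p') v w > 0"
    using i vw by (simp add: tree_inv_def)
  then have "packed (supp n (s' t)) (s' p) (supp n (s t')) (s p')"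
    unfolding S pl using i vw wr by (intro packed_insert) (auto simp: tree_inv_def)
  moreover have "partial_tree r (supp n (s' t)) (s' p) (s' l)"
    unfolding S pl using i vw by (intro partial_tree_insert) (auto simp: tree_inv_def)
  moreover have "resid s' x y = residual (supp n (s' t)) (s' p) (supp n (s t')) (s p') x y"
    if "x < n" "y < n" for x y
  proof -
    have "resid s' x y = use_arc v w (resid s) x y"
      using a that vw by (intro resid_use_arc) (auto simp: arc_added_def)
    also have "\<dots> = use_arc v w (residual (supp n (s t)) (s p) (supp n (s t')) (s p')) x y"
      using i that by (simp add: tree_inv_def use_arc_def)
    also have "\<dots> = residual (supp n (s' t)) (s' p) (supp n (s t')) (s p') x y"
      unfolding S pl using residual_insert[OF vw(4) wr] by simp
    finally show ?thesis .
  qed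
  ultimately show ?thesis using i o by (simp add: tree_inv_def)
qed

lemma full_inv_added:
  assumes i: "full_inv t p l t' p' l' s" and c: "arc_candidate t v w s" and a: "arc_added t p l v w s s'"
    and o: "s' t' = s t'" "s' p' = s p'" "s' l' = s l'"
    and f: "feasible n (insert w (supp n (s t))) (supp n (s t')) (use_arc v w (resid s))"
  shows "full_inv t p l t' p' l' s'"
proof -
  have vw: "w < n" "w \<notin> supp n (s t)" using c by (auto simp: arc_candidate_def)
  note S = arc_added_supp[OF a vw(1)]
  have "feasible n (supp n (s' t)) (supp n (s t')) (resid s') =
      feasible n (supp n (s' t)) (supp n (s t')) (use_arc v w (resid s))"
    using a vw by (intro feasible_cong resid_use_arc) (auto simp: arc_added_def)
  moreover have "safe_labels k n r (supp n (s' t)) (s' l)"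
    by (rule safe_labels_mono[of k n r "supp n (s t)" "s l"])
      (use i a vw S in \<open>auto simp: full_inv_def arc_added_def\<close>)
  moreover have "tree_inv t p l t' p' l' s'"
    using tree_inv_added[OF _ c a o] i by (simp add: full_inv_def)
  ultimately show ?thesis using i o f S by (simp add: full_inv_def)
qed

lemma try_arc_sound:
  assumes e: "env s" and tn: "tree_names t p l t' p' l'"
    and vw: "s ''v'' 0 = v" "s ''w'' 0 = w" "v < n" "w < n" and i: "tree_inv t p l t' p' l' s"
  shows "tree_inv t p l t' p' l' (sem (try_arc_prog t p l t') s)"
proof -
  let ?s = "sem (try_arc_prog t p l t') s"
  note nm = tree_names_neq[OF tn] tree_names_neq[OF tn, symmetric]
  have o: "?s t' = s t'" "?s p' = s p'" "?s l' = s l'"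
    by (rule sem_other, simp add: try_arc_writes nm)+
  have "same_tree t p l s ?s \<or> (arc_candidate t v w s \<and> arc_added t p l v w s ?s)"
    using try_arc_spec[OF e tn vw] by blast
  then show ?thesis
  proof
    assume "same_tree t p l s ?s"
    then show ?thesis using i o same_tree_inv(1) by blast
  qed (use tree_inv_added[OF i] o in blast)
qed

lemma try_arc_full:
  assumes e: "env s" and tn: "tree_names t p l t' p' l'"
    and vw: "s ''v'' 0 = v" "s ''w'' 0 = w" "v < n" "w < n" and i: "full_inv t p l t' p' l' s"
  shows "full_inv t p l t' p' l' (sem (try_arc_prog t p l t') s) \<and>
     (same_tree t p l s (sem (try_arc_prog t p l t') s) \<or>
      supp n (sem (try_arc_prog t p l t') s t) = insert w (supp n (s t)) \<and> w \<notin> supp n (s t)) \<and>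
     (arc_candidate t v w s \<longrightarrow>
       feasible n (insert w (supp n (s t))) (supp n (s t')) (use_arc v w (resid s)) \<longrightarrow>
       w \<in> supp n (sem (try_arc_prog t p l t') s t))"
proof -
  let ?s = "sem (try_arc_prog t p l t') s"
  let ?f = "feasible n (insert w (supp n (s t))) (supp n (s t')) (use_arc v w (resid s))"
  note nm = tree_names_neq[OF tn] tree_names_neq[OF tn, symmetric]
  have o: "?s t' = s t'" "?s p' = s p'" "?s l' = s l'"
    by (rule sem_other, simp add: try_arc_writes nm)+
  have f: "feasible n (supp n (s t)) (supp n (s t')) (resid s)" using i by (simp add: full_inv_def)
  show ?thesis
  proof (cases "arc_candidate t v w s \<and> ?f")
    case True
    then have "arc_added t p l v w s ?s" using try_arc_spec(2)[OF e tn vw] f by blast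
    then show ?thesis
      using True full_inv_added[OF i] o vw arc_added_supp[of t p l v w s ?s]
      by (auto simp: arc_candidate_def)
  next
    case False
    then have "same_tree t p l s ?s"
      using try_arc_spec[OF e tn vw] f by blast
    moreover from this have "full_inv t p l t' p' l' ?s"
      using i o same_tree_inv(2) by blast
    ultimately show ?thesis using False by blast
  qed
qed

lemma extend_writes: "writes (extend_prog t p l t') =
    {t, p, l, ''q'', ''vis'', ''a'', ''b'', ''c'', ''ok'', ''i'', ''v'', ''w''}"
  by (auto simp: extend_prog_def try_arc_writes)

lemma tree_inv_upd:
  "tree_names t p l t' p' l' \<Longrightarrow> x \<in> {''v'', ''w'', ''i'', ''j'', ''d''} \<Longrightarrow>
     tree_inv t p l t' p' l' (upd x c d s) = tree_inv t p l t' p' l' s"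
  by (rule tree_inv_cong) (auto simp: tree_names_def upd_apply)

lemma full_inv_upd:
  "tree_names t p l t' p' l' \<Longrightarrow> x \<in> {''v'', ''w'', ''i'', ''j'', ''d''} \<Longrightarrow>
     full_inv t p l t' p' l' (upd x c d s) = full_inv t p l t' p' l' s"
  by (rule full_inv_cong) (auto simp: tree_names_def upd_apply)

lemma extend_sound:
  assumes e: "env s" and tn: "tree_names t p l t' p' l'" and i: "tree_inv t p l t' p' l' s"
  shows "tree_inv t p l t' p' l' (sem (extend_prog t p l t') s)"
proof -
  note nm = tree_names_neq[OF tn] tree_names_neq[OF tn, symmetric]
  let ?try = "try_arc_prog t p l t'"
  let ?sweep = "PFor ''v'' ''n'' (PFor ''w'' ''n'' ?try)"
  have sweep: "tree_inv t p l t' p' l' (sem ?sweep s0)" if e0: "env s0" and i0: "tree_inv t p l t' p' l' s0" for s0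
  proof (rule For2_rule[where I = "\<lambda>_ s'. tree_inv t p l t' p' l' s'" and n = n])
    fix a b s' assume *: "a < n" "b < n" "s' ''v'' 0 = a" "s' ''w'' 0 = b" "tree_inv t p l t' p' l' s'"
      and fr: "\<And>z. z \<notin> writes ?try \<Longrightarrow> z \<noteq> ''v'' \<Longrightarrow> z \<noteq> ''w'' \<Longrightarrow> s' z = s0 z"
    have "env s'" using e0 by (rule env_cong) (rule fr, auto simp: env_vars_def try_arc_writes nm)
    then show "tree_inv t p l t' p' l' (sem ?try s')" using tn * by (intro try_arc_sound)
  qed (use e0 i0 in \<open>simp_all add: tree_inv_upd[OF tn] try_arc_writes nm env_def\<close>)
  show ?thesis unfolding extend_prog_def
  proof (rule For_rule[where I = "\<lambda>_ s'. tree_inv t p l t' p' l' s'"])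
    fix i s' assume i': "tree_inv t p l t' p' l' s'"
      and fr: "\<And>z. z \<notin> writes ?sweep \<Longrightarrow> z \<noteq> ''i'' \<Longrightarrow> s' z = s z"
    have "env s'" using e by (rule env_cong) (rule fr, auto simp: env_vars_def try_arc_writes nm)
    then show "tree_inv t p l t' p' l' (upd ''i'' 0 (Suc i) (sem ?sweep s'))"
      using sweep i' by (simp add: tree_inv_upd[OF tn])
  qed (use i in \<open>simp_all add: tree_inv_upd[OF tn] try_arc_writes nm\<close>)
qed

text \<open>Unless the tree spans, \<open>feasible_extend\<close> provides an admissible arc at the
  start of each sweep. When the sweep arrives at it, either the tree has grown already or nothing
  has changed and the arc is accepted. So \<open>n\<close> sweeps suffice.\<close>

lemma extend_full:
  assumes e: "env s" and tn: "tree_names t p l t' p' l'" and i: "full_inv t p l t' p' l' s"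
  shows "full_inv t p l t' p' l' (sem (extend_prog t p l t') s) \<and>
    supp n (sem (extend_prog t p l t') s t) = {..<n}"
proof -
  note nm = tree_names_neq[OF tn] tree_names_neq[OF tn, symmetric]
  let ?try = "try_arc_prog t p l t'"
  let ?sweep = "PFor ''v'' ''n'' (PFor ''w'' ''n'' ?try)"
  let ?inv = "full_inv t p l t' p' l'"
  have sweep: "?inv (sem ?sweep s0) \<and> (supp n (s0 t) \<subset> supp n (sem ?sweep s0 t) \<or> supp n (sem ?sweep s0 t) = {..<n})"
    if e0: "env s0" and i0: "?inv s0" for s0
  proof (cases "supp n (s0 t) = {..<n}")
    case True
    have "?inv (sem ?sweep s0) \<and> supp n (sem ?sweep s0 t) = {..<n}"
    proof (rule For2_rule[where I = "\<lambda>_ s'. ?inv s' \<and> supp n (s' t) = {..<n}" and n = n])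
      fix a b s' assume *: "a < n" "b < n" "s' ''v'' 0 = a" "s' ''w'' 0 = b" "?inv s' \<and> supp n (s' t) = {..<n}"
        and fr: "\<And>z. z \<notin> writes ?try \<Longrightarrow> z \<noteq> ''v'' \<Longrightarrow> z \<noteq> ''w'' \<Longrightarrow> s' z = s0 z"
      have "env s'" using e0 by (rule env_cong) (rule fr, auto simp: env_vars_def try_arc_writes nm)
      from try_arc_full[OF this tn *(3,4,1,2)] * show "?inv (sem ?try s') \<and> supp n (sem ?try s' t) = {..<n}"
        by (auto simp: same_tree_def)
    qed (use e0 i0 True in \<open>simp_all add: full_inv_upd[OF tn] try_arc_writes nm env_def\<close>)
    then show ?thesis by blast
  next
    case False
    then have S: "supp n (s0 t) \<subset> {..<n}" using supp_subset by blast
    have "feasible n (supp n (s0 t)) (supp n (s0 t')) (resid s0)" using i0 by (simp add: full_inv_def)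
    from feasible_extend[OF this S] obtain v w where
      c: "v \<in> supp n (s0 t)" "w < n" "w \<notin> supp n (s0 t)" "resid s0 v w > 0"
      and f: "feasible n (insert w (supp n (s0 t))) (supp n (s0 t')) (use_arc v w (resid s0))" by blast
    have v: "v < n" using c by (simp add: in_supp)
    have "?inv (sem ?sweep s0) \<and> supp n (s0 t) \<subseteq> supp n (sem ?sweep s0 t) \<and>
        (supp n (s0 t) \<noteq> supp n (sem ?sweep s0 t) \<or> same_tree t p l s0 (sem ?sweep s0) \<and> n * n \<le> v * n + w)"
    proof (rule For2_rule[where I = "\<lambda>i s'. ?inv s' \<and> supp n (s0 t) \<subseteq> supp n (s' t) \<and>
        (supp n (s0 t) \<noteq> supp n (s' t) \<or> same_tree t p l s0 s' \<and> i \<le> v * n + w)"])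
      show "s0 ''n'' 0 = n" using e0 by (simp add: env_def)
      show "?inv s0 \<and> supp n (s0 t) \<subseteq> supp n (s0 t) \<and>
        (supp n (s0 t) \<noteq> supp n (s0 t) \<or> same_tree t p l s0 s0 \<and> 0 \<le> v * n + w)"
        using i0 by (simp add: same_tree_def)
      fix a b s' assume *: "a < n" "b < n" "s' ''v'' 0 = a" "s' ''w'' 0 = b"
        and J: "?inv s' \<and> supp n (s0 t) \<subseteq> supp n (s' t) \<and>
          (supp n (s0 t) \<noteq> supp n (s' t) \<or> same_tree t p l s0 s' \<and> a * n + b \<le> v * n + w)"
        and fr: "\<And>z. z \<notin> writes ?try \<Longrightarrow> z \<noteq> ''v'' \<Longrightarrow> z \<noteq> ''w'' \<Longrightarrow> s' z = s0 z"
      let ?s = "sem ?try s'"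
      have e': "env s'" using e0 by (rule env_cong) (rule fr, auto simp: env_vars_def try_arc_writes nm)
      have t': "s' t' = s0 t'" by (rule fr) (auto simp: try_arc_writes nm)
      note ta = try_arc_full[OF e' tn *(3,4,1,2) conjunct1[OF J]]
      then have mono: "supp n (s' t) \<subseteq> supp n (?s t)" by (auto simp: same_tree_def)
      have "supp n (s0 t) \<noteq> supp n (?s t) \<or> same_tree t p l s0 ?s \<and> Suc (a * n + b) \<le> v * n + w"
      proof (cases "supp n (s0 t) = supp n (s' t)")
        case False
        with J mono show ?thesis by blast
      next
        case True
        with J have same: "same_tree t p l s0 s'" and le: "a * n + b \<le> v * n + w" by auto
        have q: "resid s' = resid s0" using same by (simp add: same_tree_def resid_def fun_eq_iff)
        show ?thesis
        proof (cases "a * n + b = v * n + w")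
          case True
          then have [simp]: "a = v" "b = w" using arc_index_eq_iff[of b n w a v] * c by auto
          have "arc_candidate t v w s'" using same c q by (simp add: arc_candidate_def same_tree_def)
          moreover have "feasible n (insert w (supp n (s' t))) (supp n (s' t')) (use_arc v w (resid s'))"
            using f q t' same by (simp add: same_tree_def)
          ultimately have "w \<in> supp n (?s t)" using ta by simp
          with c show ?thesis by blast
        next
          case False
          from ta have "same_tree t p l s' ?s \<or> supp n (?s t) = insert b (supp n (s' t)) \<and> b \<notin> supp n (s' t)"
            by blast
          then show ?thesis
          proof
            assume "same_tree t p l s' ?s"
            with same False le show ?thesis by (simp add: same_tree_def)
          next
            assume "supp n (?s t) = insert b (supp n (s' t)) \<and> b \<notin> supp n (s' t)"
            with \<open>supp n (s0 t) = supp n (s' t)\<close> show ?thesis by blast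
          qed
        qed
      qed
      with ta J mono show "?inv ?s \<and> supp n (s0 t) \<subseteq> supp n (?s t) \<and>
          (supp n (s0 t) \<noteq> supp n (?s t) \<or> same_tree t p l s0 ?s \<and> Suc (a * n + b) \<le> v * n + w)"
        by blast
    qed (simp_all add: full_inv_upd[OF tn] try_arc_writes nm same_tree_def)
    \<comment> \<open>The sweep has passed the admissible arc, so the tree cannot be
      unchanged.\<close>
    moreover have "\<not> n * n \<le> v * n + w" using arc_index_less[OF v c(2)] by simp
    ultimately show ?thesis by blast
  qed
  have "?inv (sem (extend_prog t p l t') s) \<and>
      (supp n (sem (extend_prog t p l t') s t) = {..<n} \<or> s ''n'' 0 \<le> card (supp n (sem (extend_prog t p l t') s t)))"
    unfolding extend_prog_def
  proof (rule For_rule[where I = "\<lambda>i s'. ?inv s' \<and> (supp n (s' t) = {..<n} \<or> i \<le> card (supp n (s' t)))"])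
    fix i s' assume J: "?inv s' \<and> (supp n (s' t) = {..<n} \<or> i \<le> card (supp n (s' t)))"
      and fr: "\<And>z. z \<notin> writes ?sweep \<Longrightarrow> z \<noteq> ''i'' \<Longrightarrow> s' z = s z"
    have "env s'" using e by (rule env_cong) (rule fr, auto simp: env_vars_def try_arc_writes nm)
    from sweep[OF this] J have sw: "?inv (sem ?sweep s')"
      "supp n (s' t) \<subset> supp n (sem ?sweep s' t) \<or> supp n (sem ?sweep s' t) = {..<n}" by blast+
    have "supp n (sem ?sweep s' t) = {..<n} \<or> Suc i \<le> card (supp n (sem ?sweep s' t))"
    proof (cases "supp n (s' t) \<subset> supp n (sem ?sweep s' t)")
      case True
      then have "card (supp n (s' t)) < card (supp n (sem ?sweep s' t))" by (intro psubset_card_mono) auto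
      moreover have "supp n (s' t) \<noteq> {..<n}" using True supp_subset by blast
      ultimately show ?thesis using J by auto
    qed (use sw in blast)
    with sw(1) show "?inv (upd ''i'' 0 (Suc i) (sem ?sweep s')) \<and>
        (supp n (upd ''i'' 0 (Suc i) (sem ?sweep s') t) = {..<n} \<or>
         Suc i \<le> card (supp n (upd ''i'' 0 (Suc i) (sem ?sweep s') t)))"
      by (simp add: full_inv_upd[OF tn] nm)
  qed (use i in \<open>simp_all add: full_inv_upd[OF tn] try_arc_writes nm\<close>)
  moreover have "s ''n'' 0 = n" using e by (simp add: env_def)
  moreover have "X = {..<n}" if "n \<le> card X" "X \<subseteq> {..<n}" for X
    using that by (intro card_seteq) auto
  ultimately show ?thesis using supp_subset by metis
qed

end

section \<open>The algorithm: enumeration of small partial arborescences\<close>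

text \<open>
  The number \<open>x\<close> encodes all choices of an attempt in base \<open>B\<close>; its last digit is split off.
\<close>

definition digit_prog :: prog where
  "digit_prog =
     set_var ''d'' (Const 0) ;; set_var ''y'' (Const 0) ;;
     PFor ''i'' ''NI''
       (PCond (Less (var ''i'') (var ''x''))
          (PCond (Less (Add (var ''d'') (Const 1)) (var ''B''))
             (set_var ''d'' (Add (var ''d'') (Const 1)))
             (set_var ''d'' (Const 0) ;; set_var ''y'' (Add (var ''y'') (Const 1))))
          PSkip) ;;
     set_var ''x'' (var ''y'')"

definition add_arc_prog :: "name \<Rightarrow> name \<Rightarrow> name \<Rightarrow> prog" where
  "add_arc_prog t p l =
     PStore t (var ''w'') (Const 1) ;;
     PStore ''q'' (arc_addr ''v'' ''w'') (Sub (Cell ''q'' (arc_addr ''v'' ''w'')) (Const 1)) ;;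
     PStore p (var ''w'') (var ''v'') ;; label_prog l"

text \<open>Adds the candidate arc with number \<open>d\<close>, counted from 1; the digit 0 has no effect.\<close>

definition pick_body :: "name \<Rightarrow> name \<Rightarrow> name \<Rightarrow> prog" where
  "pick_body t p l =
     PCond (Conj (Conj (pos (Cell t (var ''v''))) (Neg (pos (Cell t (var ''w'')))))
         (Conj (pos (Cell ''q'' (arc_addr ''v'' ''w''))) (pos (Cell ''f'' (arc_addr ''v'' ''w'')))))
       (PCond (Conj (pos (var ''d'')) (Less (var ''d'') (Const 2))) (add_arc_prog t p l) PSkip ;;
        set_var ''d'' (Sub (var ''d'') (Const 1)))
       PSkip"

definition pick_prog :: "name \<Rightarrow> name \<Rightarrow> name \<Rightarrow> prog" where
  "pick_prog t p l = PFor ''v'' ''n'' (PFor ''w'' ''n'' (pick_body t p l))"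

definition search_prog :: "name \<Rightarrow> name \<Rightarrow> name \<Rightarrow> prog" where
  "search_prog t p l = PFor ''j'' ''K2'' (digit_prog ;; pick_prog t p l)"

context packing
begin

lemma digit_writes: "writes digit_prog = {''d'', ''y'', ''i'', ''x''}"
  by (auto simp: digit_prog_def)

lemma base_gt_1: "base > 1"
  using k_pos by (simp add: base_def)

text \<open>Division by counting: the first \<open>x\<close> rounds increase the digit
  \<open>d\<close> and carry into \<open>y\<close>, the others do nothing. By assumption the number
  of rounds, \<open>NI\<close>, exceeds \<open>x\<close>.\<close>

lemma digit_spec:
  assumes e: "env s" and x: "s ''x'' 0 < base ^ (4 * k)"
  shows "sem digit_prog s ''d'' 0 = s ''x'' 0 mod base" "sem digit_prog s ''x'' 0 = s ''x'' 0 div base"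
proof -
  define X where "X = s ''x'' 0"
  let ?inc = "PCond (Less (Add (var ''d'') (Const 1)) (var ''B''))
             (set_var ''d'' (Add (var ''d'') (Const 1)))
             (set_var ''d'' (Const 0) ;; set_var ''y'' (Add (var ''y'') (Const 1)))"
  let ?body = "PCond (Less (var ''i'') (var ''x'')) ?inc PSkip"
  define s1 where "s1 = upd ''y'' 0 0 (upd ''d'' 0 0 s)"
  define s2 where "s2 = sem (PFor ''i'' ''NI'' ?body) s1"
  have B: "s ''B'' 0 = base" "s ''NI'' 0 = base ^ (4 * k)" using e by (auto simp: env_def)
  have "s2 ''d'' 0 = min (s1 ''NI'' 0) X mod base \<and> s2 ''y'' 0 = min (s1 ''NI'' 0) X div base"
    unfolding s2_def
  proof (rule For_rule[where I = "\<lambda>i s'. s' ''d'' 0 = min i X mod base \<and> s' ''y'' 0 = min i X div base"])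
    fix i s' assume i: "s' ''i'' 0 = i" and J: "s' ''d'' 0 = min i X mod base \<and> s' ''y'' 0 = min i X div base"
      and fr: "\<And>z. z \<notin> writes ?body \<Longrightarrow> z \<noteq> ''i'' \<Longrightarrow> s' z = s1 z"
    have f: "s' ''x'' 0 = X" "s' ''B'' 0 = base" using fr B by (simp_all add: s1_def X_def)
    show "upd ''i'' 0 (Suc i) (sem ?body s') ''d'' 0 = min (Suc i) X mod base \<and>
        upd ''i'' 0 (Suc i) (sem ?body s') ''y'' 0 = min (Suc i) X div base"
    proof (cases "i < X")
      case True
      then have m: "min i X = i" "min (Suc i) X = Suc i" by auto
      have "i mod base < base" using base_gt_1 by simp
      then show ?thesis using True i J f m by (auto simp: mod_Suc div_Suc)
    next
      case False
      then have "min i X = X" "min (Suc i) X = X" by auto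
      then show ?thesis using False i J f by simp
    qed
  qed (simp_all add: s1_def)
  moreover have "min (s1 ''NI'' 0) X = X" using x B by (simp add: s1_def X_def)
  moreover have "sem digit_prog s = upd ''x'' 0 (s2 ''y'' 0) s2"
    by (simp add: digit_prog_def s2_def s1_def)
  ultimately show "sem digit_prog s ''d'' 0 = s ''x'' 0 mod base" "sem digit_prog s ''x'' 0 = s ''x'' 0 div base"
    by (simp_all add: X_def)
qed

lemma add_arc_writes: "writes (add_arc_prog t p l) = {t, ''q'', p, l}"
  by (auto simp: add_arc_prog_def label_writes)

lemma add_arc_spec:
  assumes e: "env s" and tn: "tree_names t p l t' p' l'"
    and vw: "s ''v'' 0 = v" "s ''w'' 0 = w" "v < n" "w < n"
  shows "arc_added t p l v w s (sem (add_arc_prog t p l) s)"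
proof -
  note nm = tree_names_neq[OF tn] tree_names_neq[OF tn, symmetric]
  have mul: "s ''mul'' v = v * n" using e vw by (simp add: env_def)
  define s1 where "s1 = upd p w v (upd ''q'' (v * n + w) (s ''q'' (v * n + w) - 1) (upd t w 1 s))"
  have "env s1" unfolding s1_def using e by (intro env_upd) (simp_all add: env_vars_def nm)
  have s1: "s1 ''v'' 0 = v" "s1 ''w'' 0 = w" "s1 l = s l" using vw by (simp_all add: s1_def nm)
  have eq: "sem (add_arc_prog t p l) s = sem (label_prog l) s1"
    using vw mul by (simp add: add_arc_prog_def s1_def nm)
  have "sem (label_prog l) s1 l = (s l)(w := if v = r then w else s l v)"
    using label_spec[OF \<open>env s1\<close> s1(1,2), of l] s1(3) by (simp only:)
  moreover have "z \<noteq> l \<Longrightarrow> sem (label_prog l) s1 z = s1 z" for z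
    by (rule sem_other) (simp add: label_writes)
  ultimately show ?thesis unfolding eq arc_added_def by (simp add: s1_def nm fun_upd_def)
qed

lemma pick_body_writes: "writes (pick_body t p l) = {t, ''q'', p, l, ''d''}"
  by (auto simp: pick_body_def add_arc_writes)

lemma pick_writes: "writes (pick_prog t p l) = {t, ''q'', p, l, ''d'', ''v'', ''w''}"
  by (auto simp: pick_prog_def pick_body_writes)

lemma pick_body_spec:
  assumes e: "env s" and tn: "tree_names t p l t' p' l'"
    and vw: "s ''v'' 0 = v" "s ''w'' 0 = w" "v < n" "w < n"
  shows "arc_candidate t v w s \<Longrightarrow> first_arc v w \<Longrightarrow> s ''d'' 0 = 1 \<Longrightarrow>
      arc_added t p l v w s (sem (pick_body t p l) s)"
    and "\<not> (arc_candidate t v w s \<and> first_arc v w \<and> s ''d'' 0 = 1) \<Longrightarrow>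
      same_tree t p l s (sem (pick_body t p l) s)"
    and "sem (pick_body t p l) s ''d'' 0 =
      s ''d'' 0 - (if arc_candidate t v w s \<and> first_arc v w then 1 else 0)"
proof -
  note nm = tree_names_neq[OF tn] tree_names_neq[OF tn, symmetric]
  have mul: "s ''mul'' v = v * n" "0 < s ''f'' (v * n + w) \<longleftrightarrow> first_arc v w" using e vw by (simp_all add: env_def)
  have test: "bval (Conj (Conj (pos (Cell t (var ''v''))) (Neg (pos (Cell t (var ''w'')))))
            (Conj (pos (Cell ''q'' (arc_addr ''v'' ''w''))) (pos (Cell ''f'' (arc_addr ''v'' ''w''))))) s
        \<longleftrightarrow> arc_candidate t v w s \<and> first_arc v w"
    using vw mul by (auto simp: arc_candidate_def in_supp resid_def)
  have test1: "bval (Conj (pos (var ''d'')) (Less (var ''d'') (Const 2))) s \<longleftrightarrow> s ''d'' 0 = 1"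
    by auto
  let ?s = "sem (add_arc_prog t p l) s"
  have d: "?s ''d'' = s ''d''" by (rule sem_other) (simp add: add_arc_writes nm)
  have a: "arc_added t p l v w s ?s" using add_arc_spec[OF e tn vw] .
  show "arc_added t p l v w s (sem (pick_body t p l) s)"
    if "arc_candidate t v w s" "first_arc v w" "s ''d'' 0 = 1"
    using that a unfolding pick_body_def sem.simps test test1 by (simp add: arc_added_def nm fun_upd_def cong: if_cong)
  show "same_tree t p l s (sem (pick_body t p l) s)"
    if "\<not> (arc_candidate t v w s \<and> first_arc v w \<and> s ''d'' 0 = 1)"
    using that unfolding pick_body_def sem.simps test test1 by (auto simp: same_tree_def nm)
  show "sem (pick_body t p l) s ''d'' 0 = s ''d'' 0 - (if arc_candidate t v w s \<and> first_arc v w then 1 else 0)"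
    unfolding pick_body_def sem.simps test test1 using d by simp
qed

lemma pick_sound:
  assumes e: "env s" and tn: "tree_names t p l t' p' l'" and i: "tree_inv t p l t' p' l' s"
  shows "tree_inv t p l t' p' l' (sem (pick_prog t p l) s)"
proof -
  note nm = tree_names_neq[OF tn] tree_names_neq[OF tn, symmetric]
  show ?thesis unfolding pick_prog_def
  proof (rule For2_rule[where I = "\<lambda>_ s'. tree_inv t p l t' p' l' s'" and n = n])
    let ?b = "pick_body t p l"
    fix a b s' assume *: "a < n" "b < n" "s' ''v'' 0 = a" "s' ''w'' 0 = b" and i': "tree_inv t p l t' p' l' s'"
      and fr: "\<And>z. z \<notin> writes ?b \<Longrightarrow> z \<noteq> ''v'' \<Longrightarrow> z \<noteq> ''w'' \<Longrightarrow> s' z = s z"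
    have e': "env s'" using e by (rule env_cong) (rule fr, auto simp: env_vars_def pick_body_writes nm)
    have o: "sem ?b s' t' = s' t'" "sem ?b s' p' = s' p'" "sem ?b s' l' = s' l'"
      by (rule sem_other, simp add: pick_body_writes nm)+
    note sp = pick_body_spec[OF e' tn *(3,4,1,2)]
    show "tree_inv t p l t' p' l' (sem ?b s')"
    proof (cases "arc_candidate t a b s' \<and> first_arc a b \<and> s' ''d'' 0 = 1")
      case True
      then show ?thesis using tree_inv_added[OF i' _ sp(1) o] by blast
    next
      case False
      then show ?thesis using same_tree_inv(1)[OF sp(2) o] i' by blast
    qed
  qed (use e i in \<open>simp_all add: tree_inv_upd[OF tn] pick_body_writes env_def nm\<close>)
qed

section \<open>Numbering of the candidate arcs\<close>

definition candidates :: "name \<Rightarrow> state \<Rightarrow> nat set" where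
  "candidates t s = {i. i < n * n \<and> arc_candidate t (i div n) (i mod n) s \<and> first_arc (i div n) (i mod n)}"

lemma card_less_Suc_in:
  fixes C :: "nat set"
  shows "card {j \<in> C. j < Suc i} = card {j \<in> C. j < i} + of_bool (i \<in> C)"
proof -
  have "{j \<in> C. j < Suc i} = (if i \<in> C then insert i {j \<in> C. j < i} else {j \<in> C. j < i})"
    by (auto simp: less_Suc_eq)
  then show ?thesis by simp
qed

lemma in_candidates:
  assumes "v < n" "w < n"
  shows "v * n + w \<in> candidates t s \<longleftrightarrow> arc_candidate t v w s \<and> first_arc v w"
  using assms arc_index_less[OF assms] by (simp add: candidates_def)

text \<open>Up to the selected arc the tree is unchanged, so the candidates met on the way are those
  of the initial state, and \<open>d\<close> has been counted down to 1 when the arc is reached.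
  Afterwards \<open>d\<close> stays at 0 by truncated subtraction, so no second arc is
  taken.\<close>

lemma pick_hit:
  assumes e: "env s" and tn: "tree_names t p l t' p' l'" and vw: "v < n" "w < n"
    and c: "v * n + w \<in> candidates t s"
    and d: "s ''d'' 0 = Suc (card {j \<in> candidates t s. j < v * n + w})"
  shows "arc_added t p l v w s (sem (pick_prog t p l) s)"
proof -
  note nm = tree_names_neq[OF tn] tree_names_neq[OF tn, symmetric]
  let ?b = "pick_body t p l"
  let ?C = "candidates t s"
  let ?i = "v * n + w"
  let ?cnt = "\<lambda>i. card {j \<in> ?C. j < i}"
  have mono: "?cnt i \<le> ?cnt j" if "i \<le> j" for i j
    using that by (intro card_mono) auto
  define I where "I i s' \<longleftrightarrow> (if i \<le> ?i then same_tree t p l s s' \<and> s' ''d'' 0 = Suc (?cnt ?i) - ?cnt i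
      else arc_added t p l v w s s' \<and> s' ''d'' 0 = 0)" for i s'
  have "I (n * n) (sem (pick_prog t p l) s)"
    unfolding pick_prog_def
  proof (rule For2_rule[where I = I])
    show "s ''n'' 0 = n" using e by (simp add: env_def)
    show "I 0 s" using d by (simp add: I_def same_tree_def)
    show "I i (upd ''v'' 0 c s')" "I i (upd ''w'' 0 c s')" if "I i s'" for i s' c
      using that by (auto simp: I_def same_tree_def arc_added_def nm)
    fix a b s' assume *: "a < n" "b < n" "s' ''v'' 0 = a" "s' ''w'' 0 = b" and J: "I (a * n + b) s'"
      and fr: "\<And>z. z \<notin> writes ?b \<Longrightarrow> z \<noteq> ''v'' \<Longrightarrow> z \<noteq> ''w'' \<Longrightarrow> s' z = s z"
    have e': "env s'" using e by (rule env_cong) (rule fr, auto simp: env_vars_def pick_body_writes nm)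
    note sp = pick_body_spec[OF e' tn *(3,4,1,2)]
    let ?j = "a * n + b"
    have cand: "arc_candidate t a b s' \<and> first_arc a b \<longleftrightarrow> ?j \<in> ?C" if "same_tree t p l s s'"
      using that in_candidates[OF *(1,2), of t s]
      by (simp add: arc_candidate_def same_tree_def resid_def)
    consider "?j < ?i" | "?j = ?i" | "?j > ?i" by linarith
    then show "I (Suc ?j) (sem ?b s')"
    proof cases
      case 1
      then have st: "same_tree t p l s s'" and ds: "s' ''d'' 0 = Suc (?cnt ?i) - ?cnt ?j"
        using J by (auto simp: I_def)
      have le: "?cnt (Suc ?j) \<le> ?cnt ?i" using 1 by (intro mono) simp
      have "\<not> (arc_candidate t a b s' \<and> first_arc a b \<and> s' ''d'' 0 = 1)"
        using cand[OF st] ds le card_less_Suc_in[of ?C ?j] by auto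
      from sp(2)[OF this] st have "same_tree t p l s (sem ?b s')" by (simp add: same_tree_def)
      moreover have "sem ?b s' ''d'' 0 = Suc (?cnt ?i) - ?cnt (Suc ?j)"
        using sp(3) cand[OF st] ds le card_less_Suc_in[of ?C ?j] by (simp split: if_splits)
      ultimately show ?thesis using 1 by (simp add: I_def)
    next
      case 2
      then have [simp]: "a = v" "b = w" using arc_index_eq_iff[of b n w a v] * vw by auto
      have st: "same_tree t p l s s'" and ds: "s' ''d'' 0 = 1" using J by (auto simp: I_def)
      have ca: "arc_candidate t v w s'" "first_arc v w" using cand[OF st] c by auto
      have "arc_added t p l v w s' (sem ?b s')" using sp(1) ca ds by simp
      then have "arc_added t p l v w s (sem ?b s')" using st by (simp add: arc_added_def same_tree_def)
      moreover have "sem ?b s' ''d'' 0 = 0" using sp(3) ds ca by simp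
      ultimately show ?thesis by (simp add: I_def)
    next
      case 3
      then have aa: "arc_added t p l v w s s'" and ds: "s' ''d'' 0 = 0" using J by (auto simp: I_def)
      have "same_tree t p l s' (sem ?b s')" using sp(2) ds by simp
      then have "arc_added t p l v w s (sem ?b s')" using aa by (simp add: arc_added_def same_tree_def)
      moreover have "sem ?b s' ''d'' 0 = 0" using sp(3) ds by simp
      ultimately show ?thesis using 3 by (simp add: I_def)
    qed
  qed (simp_all add: pick_body_writes nm)
  moreover have "?i < n * n" using arc_index_less[OF vw] .
  ultimately show ?thesis by (simp add: I_def)
qed

lemma pick_zero:
  assumes e: "env s" and tn: "tree_names t p l t' p' l'" and d: "s ''d'' 0 = 0"
  shows "same_tree t p l s (sem (pick_prog t p l) s)"
proof -
  note nm = tree_names_neq[OF tn] tree_names_neq[OF tn, symmetric]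
  let ?b = "pick_body t p l"
  have "same_tree t p l s (sem (pick_prog t p l) s) \<and> sem (pick_prog t p l) s ''d'' 0 = 0"
    unfolding pick_prog_def
  proof (rule For2_rule[where I = "\<lambda>_ s'. same_tree t p l s s' \<and> s' ''d'' 0 = 0" and n = n])
    fix a b s' assume *: "a < n" "b < n" "s' ''v'' 0 = a" "s' ''w'' 0 = b"
      and J: "same_tree t p l s s' \<and> s' ''d'' 0 = 0"
      and fr: "\<And>z. z \<notin> writes ?b \<Longrightarrow> z \<noteq> ''v'' \<Longrightarrow> z \<noteq> ''w'' \<Longrightarrow> s' z = s z"
    have e': "env s'" using e by (rule env_cong) (rule fr, auto simp: env_vars_def pick_body_writes nm)
    note sp = pick_body_spec[OF e' tn *(3,4,1,2)]
    have "same_tree t p l s' (sem ?b s')" using sp(2) J by simp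
    moreover have "sem ?b s' ''d'' 0 = 0" using sp(3) J by simp
    ultimately show "same_tree t p l s (sem ?b s') \<and> sem ?b s' ''d'' 0 = 0"
      using J by (simp add: same_tree_def)
  qed (use e d in \<open>simp_all add: pick_body_writes nm env_def same_tree_def\<close>)
  then show ?thesis by blast
qed

lemma search_writes: "writes (search_prog t p l) =
    {t, ''q'', p, l, ''d'', ''v'', ''w'', ''y'', ''i'', ''x'', ''j''}"
  by (auto simp: search_prog_def digit_writes pick_writes)

lemma search_sound:
  assumes e: "env s" and tn: "tree_names t p l t' p' l'" and i: "tree_inv t p l t' p' l' s"
  shows "tree_inv t p l t' p' l' (sem (search_prog t p l) s)"
proof -
  note nm = tree_names_neq[OF tn] tree_names_neq[OF tn, symmetric]
  let ?b = "digit_prog ;; pick_prog t p l"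
  have D: "tree_inv t p l t' p' l' (sem digit_prog s') = tree_inv t p l t' p' l' s'" for s'
    by (rule tree_inv_cong, rule sem_other) (auto simp: digit_writes nm)
  show ?thesis unfolding search_prog_def
  proof (rule For_rule[where I = "\<lambda>_ s'. tree_inv t p l t' p' l' s'"])
    fix i s' assume J: "tree_inv t p l t' p' l' s'"
      and fr: "\<And>z. z \<notin> writes ?b \<Longrightarrow> z \<noteq> ''j'' \<Longrightarrow> s' z = s z"
    have "env s'" using e by (rule env_cong) (rule fr, auto simp: env_vars_def digit_writes pick_writes nm)
    then have "env (sem digit_prog s')" by (rule env_sem) (auto simp: digit_writes env_vars_def)
    from pick_sound[OF this tn] J D have "tree_inv t p l t' p' l' (sem ?b s')" by simp
    then show "tree_inv t p l t' p' l' (upd ''j'' 0 (Suc i) (sem ?b s'))" by (simp add: tree_inv_upd[OF tn])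
  qed (use i in \<open>simp_all add: tree_inv_upd[OF tn] digit_writes pick_writes nm\<close>)
qed

end

section \<open>Digits that rebuild a given pair of kernels\<close>

context packing
begin

text \<open>The arrays are compared only where the tree is defined: elsewhere \<open>p\<close> and
  \<open>l\<close> may hold remains of earlier attempts.\<close>

definition matches :: "name \<Rightarrow> name \<Rightarrow> name \<Rightarrow> nat set \<Rightarrow> (nat \<Rightarrow> nat) \<Rightarrow> (nat \<Rightarrow> nat) \<Rightarrow> state \<Rightarrow> bool" where
  "matches t p l S q h s \<longleftrightarrow> supp n (s t) = S \<and> (\<forall>v\<in>S - {r}. s p v = q v) \<and> (\<forall>v\<in>S. s l v = h v)"

text \<open>The candidates without reference to a state, so that the digit selecting an arc can be
  fixed before the program runs.\<close>

definition candidate_arcs :: "nat set \<Rightarrow> (nat \<Rightarrow> nat) \<Rightarrow> nat set \<Rightarrow> (nat \<Rightarrow> nat) \<Rightarrow> nat set" where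
  "candidate_arcs S q T q' = {i. i < n * n \<and> i div n \<in> S \<and> i mod n \<notin> S \<and>
     residual S q T q' (i div n) (i mod n) > 0 \<and> first_arc (i div n) (i mod n)}"

lemma candidates_eq:
  assumes "tree_inv t p l t' p' l' s" "matches t p l S q h s" "matches t' p' l' T q' h' s"
  shows "candidates t s = candidate_arcs S q T q'"
proof -
  have "resid s a b = residual S q T q' a b" if "a < n" "b < n" for a b
  proof -
    have "uses_arc r S (s p) a b = uses_arc r S q a b" "uses_arc r T (s p') a b = uses_arc r T q' a b"
      using assms(2,3) by (auto simp: uses_arc_def matches_def)
    then show ?thesis using assms that by (simp add: tree_inv_def matches_def residual_def)
  qed
  moreover have "i div n < n" "i mod n < n" if "i < n * n" for i
    using that r_less by (auto simp: less_mult_imp_div_less)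
  ultimately show ?thesis
    using assms(2) by (auto simp: candidates_def candidate_arcs_def arc_candidate_def matches_def)
qed

lemma card_candidate_arcs:
  assumes "S \<subseteq> {..<n}"
  shows "card (candidate_arcs S q T q') \<le> card S * (6 * k)"
proof -
  have fin: "finite S" using assms finite_subset by blast
  let ?P = "SIGMA v:S. {w. w < n \<and> first_arc v w}"
  have "candidate_arcs S q T q' \<subseteq> (\<lambda>(v, w). v * n + w) ` ?P"
  proof
    fix i assume i: "i \<in> candidate_arcs S q T q'"
    then have "(i div n, i mod n) \<in> ?P" using r_less by (auto simp: candidate_arcs_def)
    then show "i \<in> (\<lambda>(v, w). v * n + w) ` ?P"
      by (rule rev_image_eqI) simp
  qed
  then have "card (candidate_arcs S q T q') \<le> card ?P"
    using fin by (intro surj_card_le) auto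
  also have "\<dots> = (\<Sum>v\<in>S. card {w. w < n \<and> first_arc v w})"
    using fin by (intro card_SigmaI) auto
  also have "\<dots> \<le> (\<Sum>v\<in>S. 6 * k)" using card_first_arcs_le by (intro sum_mono) auto
  finally show ?thesis by simp
qed

text \<open>Includes the increment of the counter, so that the whole search loop is an iterate of
  this function.\<close>

definition search_step :: "name \<Rightarrow> name \<Rightarrow> name \<Rightarrow> state \<Rightarrow> state" where
  "search_step t p l s = upd ''j'' 0 (Suc (sem (digit_prog ;; pick_prog t p l) s ''j'' 0))
     (sem (digit_prog ;; pick_prog t p l) s)"

definition search_inv where
  "search_inv t p l S q h t' p' l' T q' h' s \<longleftrightarrow> env s \<and> tree_inv t p l t' p' l' s \<and>
     matches t p l S q h s \<and> matches t' p' l' T q' h' s"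

lemma search_step_basic:
  assumes tn: "tree_names t p l t' p' l'" and i: "search_inv t p l S q h t' p' l' T q' h' s"
    and x: "s ''x'' 0 < base ^ (4 * k)"
  defines "s1 \<equiv> sem digit_prog s" and "s' \<equiv> search_step t p l s"
  shows "search_inv t p l S q h t' p' l' T q' h' s1" "s1 ''d'' 0 = s ''x'' 0 mod base"
    "s' ''x'' 0 = s ''x'' 0 div base" "env s'" "tree_inv t p l t' p' l' s'"
    "matches t' p' l' T q' h' s'"
    "\<And>z. z \<in> {t, p, l, ''q''} \<Longrightarrow> s' z = sem (pick_prog t p l) s1 z"
proof -
  note nm = tree_names_neq[OF tn] tree_names_neq[OF tn, symmetric]
  have e: "env s" using i by (simp add: search_inv_def)
  have f1: "z \<notin> {''d'', ''y'', ''i'', ''x''} \<Longrightarrow> s1 z = s z" for z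
    unfolding s1_def by (rule sem_other) (simp add: digit_writes)
  have e1: "env s1" unfolding s1_def using e by (rule env_sem) (auto simp: digit_writes env_vars_def)
  have i1: "tree_inv t p l t' p' l' s1"
  proof -
    have "tree_inv t p l t' p' l' s1 = tree_inv t p l t' p' l' s"
      by (rule tree_inv_cong, rule f1) (auto simp: nm)
    with i show ?thesis by (simp add: search_inv_def)
  qed
  have m1: "matches t p l S q h s1" "matches t' p' l' T q' h' s1"
    using i f1 by (simp_all add: search_inv_def matches_def nm)
  show "search_inv t p l S q h t' p' l' T q' h' s1" using e1 i1 m1 by (simp add: search_inv_def)
  show "s1 ''d'' 0 = s ''x'' 0 mod base" unfolding s1_def using digit_spec[OF e x] by simp
  have x1: "s1 ''x'' 0 = s ''x'' 0 div base" unfolding s1_def using digit_spec[OF e x] by simp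
  have f2: "z \<notin> {t, ''q'', p, l, ''d'', ''v'', ''w'', ''j''} \<Longrightarrow> s' z = s1 z" for z
  proof -
    assume z: "z \<notin> {t, ''q'', p, l, ''d'', ''v'', ''w'', ''j''}"
    have "sem (pick_prog t p l) s1 z = s1 z" by (rule sem_other) (use z in \<open>simp add: pick_writes\<close>)
    then show "s' z = s1 z" using z by (simp add: s'_def search_step_def s1_def)
  qed
  show "s' ''x'' 0 = s ''x'' 0 div base" using f2[of "''x''"] x1 by (simp add: nm)
  show "env s'" using e1 by (rule env_cong) (rule f2, auto simp: env_vars_def nm)
  show "tree_inv t p l t' p' l' s'"
    unfolding s'_def search_step_def using pick_sound[OF e1 tn i1]
    by (simp add: tree_inv_upd[OF tn] s1_def)
  show "matches t' p' l' T q' h' s'" using m1(2) f2 by (simp add: matches_def nm)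
  show "s' z = sem (pick_prog t p l) s1 z" if "z \<in> {t, p, l, ''q''}" for z
    using that by (auto simp: s'_def search_step_def s1_def nm)
qed

lemma search_step_zero:
  assumes tn: "tree_names t p l t' p' l'" and i: "search_inv t p l S q h t' p' l' T q' h' s"
    and x: "s ''x'' 0 < base ^ (4 * k)" and d: "s ''x'' 0 mod base = 0"
  shows "search_inv t p l S q h t' p' l' T q' h' (search_step t p l s)"
proof -
  note b = search_step_basic[OF tn i x]
  let ?s1 = "sem digit_prog s"
  have "same_tree t p l ?s1 (sem (pick_prog t p l) ?s1)"
    by (rule pick_zero[OF _ tn]) (use b(1,2) d in \<open>auto simp: search_inv_def\<close>)
  then have "matches t p l S q h (search_step t p l s)"
    using b(1,7) by (simp add: same_tree_def search_inv_def matches_def)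
  with b show ?thesis by (simp add: search_inv_def)
qed

lemma search_step_hit:
  assumes tn: "tree_names t p l t' p' l'" and i: "search_inv t p l S q h t' p' l' T q' h' s"
    and x: "s ''x'' 0 < base ^ (4 * k)"
    and pt: "partial_tree r S' q h" and S': "S' \<subseteq> {..<n}" and w: "w \<in> S' - S" "q w \<in> S"
    and S: "r \<in> S" "S \<subseteq> S'"
    and c: "q w * n + w \<in> candidate_arcs S q T q'"
    and d: "s ''x'' 0 mod base = Suc (card {j \<in> candidate_arcs S q T q'. j < q w * n + w})"
  shows "search_inv t p l (insert w S) q h t' p' l' T q' h' (search_step t p l s)"
proof -
  note b = search_step_basic[OF tn i x]
  let ?s1 = "sem digit_prog s"
  let ?s' = "search_step t p l s"
  note nm = tree_names_neq[OF tn] tree_names_neq[OF tn, symmetric]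
  have i1: "env ?s1" "tree_inv t p l t' p' l' ?s1" "matches t p l S q h ?s1" "matches t' p' l' T q' h' ?s1"
    using b(1) by (auto simp: search_inv_def)
  note ce = candidates_eq[OF i1(2-4)]
  have lt: "q w < n" "w < n" using w S S' by auto
  have wr: "w \<noteq> r" using w S by auto
  have "arc_added t p l (q w) w ?s1 (sem (pick_prog t p l) ?s1)"
    by (rule pick_hit[OF i1(1) tn lt]) (use ce c d b(2) in auto)
  then have a: "arc_added t p l (q w) w ?s1 ?s'"
    using b(7) by (simp add: arc_added_def)
  have m1: "supp n (?s1 t) = S" "\<And>v. v \<in> S \<Longrightarrow> v \<noteq> r \<Longrightarrow> ?s1 p v = q v" "\<And>v. v \<in> S \<Longrightarrow> ?s1 l v = h v"
    using i1(3) by (auto simp: matches_def)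
  have "supp n (?s' t) = insert w S" using arc_added_supp[OF a lt(2)] m1 by simp
  moreover have "?s' p v = q v" if "v \<in> insert w S - {r}" for v
    using a m1(2) that by (auto simp: arc_added_def)
  moreover have "?s' l v = h v" if "v \<in> insert w S" for v
  proof (cases "v = w")
    case True
    have "h w = (if q w = r then w else h (q w))" using partial_tree_label[OF pt _ wr] w by blast
    then show ?thesis using a m1(3)[OF w(2)] True by (simp add: arc_added_def)
  next
    case False
    then show ?thesis using a m1(3) that by (simp add: arc_added_def)
  qed
  ultimately have "matches t p l (insert w S) q h ?s'" by (simp add: matches_def)
  with b show ?thesis by (simp add: search_inv_def)
qed

text \<open>Each round adds one missing arc of the kernel. Its digit depends on the trees and not on
  the state, so one number \<open>N\<close> works for all states. Digits are consumed from the least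
  significant end, and the higher part \<open>Y\<close> is left in \<open>x\<close> for the search
  that follows.\<close>

lemma search_complete:
  assumes tn: "tree_names t p l t' p' l'"
    and pt: "partial_tree r S' q h" and S': "S' \<subseteq> {..<n}" "card S' \<le> 2 * k"
    and fa: "\<forall>v\<in>S' - {r}. first_arc (q v) v" and pk: "packed S' q T q'"
    and S: "r \<in> S" "S \<subseteq> S'" and cS: "card (S' - S) \<le> j"
  shows "\<exists>N<base ^ j. \<forall>s Y. search_inv t p l S q h t' p' l' T q' h' s \<longrightarrow>
      s ''x'' 0 = N + base ^ j * Y \<longrightarrow> s ''x'' 0 < base ^ (4 * k) \<longrightarrow>
      search_inv t p l S' q h t' p' l' T q' h' ((search_step t p l ^^ j) s) \<and>
      (search_step t p l ^^ j) s ''x'' 0 = Y"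
  using S cS
proof (induction j arbitrary: S)
  case 0
  have "finite S'" using S'(1) finite_subset by blast
  then have "S' = S" using 0 by auto
  then show ?case by auto
next
  case (Suc j)
  have finS': "finite S'" using S'(1) finite_subset by blast
  have "\<exists>d S2. d < base \<and> r \<in> S2 \<and> S2 \<subseteq> S' \<and> card (S' - S2) \<le> j \<and>
    (\<forall>s. search_inv t p l S q h t' p' l' T q' h' s \<longrightarrow> s ''x'' 0 < base ^ (4 * k) \<longrightarrow>
       s ''x'' 0 mod base = d \<longrightarrow> search_inv t p l S2 q h t' p' l' T q' h' (search_step t p l s))"
  proof (cases "S = S'")
    case True
    \<comment> \<open>A kernel that is complete early is kept by the digit 0.\<close>
    then show ?thesis using base_gt_1 Suc.prems search_step_zero[OF tn]
      by (intro exI[of _ 0] exI[of _ S']) auto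
  next
    case False
    then obtain w where w: "w \<in> S' - S" "q w \<in> S"
      using partial_tree_exit[OF pt Suc.prems(1)] Suc.prems(2) by blast
    have lt: "q w < n" "w < n" using w Suc.prems S' by auto
    have wr: "w \<noteq> r" using w Suc.prems by auto
    let ?C = "candidate_arcs S q T q'"
    have "uses_arc r S' q (q w) w + uses_arc r T q' (q w) w \<le> m (q w) w"
      using pk lt unfolding packed_def by blast
    \<comment> \<open>\<open>packed\<close> for the finished kernel \<open>S'\<close> already
      accounts for this arc, and \<open>S\<close> does not use it yet.\<close>
    then have "residual S q T q' (q w) w > 0"
      using w wr by (auto simp: residual_def uses_arc_def)
    then have c: "q w * n + w \<in> ?C"
      using w lt fa wr arc_index_less[OF lt] by (auto simp: candidate_arcs_def)
    have finC: "finite ?C" by (simp add: candidate_arcs_def)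
    let ?d = "Suc (card {j \<in> ?C. j < q w * n + w})"
    have "{j \<in> ?C. j < q w * n + w} \<subset> ?C" using c by blast
    then have "?d \<le> card ?C" using finC by (simp add: psubset_card_mono Suc_leI)
    also have "\<dots> \<le> card S * (6 * k)"
      by (rule card_candidate_arcs) (use Suc.prems S' in auto)
    also have "\<dots> \<le> (2 * k) * (6 * k)"
      using card_mono[OF finS' Suc.prems(2)] S'(2) by (intro mult_le_mono1) simp
    finally have "?d < base" by (simp add: base_def)
    moreover have "card (S' - insert w S) < card (S' - S)"
      using w finS' by (intro psubset_card_mono) auto
    ultimately show ?thesis
      using Suc.prems w search_step_hit[OF tn _ _ pt S'(1) w Suc.prems(1,2) c]
      by (intro exI[of _ ?d] exI[of _ "insert w S"]) auto
  qed
  then obtain d S2 where d: "d < base" "r \<in> S2" "S2 \<subseteq> S'" "card (S' - S2) \<le> j"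
    and step: "\<And>s. search_inv t p l S q h t' p' l' T q' h' s \<Longrightarrow> s ''x'' 0 < base ^ (4 * k) \<Longrightarrow>
       s ''x'' 0 mod base = d \<Longrightarrow> search_inv t p l S2 q h t' p' l' T q' h' (search_step t p l s)"
    by blast
  from Suc.IH[OF d(2-4)] obtain N where N: "N < base ^ j"
    "\<And>s Y. search_inv t p l S2 q h t' p' l' T q' h' s \<Longrightarrow>
      s ''x'' 0 = N + base ^ j * Y \<Longrightarrow> s ''x'' 0 < base ^ (4 * k) \<Longrightarrow>
      search_inv t p l S' q h t' p' l' T q' h' ((search_step t p l ^^ j) s) \<and>
      (search_step t p l ^^ j) s ''x'' 0 = Y" by blast
  have lt: "d + base * N < base ^ Suc j"
  proof -
    have "d + base * N < base * Suc N" using d(1) by simp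
    also have "\<dots> \<le> base * base ^ j" using N(1) by (intro mult_le_mono2) simp
    finally show ?thesis by simp
  qed
  show ?case
  proof (intro exI[of _ "d + base * N"] conjI allI impI)
    fix s Y assume i: "search_inv t p l S q h t' p' l' T q' h' s"
      and x: "s ''x'' 0 = d + base * N + base ^ Suc j * Y" and xl: "s ''x'' 0 < base ^ (4 * k)"
    have x': "s ''x'' 0 = d + base * (N + base ^ j * Y)" using x by (simp add: algebra_simps)
    have md: "s ''x'' 0 mod base = d" "s ''x'' 0 div base = N + base ^ j * Y"
      unfolding x' using d(1) by simp_all
    let ?s = "search_step t p l s"
    have "?s ''x'' 0 = N + base ^ j * Y" using search_step_basic(3)[OF tn i xl] md by simp
    moreover from this have "?s ''x'' 0 < base ^ (4 * k)"
      using xl md by (metis div_le_dividend le_less_trans)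
    ultimately have "search_inv t p l S' q h t' p' l' T q' h' ((search_step t p l ^^ j) ?s) \<and>
      (search_step t p l ^^ j) ?s ''x'' 0 = Y"
      using N(2) step[OF i xl md(1)] by blast
    then show "search_inv t p l S' q h t' p' l' T q' h' ((search_step t p l ^^ Suc j) s)"
      "(search_step t p l ^^ Suc j) s ''x'' 0 = Y"
      by (simp_all only: funpow_Suc_right comp_apply)
  qed (fact lt)
qed

lemma search_sem:
  assumes "env s"
  shows "sem (search_prog t p l) s = (search_step t p l ^^ (2 * k)) (upd ''j'' 0 0 s)"
proof -
  have "s ''K2'' 0 = 2 * k" using assms by (simp add: env_def)
  then show ?thesis
    unfolding search_prog_def sem.simps(5) search_step_def[abs_def] by (simp only:)
qed

end

section \<open>The algorithm: main loop\<close>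

definition reset_prog :: prog where
  "reset_prog =
     PFor ''v'' ''n'' (PStore ''t1'' (var ''v'') (Const 0) ;; PStore ''t2'' (var ''v'') (Const 0)) ;;
     PFor ''v'' ''n'' (PFor ''w'' ''n''
       (PStore ''q'' (arc_addr ''v'' ''w'') (Cell ''m'' (arc_addr ''v'' ''w'')))) ;;
     PStore ''t1'' (var ''r'') (Const 1) ;; PStore ''t2'' (var ''r'') (Const 1) ;;
     PStore ''l1'' (var ''r'') (var ''r'') ;; PStore ''l2'' (var ''r'') (var ''r'')"

definition span_check_prog :: prog where
  "span_check_prog = PFor ''v'' ''n''
     (PCond (Conj (pos (Cell ''t1'' (var ''v''))) (pos (Cell ''t2'' (var ''v''))))
        PSkip (set_var ''ok'' (Const 0)))"

definition safe_check_prog :: "name \<Rightarrow> prog" where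
  "safe_check_prog l = PFor ''v'' ''n''
     (PCond (eq (var ''v'') (var ''r'')) PSkip
        (set_var ''e'' (Const 0) ;;
         PFor ''w'' ''n'' (PCond (eq (Cell l (var ''w'')) (var ''v'')) PSkip
           (set_var ''e'' (Add (var ''e'') (Const 1)))) ;;
         PCond (Less (var ''e'') (var ''k'')) (set_var ''ok'' (Const 0)) PSkip))"

text \<open>\<open>i1\<close> is left alone: its initial zeros are the indices chosen for the first
  tree.\<close>

definition output_prog :: prog where
  "output_prog = set_var ''ans'' (Const 1) ;;
     PFor ''v'' ''n'' (PCond (eq (Cell ''p1'' (var ''v'')) (Cell ''p2'' (var ''v'')))
        (PStore ''i2'' (var ''v'') (Const 1)) (PStore ''i2'' (var ''v'') (Const 0)))"

definition attempt_prog :: prog where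
  "attempt_prog = reset_prog ;;
     search_prog ''t1'' ''p1'' ''l1'' ;; search_prog ''t2'' ''p2'' ''l2'' ;;
     extend_prog ''t1'' ''p1'' ''l1'' ''t2'' ;; extend_prog ''t2'' ''p2'' ''l2'' ''t1'' ;;
     set_var ''ok'' (Const 1) ;;
     span_check_prog ;; safe_check_prog ''l1'' ;; safe_check_prog ''l2'' ;;
     PCond (pos (var ''ok'')) output_prog PSkip"

text \<open>A bounded loop cannot stop early; after a success the remaining rounds are skipped,
  which also protects the result.\<close>

definition loop_prog :: prog where
  "loop_prog = PFor ''N'' ''NI''
     (PCond (pos (var ''ans'')) PSkip (set_var ''x'' (var ''N'') ;; attempt_prog))"

definition setup_constants_prog :: prog where
  "setup_constants_prog =
     PFor ''v'' ''n'' (PStore ''mul'' (Add (var ''v'') (Const 1)) (Add (Cell ''mul'' (var ''v'')) (var ''n''))) ;;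
     set_var ''K2'' (Add (var ''k'') (var ''k'')) ;;
     set_var ''M'' (Add (Add (var ''K2'') (var ''K2'')) (var ''K2'')) ;;
     set_var ''K12'' (Add (var ''M'') (var ''M'')) ;;
     set_var ''K4'' (Add (var ''K2'') (var ''K2'')) ;;
     set_var ''B'' (Const 1) ;;
     PFor ''i'' ''k'' (set_var ''B'' (Add (var ''B'') (var ''K12'')))"

definition setup_power_prog :: prog where
  "setup_power_prog = set_var ''NI'' (Const 1) ;;
     PFor ''i'' ''K4''
       (set_var ''y'' (Const 0) ;;
        PFor ''j'' ''B'' (set_var ''y'' (Add (var ''y'') (var ''NI''))) ;;
        set_var ''NI'' (var ''y''))"

definition setup_first_arcs_prog :: prog where
  "setup_first_arcs_prog = PFor ''v'' ''n''
     (set_var ''row'' (Const 0) ;;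
      PFor ''w'' ''n'' (PCond (pos (Cell ''m'' (arc_addr ''v'' ''w'')))
        (PCond (Less (var ''row'') (var ''M'')) (PStore ''f'' (arc_addr ''v'' ''w'') (Const 1)) PSkip ;;
         set_var ''row'' (Add (var ''row'') (Const 1)))
        PSkip))"

context packing
begin

lemma reset_writes: "writes reset_prog = {''v'', ''t1'', ''t2'', ''w'', ''q'', ''l1'', ''l2''}"
  by (auto simp: reset_prog_def)

lemma names1: "tree_names ''t1'' ''p1'' ''l1'' ''t2'' ''p2'' ''l2''"
  and names2: "tree_names ''t2'' ''p2'' ''l2'' ''t1'' ''p1'' ''l1''"
  by (simp_all add: tree_names_def)

abbreviation "inv1 \<equiv> tree_inv ''t1'' ''p1'' ''l1'' ''t2'' ''p2'' ''l2''"
abbreviation "inv2 \<equiv> tree_inv ''t2'' ''p2'' ''l2'' ''t1'' ''p1'' ''l1''"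
abbreviation "full1 \<equiv> full_inv ''t1'' ''p1'' ''l1'' ''t2'' ''p2'' ''l2''"
abbreviation "full2 \<equiv> full_inv ''t2'' ''p2'' ''l2'' ''t1'' ''p1'' ''l1''"

lemma reset_spec:
  assumes e: "env s"
  shows "inv1 (sem reset_prog s)" "env (sem reset_prog s)"
    "h r = r \<Longrightarrow> matches ''t1'' ''p1'' ''l1'' {r} q h (sem reset_prog s)"
    "h r = r \<Longrightarrow> matches ''t2'' ''p2'' ''l2'' {r} q h (sem reset_prog s)"
proof -
  let ?c = "PStore ''t1'' (var ''v'') (Const 0) ;; PStore ''t2'' (var ''v'') (Const 0)"
  let ?q = "PStore ''q'' (arc_addr ''v'' ''w'') (Cell ''m'' (arc_addr ''v'' ''w''))"
  define s1 where "s1 = sem (PFor ''v'' ''n'' ?c) s"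
  define s2 where "s2 = sem (PFor ''v'' ''n'' (PFor ''w'' ''n'' ?q)) s1"
  have n: "s ''n'' 0 = n" using e by (simp add: env_def)
  have "\<forall>v<s ''n'' 0. s1 ''t1'' v = 0 \<and> s1 ''t2'' v = 0" unfolding s1_def
  proof (rule For_rule[where I = "\<lambda>i s'. \<forall>v<i. s' ''t1'' v = 0 \<and> s' ''t2'' v = 0"])
    fix i :: nat and s' :: state assume "s' ''v'' 0 = i" "\<forall>v<i. s' ''t1'' v = 0 \<and> s' ''t2'' v = 0"
    then show "\<forall>v<Suc i. upd ''v'' 0 (Suc i) (sem ?c s') ''t1'' v = 0 \<and> upd ''v'' 0 (Suc i) (sem ?c s') ''t2'' v = 0"
      by (auto simp: less_Suc_eq)
  qed simp_all
  then have t1: "\<And>v. v < n \<Longrightarrow> s1 ''t1'' v = 0 \<and> s1 ''t2'' v = 0" using n by simp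
  have e1: "env s1" unfolding s1_def using e by (rule env_sem) (auto simp: env_vars_def)
  have e2: "env s2" unfolding s2_def using e1 by (rule env_sem) (auto simp: env_vars_def)
  have f2: "s2 ''t1'' = s1 ''t1''" "s2 ''t2'' = s1 ''t2''" unfolding s2_def by (rule sem_other, simp)+
  have q2: "\<forall>a<n. \<forall>b<n. a * n + b < n * n \<longrightarrow> s2 ''q'' (a * n + b) = m a b" unfolding s2_def
  proof (rule For2_rule[where I = "\<lambda>i s'. \<forall>a<n. \<forall>b<n. a * n + b < i \<longrightarrow> s' ''q'' (a * n + b) = m a b"])
    show "s1 ''n'' 0 = n" using e1 by (simp add: env_def)
    fix a b :: nat and s' :: state assume *: "a < n" "b < n" "s' ''v'' 0 = a" "s' ''w'' 0 = b"
      and fr: "\<And>z. z \<notin> writes ?q \<Longrightarrow> z \<noteq> ''v'' \<Longrightarrow> z \<noteq> ''w'' \<Longrightarrow> s' z = s1 z"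
      and J: "\<forall>c<n. \<forall>d<n. c * n + d < a * n + b \<longrightarrow> s' ''q'' (c * n + d) = m c d"
    have "s' ''mul'' = s1 ''mul''" "s' ''m'' = s1 ''m''" using fr by simp_all
    then have "s' ''mul'' a = a * n" "s' ''m'' (a * n + b) = m a b" using e1 * by (simp_all add: env_def)
    then show "\<forall>c<n. \<forall>d<n. c * n + d < Suc (a * n + b) \<longrightarrow> sem ?q s' ''q'' (c * n + d) = m c d"
      using J * arc_index_eq_iff[of _ n b _ a] by (auto simp: less_Suc_eq)
  qed simp_all
  have rn: "s2 ''r'' 0 = r" using e2 by (simp add: env_def)
  let ?s = "sem reset_prog s"
  have "?s = upd ''l2'' r r (upd ''l1'' r r (upd ''t2'' r 1 (upd ''t1'' r 1 s2)))"
    unfolding reset_prog_def using rn by (simp add: s2_def s1_def)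
  then have s: "?s ''t1'' = (s1 ''t1'')(r := 1)" "?s ''t2'' = (s1 ''t2'')(r := 1)" "?s ''q'' = s2 ''q''"
    "?s ''l1'' r = r" "?s ''l2'' r = r"
    by (simp_all add: f2 fun_upd_def)
  have sup: "supp n (?s ''t1'') = {r}" "supp n (?s ''t2'') = {r}"
    unfolding s using t1 r_less by (auto simp: supp_def)
  have res: "resid ?s a b = m a b" if "a < n" "b < n" for a b
    using q2 that arc_index_less[OF that] by (simp add: resid_def s)
  show "env (sem reset_prog s)" using e by (rule env_sem) (auto simp: reset_writes env_vars_def)
  show "inv1 ?s" unfolding tree_inv_def sup
    using res s by (auto simp: packed_def residual_def uses_arc_def intro: partial_tree_singleton)
  show "h r = r \<Longrightarrow> matches ''t1'' ''p1'' ''l1'' {r} q h ?s" "h r = r \<Longrightarrow> matches ''t2'' ''p2'' ''l2'' {r} q h ?s"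
    using s(4,5) by (simp_all add: matches_def sup)
qed

lemma span_check_spec:
  assumes e: "env s"
  shows "0 < sem span_check_prog s ''ok'' 0 \<longleftrightarrow>
    0 < s ''ok'' 0 \<and> supp n (s ''t1'') = {..<n} \<and> supp n (s ''t2'') = {..<n}"
proof -
  let ?b = "PCond (Conj (pos (Cell ''t1'' (var ''v''))) (pos (Cell ''t2'' (var ''v''))))
        PSkip (set_var ''ok'' (Const 0))"
  have "0 < sem span_check_prog s ''ok'' 0 \<longleftrightarrow>
      0 < s ''ok'' 0 \<and> (\<forall>v<s ''n'' 0. 0 < s ''t1'' v \<and> 0 < s ''t2'' v)"
    unfolding span_check_prog_def
  proof (rule For_rule[where I = "\<lambda>i s'. 0 < s' ''ok'' 0 \<longleftrightarrow>
      0 < s ''ok'' 0 \<and> (\<forall>v<i. 0 < s ''t1'' v \<and> 0 < s ''t2'' v)"])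
    fix i :: nat and s' :: state assume "s' ''v'' 0 = i" "\<And>z. z \<notin> writes ?b \<Longrightarrow> z \<noteq> ''v'' \<Longrightarrow> s' z = s z"
      "0 < s' ''ok'' 0 \<longleftrightarrow> 0 < s ''ok'' 0 \<and> (\<forall>v<i. 0 < s ''t1'' v \<and> 0 < s ''t2'' v)"
    then show "0 < upd ''v'' 0 (Suc i) (sem ?b s') ''ok'' 0 \<longleftrightarrow>
        0 < s ''ok'' 0 \<and> (\<forall>v<Suc i. 0 < s ''t1'' v \<and> 0 < s ''t2'' v)"
      by (auto simp: less_Suc_eq)
  qed simp_all
  moreover have "s ''n'' 0 = n" using e by (simp add: env_def)
  ultimately show ?thesis by (auto simp: supp_def)
qed

lemma safe_check_spec:
  assumes e: "env s" and l: "l \<in> {''l1'', ''l2''}"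
  shows "0 < sem (safe_check_prog l) s ''ok'' 0 \<longleftrightarrow> 0 < s ''ok'' 0 \<and> safe_labels k n r {..<n} (s l)"
proof -
  let ?c = "PCond (eq (Cell l (var ''w'')) (var ''v'')) PSkip (set_var ''e'' (Add (var ''e'') (Const 1)))"
  let ?b = "PCond (eq (var ''v'') (var ''r'')) PSkip
        (set_var ''e'' (Const 0) ;; PFor ''w'' ''n'' ?c ;;
         PCond (Less (var ''e'') (var ''k'')) (set_var ''ok'' (Const 0)) PSkip)"
  have ln: "l \<notin> {''v'', ''w'', ''e'', ''ok''}" using l by auto
  have "0 < sem (safe_check_prog l) s ''ok'' 0 \<longleftrightarrow>
      0 < s ''ok'' 0 \<and> (\<forall>v<s ''n'' 0. v \<noteq> r \<longrightarrow> k \<le> card {x \<in> {..<n}. s l x \<noteq> v})"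
    unfolding safe_check_prog_def
  proof (rule For_rule[where I = "\<lambda>i s'. 0 < s' ''ok'' 0 \<longleftrightarrow>
      0 < s ''ok'' 0 \<and> (\<forall>v<i. v \<noteq> r \<longrightarrow> k \<le> card {x \<in> {..<n}. s l x \<noteq> v})"])
    fix i :: nat and s' :: state assume i: "s' ''v'' 0 = i" and fr: "\<And>z. z \<notin> writes ?b \<Longrightarrow> z \<noteq> ''v'' \<Longrightarrow> s' z = s z"
      and J: "0 < s' ''ok'' 0 \<longleftrightarrow>
        0 < s ''ok'' 0 \<and> (\<forall>v<i. v \<noteq> r \<longrightarrow> k \<le> card {x \<in> {..<n}. s l x \<noteq> v})"
    have f: "s' ''r'' 0 = r" "s' ''k'' 0 = k" "s' ''n'' 0 = n" "s' l = s l"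
      using fr e ln by (simp_all add: env_def)
    define s1 where "s1 = upd ''e'' 0 0 s'"
    define s2 where "s2 = sem (PFor ''w'' ''n'' ?c) s1"
    have "s2 ''e'' 0 = card {x. x < s1 ''n'' 0 \<and> s l x \<noteq> i}"
      unfolding s2_def
    proof (rule For_rule[where I = "\<lambda>j s''. s'' ''e'' 0 = card {x. x < j \<and> s l x \<noteq> i}"])
      fix j :: nat and s'' :: state assume j: "s'' ''w'' 0 = j" "s'' ''e'' 0 = card {x. x < j \<and> s l x \<noteq> i}"
        and fr': "\<And>z. z \<notin> writes ?c \<Longrightarrow> z \<noteq> ''w'' \<Longrightarrow> s'' z = s1 z"
      have f': "s'' l = s l" "s'' ''v'' 0 = i" using fr' ln f i by (simp_all add: s1_def)
      have "{x. x < Suc j \<and> s l x \<noteq> i} =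
          (if s l j \<noteq> i then insert j {x. x < j \<and> s l x \<noteq> i} else {x. x < j \<and> s l x \<noteq> i})"
        by (auto simp: less_Suc_eq)
      then show "upd ''w'' 0 (Suc j) (sem ?c s'') ''e'' 0 = card {x. x < Suc j \<and> s l x \<noteq> i}"
        using j f' by auto
    qed (simp_all add: s1_def)
    then have e2: "s2 ''e'' 0 = card {x \<in> {..<n}. s l x \<noteq> i}" using f by (simp add: s1_def lessThan_def Collect_conj_eq[symmetric])
    have f2: "s2 ''k'' 0 = k" "s2 ''ok'' = s' ''ok''"
      unfolding s2_def using f by (simp_all add: sem_other s1_def)
    have "sem ?b s' = (if i = r then s' else if card {x \<in> {..<n}. s l x \<noteq> i} < k then upd ''ok'' 0 0 s2 else s2)"
      using e2 f2 i f by (auto simp: s2_def s1_def)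
    then show "0 < upd ''v'' 0 (Suc i) (sem ?b s') ''ok'' 0 \<longleftrightarrow>
        0 < s ''ok'' 0 \<and> (\<forall>v<Suc i. v \<noteq> r \<longrightarrow> k \<le> card {x \<in> {..<n}. s l x \<noteq> v})"
      using J f2 by (auto simp: less_Suc_eq)
  qed (use ln in simp_all)
  moreover have "s ''n'' 0 = n" using e by (simp add: env_def)
  ultimately show ?thesis by (simp add: safe_labels_def)
qed

lemma output_spec:
  assumes e: "env s"
  shows "sem output_prog s ''ans'' 0 = 1"
    "\<forall>v<n. sem output_prog s ''i2'' v = (if s ''p1'' v = s ''p2'' v then 1 else 0)"
proof -
  let ?b = "PCond (eq (Cell ''p1'' (var ''v'')) (Cell ''p2'' (var ''v'')))
        (PStore ''i2'' (var ''v'') (Const 1)) (PStore ''i2'' (var ''v'') (Const 0))"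
  define s1 where "s1 = upd ''ans'' 0 1 s"
  have eq: "sem output_prog s = sem (PFor ''v'' ''n'' ?b) s1" by (simp add: output_prog_def s1_def)
  have "sem (PFor ''v'' ''n'' ?b) s1 ''ans'' = s1 ''ans''" by (rule sem_other) simp
  then show "sem output_prog s ''ans'' 0 = 1" by (simp add: eq s1_def)
  have "\<forall>v<s1 ''n'' 0. sem output_prog s ''i2'' v = (if s ''p1'' v = s ''p2'' v then 1 else 0)"
    unfolding eq
  proof (rule For_rule[where I = "\<lambda>i s'. \<forall>v<i. s' ''i2'' v = (if s ''p1'' v = s ''p2'' v then 1 else 0)"])
    fix i :: nat and s' :: state assume i: "s' ''v'' 0 = i" "\<forall>v<i. s' ''i2'' v = (if s ''p1'' v = s ''p2'' v then 1 else 0)"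
      and fr: "\<And>z. z \<notin> writes ?b \<Longrightarrow> z \<noteq> ''v'' \<Longrightarrow> s' z = s1 z"
    have "s' ''p1'' = s ''p1''" "s' ''p2'' = s ''p2''" using fr by (simp_all add: s1_def)
    then show "\<forall>v<Suc i. upd ''v'' 0 (Suc i) (sem ?b s') ''i2'' v = (if s ''p1'' v = s ''p2'' v then 1 else 0)"
      using i by (auto simp: less_Suc_eq)
  qed simp_all
  then show "\<forall>v<n. sem output_prog s ''i2'' v = (if s ''p1'' v = s ''p2'' v then 1 else 0)"
    using e by (simp add: s1_def env_def)
qed

lemma check_writes: "writes span_check_prog = {''v'', ''ok''}"
  "writes (safe_check_prog l) = {''v'', ''e'', ''w'', ''ok''}"
  "writes output_prog = {''ans'', ''v'', ''i2''}"
  by (auto simp: span_check_prog_def safe_check_prog_def output_prog_def)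

lemma attempt_writes: "writes attempt_prog \<inter> (env_vars \<union> {''N'', ''i1''}) = {}"
  by (simp add: attempt_prog_def reset_writes search_writes extend_writes check_writes env_vars_def)

definition result_ok :: "state \<Rightarrow> bool" where
  "result_ok s \<longleftrightarrow> solution (s ''p1'') (s ''l1'') (s ''p2'') (s ''l2'') \<and>
     (\<forall>v<n. s ''i2'' v = (if s ''p1'' v = s ''p2'' v then 1 else 0))"

text \<open>The part of an attempt that precedes the checks. The checks decide \<open>built\<close>
  exactly, so completeness only has to be shown for this part.\<close>

definition build_prog :: prog where
  "build_prog = reset_prog ;;
     search_prog ''t1'' ''p1'' ''l1'' ;; search_prog ''t2'' ''p2'' ''l2'' ;;
     extend_prog ''t1'' ''p1'' ''l1'' ''t2'' ;; extend_prog ''t2'' ''p2'' ''l2'' ''t1''"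

lemma build_writes: "writes build_prog \<inter> (env_vars \<union> {''ans''}) = {}"
  by (simp add: build_prog_def reset_writes search_writes extend_writes env_vars_def)

lemma build_sound:
  assumes e: "env s"
  shows "inv1 (sem build_prog s)" "env (sem build_prog s)"
proof -
  define s1 where "s1 = sem reset_prog s"
  define s2 where "s2 = sem (search_prog ''t1'' ''p1'' ''l1'') s1"
  define s3 where "s3 = sem (search_prog ''t2'' ''p2'' ''l2'') s2"
  define s4 where "s4 = sem (extend_prog ''t1'' ''p1'' ''l1'' ''t2'') s3"
  define s5 where "s5 = sem (extend_prog ''t2'' ''p2'' ''l2'' ''t1'') s4"
  have s5: "sem build_prog s = s5" by (simp add: build_prog_def s1_def s2_def s3_def s4_def s5_def)
  have e1: "env s1" unfolding s1_def using e by (rule reset_spec)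
  have e2: "env s2" unfolding s2_def using e1 by (rule env_sem) (simp add: search_writes env_vars_def)
  have e3: "env s3" unfolding s3_def using e2 by (rule env_sem) (simp add: search_writes env_vars_def)
  have e4: "env s4" unfolding s4_def using e3 by (rule env_sem) (simp add: extend_writes env_vars_def)
  have e5: "env s5" unfolding s5_def using e4 by (rule env_sem) (simp add: extend_writes env_vars_def)
  have "inv1 s1" unfolding s1_def using e by (rule reset_spec)
  then have "inv1 s2" unfolding s2_def by (rule search_sound[OF e1 names1])
  then have "inv2 s3" unfolding s3_def by (intro search_sound[OF e2 names2]) (simp only: tree_inv_swap)
  then have "inv1 s4" unfolding s4_def by (intro extend_sound[OF e3 names1]) (simp only: tree_inv_swap)
  then have "inv2 s5" unfolding s5_def by (intro extend_sound[OF e4 names2]) (simp only: tree_inv_swap)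
  then show "inv1 (sem build_prog s)" "env (sem build_prog s)" unfolding s5 using e5 tree_inv_swap by blast+
qed

definition built :: "state \<Rightarrow> bool" where
  "built s \<longleftrightarrow> supp n (s ''t1'') = {..<n} \<and> supp n (s ''t2'') = {..<n} \<and>
     safe_labels k n r {..<n} (s ''l1'') \<and> safe_labels k n r {..<n} (s ''l2'')"

lemma attempt_spec:
  assumes e: "env s"
  shows "built (sem build_prog s) \<Longrightarrow> sem attempt_prog s ''ans'' 0 = 1 \<and> result_ok (sem attempt_prog s)"
    "\<not> built (sem build_prog s) \<Longrightarrow> sem attempt_prog s ''ans'' 0 = s ''ans'' 0"
proof -
  define s5 where "s5 = sem build_prog s"
  define s6 where "s6 = upd ''ok'' 0 1 s5"
  define s7 where "s7 = sem span_check_prog s6"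
  define s8 where "s8 = sem (safe_check_prog ''l1'') s7"
  define s9 where "s9 = sem (safe_check_prog ''l2'') s8"
  have fin: "sem attempt_prog s = (if 0 < s9 ''ok'' 0 then sem output_prog s9 else s9)"
    by (simp add: attempt_prog_def build_prog_def s5_def s6_def s7_def s8_def s9_def)
  have i5: "inv1 s5" and e5: "env s5" unfolding s5_def using build_sound[OF e] by auto
  have e6: "env s6" unfolding s6_def using e5 by (rule env_upd) (simp add: env_vars_def)
  have e7: "env s7" unfolding s7_def using e6 by (rule env_sem) (simp add: check_writes env_vars_def)
  have e8: "env s8" unfolding s8_def using e7 by (rule env_sem) (simp add: check_writes env_vars_def)
  have e9: "env s9" unfolding s9_def using e8 by (rule env_sem) (simp add: check_writes env_vars_def)
  have fr: "s9 z = s5 z \<and> s8 z = s5 z \<and> s7 z = s5 z \<and> s6 z = s5 z" if "z \<notin> {''v'', ''e'', ''w'', ''ok''}" for z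
  proof -
    have "s6 z = s5 z" using that by (simp add: s6_def)
    moreover have "s7 z = s6 z" unfolding s7_def by (rule sem_other) (use that in \<open>simp add: check_writes\<close>)
    moreover have "s8 z = s7 z" unfolding s8_def by (rule sem_other) (use that in \<open>simp add: check_writes\<close>)
    moreover have "s9 z = s8 z" unfolding s9_def by (rule sem_other) (use that in \<open>simp add: check_writes\<close>)
    ultimately show ?thesis by simp
  qed
  have "0 < s9 ''ok'' 0 \<longleftrightarrow> 0 < s8 ''ok'' 0 \<and> safe_labels k n r {..<n} (s8 ''l2'')"
    unfolding s9_def by (rule safe_check_spec[OF e8]) simp
  moreover have "0 < s8 ''ok'' 0 \<longleftrightarrow> 0 < s7 ''ok'' 0 \<and> safe_labels k n r {..<n} (s7 ''l1'')"
    unfolding s8_def by (rule safe_check_spec[OF e7]) simp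
  moreover have "0 < s7 ''ok'' 0 \<longleftrightarrow> 0 < s6 ''ok'' 0 \<and> supp n (s6 ''t1'') = {..<n} \<and> supp n (s6 ''t2'') = {..<n}"
    unfolding s7_def by (rule span_check_spec[OF e6])
  moreover have "0 < s6 ''ok'' 0" by (simp add: s6_def)
  ultimately have ok: "0 < s9 ''ok'' 0 \<longleftrightarrow> built s5" using fr by (auto simp: built_def)
  show "sem attempt_prog s ''ans'' 0 = s ''ans'' 0" if "\<not> built (sem build_prog s)"
  proof -
    have "s5 ''ans'' = s ''ans''" unfolding s5_def by (rule sem_other) (use build_writes in blast)
    then show ?thesis using that fin ok fr[of "''ans''"] by (simp add: s5_def)
  qed
  assume b: "built (sem build_prog s)"
  then have b5: "built s5" by (simp add: s5_def)
  have a: "sem attempt_prog s = sem output_prog s9" using ok b5 fin by simp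
  have o: "sem attempt_prog s z = s5 z" if "z \<in> {''p1'', ''p2'', ''l1'', ''l2''}" for z
  proof -
    have "sem output_prog s9 z = s9 z" by (rule sem_other) (use that in \<open>auto simp: check_writes\<close>)
    then show ?thesis using fr[of z] that a by auto
  qed
  have "solution (s5 ''p1'') (s5 ''l1'') (s5 ''p2'') (s5 ''l2'')"
    using i5 b5 by (simp add: tree_inv_def built_def solution_def)
  then show "sem attempt_prog s ''ans'' 0 = 1 \<and> result_ok (sem attempt_prog s)"
    using output_spec[OF e9] o fr by (simp add: a[symmetric] result_ok_def)
qed

lemma search_phase:
  assumes tn: "tree_names t p l t' p' l'"
    and i: "search_inv t p l S q h t' p' l' T q' h' s"
    and N: "\<And>s Y. search_inv t p l S q h t' p' l' T q' h' s \<Longrightarrow>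
      s ''x'' 0 = N + base ^ (2 * k) * Y \<Longrightarrow> s ''x'' 0 < base ^ (4 * k) \<Longrightarrow>
      search_inv t p l S' q h t' p' l' T q' h' ((search_step t p l ^^ (2 * k)) s) \<and>
      (search_step t p l ^^ (2 * k)) s ''x'' 0 = Y"
    and x: "s ''x'' 0 = N + base ^ (2 * k) * Y" "s ''x'' 0 < base ^ (4 * k)"
  shows "search_inv t p l S' q h t' p' l' T q' h' (sem (search_prog t p l) s)"
    "sem (search_prog t p l) s ''x'' 0 = Y"
proof -
  note nm = tree_names_neq[OF tn] tree_names_neq[OF tn, symmetric]
  let ?s = "upd ''j'' 0 0 s"
  have "env s" using i by (simp add: search_inv_def)
  then have "env ?s" by (rule env_upd) (simp add: env_vars_def)
  then have "search_inv t p l S q h t' p' l' T q' h' ?s"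
    using i by (simp add: search_inv_def tree_inv_upd[OF tn] matches_def nm)
  from N[OF this, of Y] x show "search_inv t p l S' q h t' p' l' T q' h' (sem (search_prog t p l) s)"
    "sem (search_prog t p l) s ''x'' 0 = Y"
    by (simp_all add: search_sem[OF \<open>env s\<close>])
qed

lemma search_inv_swap:
  "search_inv t p l S q h t' p' l' T q' h' s = search_inv t' p' l' T q' h' t p l S q h s"
  unfolding search_inv_def using tree_inv_swap by blast

text \<open>After both searches the arrays describe the good pair \<open>S\<close>,
  \<open>T\<close>. By \<open>tree_inv\<close> the residual of this pair is what \<open>q\<close>
  contains, so feasibility carries over to the state.\<close>

lemma search_inv_imp_full:
  assumes i: "search_inv t p l S q h t' p' l' T q' h' s" and g: "good S q h T q' h'"
    and sl: "safe_labels k n r S h" "safe_labels k n r T h'"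
  shows "full_inv t p l t' p' l' s"
proof -
  have S: "supp n (s t) = S" "supp n (s t') = T" using i by (auto simp: search_inv_def matches_def)
  have fin: "finite S" "finite T" using good_finite[OF g] by auto
  have "resid s a b = residual S q T q' a b" if "a < n" "b < n" for a b
  proof -
    have "uses_arc r S (s p) a b = uses_arc r S q a b" "uses_arc r T (s p') a b = uses_arc r T q' a b"
      using i by (auto simp: uses_arc_def matches_def search_inv_def)
    then show ?thesis using i that S by (simp add: search_inv_def tree_inv_def residual_def)
  qed
  then have "feasible n S T (resid s) = feasible n S T (residual S q T q')" by (intro feasible_cong)
  moreover have "safe_labels k n r S (s l)"
    by (rule safe_labels_mono[OF sl(1)]) (use i fin in \<open>auto simp: search_inv_def matches_def\<close>)
  moreover have "safe_labels k n r T (s l')"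
    by (rule safe_labels_mono[OF sl(2)]) (use i fin in \<open>auto simp: search_inv_def matches_def\<close>)
  ultimately show ?thesis using i g S by (simp add: full_inv_def search_inv_def good_def)
qed

text \<open>The low \<open>2 * k\<close> digits rebuild the first kernel, the high ones the second.
  One number works from every state with the right constants, whatever earlier attempts left
  behind.\<close>

lemma build_complete:
  assumes "solution p l p' l'"
  shows "\<exists>N<base ^ (4 * k). \<forall>s. env s \<longrightarrow> s ''x'' 0 = N \<longrightarrow> built (sem build_prog s)"
proof (cases "n > 1")
  \<comment> \<open>With the root as the only vertex, both trees span from the start and any number
    works.\<close>
  case False
  then have n: "{..<n} = {r}" using r_less by auto
  then have "c = r" if "c < n" for c using that by (metis lessThan_iff singletonD)
  then have sl: "safe_labels k n r {..<n} f" for f by (simp add: safe_labels_def)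
  have "built s" if "inv1 s" for s
  proof -
    have "r \<in> supp n (s ''t1'')" "r \<in> supp n (s ''t2'')"
      using that partial_tree_root by (auto simp: tree_inv_def)
    then have "supp n (s ''t1'') = {..<n}" "supp n (s ''t2'') = {..<n}"
      using supp_subset[of n] unfolding n by blast+
    with sl show ?thesis by (simp add: built_def)
  qed
  then show ?thesis using build_sound(1) base_gt_1 by (intro exI[of _ 0]) auto
next
  case True
  obtain S q h T q' h' where g: "good S q h T q' h'"
    and sl: "safe_labels k n r S h" "safe_labels k n r T h'" and c: "card S \<le> 2 * k" "card T \<le> 2 * k"
    and fa: "\<forall>v\<in>S - {r}. first_arc (q v) v" "\<forall>v\<in>T - {r}. first_arc (q' v) v"
    by (rule ex_small_kernels[of p l p' l']) (use assms True in \<open>auto simp: solution_def\<close>)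
  have pt: "partial_tree r S q h" "partial_tree r T q' h'" and sub: "S \<subseteq> {..<n}" "T \<subseteq> {..<n}"
    and pk: "packed S q T q'" using g by (auto simp: good_def)
  have r: "r \<in> S" "r \<in> T" "h r = r" "h' r = r"
    using pt partial_tree_root partial_tree_label_root by auto
  have fin: "finite S" "finite T" using good_finite[OF g] by auto
  \<comment> \<open>While the first kernel is rebuilt, the second tree is still \<open>{r}\<close>
    and uses no arc.\<close>
  have pk1: "packed S q {r} q'"
    unfolding packed_def
  proof (intro allI impI)
    fix u v assume "u < n" "v < n"
    then have "uses_arc r S q u v + uses_arc r T q' u v \<le> m u v" using pk unfolding packed_def by blast
    then show "uses_arc r S q u v + uses_arc r {r} q' u v \<le> m u v" by (simp add: uses_arc_def)
  qed
  have pk2: "packed T q' S q" using pk by (simp add: packed_commute)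
  have c1: "card (S - {r}) \<le> 2 * k" "card (T - {r}) \<le> 2 * k"
    using c card_Diff1_le[of S r] card_Diff1_le[of T r] by linarith+
  obtain N1 where N1: "N1 < base ^ (2 * k)"
    "\<And>s Y. search_inv ''t1'' ''p1'' ''l1'' {r} q h ''t2'' ''p2'' ''l2'' {r} q' h' s \<Longrightarrow>
      s ''x'' 0 = N1 + base ^ (2 * k) * Y \<Longrightarrow> s ''x'' 0 < base ^ (4 * k) \<Longrightarrow>
      search_inv ''t1'' ''p1'' ''l1'' S q h ''t2'' ''p2'' ''l2'' {r} q' h' ((search_step ''t1'' ''p1'' ''l1'' ^^ (2 * k)) s) \<and>
      (search_step ''t1'' ''p1'' ''l1'' ^^ (2 * k)) s ''x'' 0 = Y"
    using search_complete[OF names1 pt(1) sub(1) c(1) fa(1) pk1, of "{r}" "2 * k" h'] r c1 by auto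
  obtain N2 where N2: "N2 < base ^ (2 * k)"
    "\<And>s Y. search_inv ''t2'' ''p2'' ''l2'' {r} q' h' ''t1'' ''p1'' ''l1'' S q h s \<Longrightarrow>
      s ''x'' 0 = N2 + base ^ (2 * k) * Y \<Longrightarrow> s ''x'' 0 < base ^ (4 * k) \<Longrightarrow>
      search_inv ''t2'' ''p2'' ''l2'' T q' h' ''t1'' ''p1'' ''l1'' S q h ((search_step ''t2'' ''p2'' ''l2'' ^^ (2 * k)) s) \<and>
      (search_step ''t2'' ''p2'' ''l2'' ^^ (2 * k)) s ''x'' 0 = Y"
    using search_complete[OF names2 pt(2) sub(2) c(2) fa(2) pk2, of "{r}" "2 * k" h] r c1 by auto
  let ?N = "N1 + base ^ (2 * k) * N2"
  have sq: "base ^ (4 * k) = base ^ (2 * k) * base ^ (2 * k)" by (simp flip: power_add)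
  have lt: "?N < base ^ (4 * k)"
  proof -
    have "?N < base ^ (2 * k) * Suc N2" using N1(1) by simp
    also have "\<dots> \<le> base ^ (2 * k) * base ^ (2 * k)" using N2(1) by (intro mult_le_mono2) simp
    finally show ?thesis unfolding sq .
  qed
  have "N2 < base ^ (4 * k)"
  proof -
    have "base ^ (2 * k) \<le> base ^ (4 * k)" using base_gt_1 by (intro power_increasing) auto
    with N2(1) show ?thesis by linarith
  qed
  show ?thesis
  proof (intro exI[of _ ?N] conjI allI impI)
    show "?N < base ^ (4 * k)" by (fact lt)
    fix s assume e: "env s" and x: "s ''x'' 0 = ?N"
    define s1 where "s1 = sem reset_prog s"
    define s2 where "s2 = sem (search_prog ''t1'' ''p1'' ''l1'') s1"
    define s3 where "s3 = sem (search_prog ''t2'' ''p2'' ''l2'') s2"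
    define s4 where "s4 = sem (extend_prog ''t1'' ''p1'' ''l1'' ''t2'') s3"
    define s5 where "s5 = sem (extend_prog ''t2'' ''p2'' ''l2'' ''t1'') s4"
    have s5: "sem build_prog s = s5" by (simp add: build_prog_def s1_def s2_def s3_def s4_def s5_def)
    have i1: "search_inv ''t1'' ''p1'' ''l1'' {r} q h ''t2'' ''p2'' ''l2'' {r} q' h' s1"
      using reset_spec[OF e] r unfolding s1_def search_inv_def by blast
    have "s1 ''x'' = s ''x''" unfolding s1_def by (rule sem_other) (simp add: reset_writes)
    then have x1: "s1 ''x'' 0 = ?N" "s1 ''x'' 0 < base ^ (4 * k)" using x lt by simp_all
    note i2 = search_phase[OF names1 i1 N1(2) x1, folded s2_def]
    have i2': "search_inv ''t2'' ''p2'' ''l2'' {r} q' h' ''t1'' ''p1'' ''l1'' S q h s2"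
      using i2(1) by (simp only: search_inv_swap)
    have x2: "s2 ''x'' 0 = N2 + base ^ (2 * k) * 0" "s2 ''x'' 0 < base ^ (4 * k)"
      using i2(2) \<open>N2 < base ^ (4 * k)\<close> by simp_all
    have "search_inv ''t2'' ''p2'' ''l2'' T q' h' ''t1'' ''p1'' ''l1'' S q h s3"
      using search_phase(1)[OF names2 i2' N2(2) x2] by (simp only: s3_def)
    then have i3: "search_inv ''t1'' ''p1'' ''l1'' S q h ''t2'' ''p2'' ''l2'' T q' h' s3"
      by (simp only: search_inv_swap)
    from search_inv_imp_full[OF i3 g sl] have "full1 s3" .
    moreover have e3: "env s3" using i3 by (simp add: search_inv_def)
    ultimately have f4: "full1 s4" "supp n (s4 ''t1'') = {..<n}"
      unfolding s4_def using extend_full[OF _ names1] by blast+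
    have e4: "env s4" unfolding s4_def using e3 by (rule env_sem) (simp add: extend_writes env_vars_def)
    have "full2 s4" using f4(1) by (simp only: full_inv_swap)
    then have f5: "full2 s5" "supp n (s5 ''t2'') = {..<n}"
      unfolding s5_def using extend_full[OF e4 names2] by blast+
    have "s5 ''t1'' = s4 ''t1''" unfolding s5_def by (rule sem_other) (simp add: extend_writes)
    then show "built (sem build_prog s)"
      unfolding s5 using f4(2) f5 by (simp add: built_def full_inv_def)
  qed
qed

end

definition algorithm :: prog where
  "algorithm = setup_constants_prog ;; setup_power_prog ;; setup_first_arcs_prog ;; loop_prog"

context packing
begin

text \<open>For each failed number the invariant remembers merely some state satisfying
  \<open>env\<close> in which it failed. This suffices, since the number from
  \<open>build_complete\<close> succeeds in every such state.\<close>

lemma loop_spec: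
  assumes e: "env s" and a: "s ''ans'' 0 = 0"
  shows "if \<exists>p l p' l'. solution p l p' l'
    then sem loop_prog s ''ans'' 0 = 1 \<and> result_ok (sem loop_prog s)
    else sem loop_prog s ''ans'' 0 = 0"
proof -
  let ?b = "PCond (pos (var ''ans'')) PSkip (set_var ''x'' (var ''N'') ;; attempt_prog)"
  have wr: "''N'' \<notin> writes attempt_prog" using attempt_writes by blast
  have ebx: "env (sem attempt_prog s')" if "env s'" for s'
    using that by (rule env_sem) (use attempt_writes in blast)
  have ins: "env (upd ''N'' 0 c s') = env s'" "result_ok (upd ''N'' 0 c s') = result_ok s'" for c s'
    by (simp_all add: env_def result_ok_def)
  have "env (sem loop_prog s) \<and> (sem loop_prog s ''ans'' 0 = 1 \<and> result_ok (sem loop_prog s) \<or>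
      sem loop_prog s ''ans'' 0 = 0 \<and>
      (\<forall>N<s ''NI'' 0. \<exists>s0. env s0 \<and> s0 ''x'' 0 = N \<and> \<not> built (sem build_prog s0)))"
    unfolding loop_prog_def
  proof (rule For_rule[where I = "\<lambda>i s'. env s' \<and> (s' ''ans'' 0 = 1 \<and> result_ok s' \<or>
      s' ''ans'' 0 = 0 \<and> (\<forall>N<i. \<exists>s0. env s0 \<and> s0 ''x'' 0 = N \<and> \<not> built (sem build_prog s0)))"])
    show "''N'' \<notin> writes ?b" using wr by simp
    fix i :: nat and s' :: state
    assume i: "s' ''N'' 0 = i" and J: "env s' \<and> (s' ''ans'' 0 = 1 \<and> result_ok s' \<or>
      s' ''ans'' 0 = 0 \<and> (\<forall>N<i. \<exists>s0. env s0 \<and> s0 ''x'' 0 = N \<and> \<not> built (sem build_prog s0)))"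
    let ?s = "upd ''x'' 0 i s'"
    have e': "env ?s" using J by (intro env_upd) (simp_all add: env_vars_def)
    have b: "sem ?b s' = (if 0 < s' ''ans'' 0 then s' else sem attempt_prog ?s)" using i by simp
    have "env (sem ?b s') \<and> (sem ?b s' ''ans'' 0 = 1 \<and> result_ok (sem ?b s') \<or>
        sem ?b s' ''ans'' 0 = 0 \<and>
        (\<forall>N<Suc i. \<exists>s0. env s0 \<and> s0 ''x'' 0 = N \<and> \<not> built (sem build_prog s0)))"
    proof (cases "s' ''ans'' 0 = 1")
      case True
      then show ?thesis using J by (simp add: b)
    next
      case False
      with J have a0: "s' ''ans'' 0 = 0"
        and w: "\<forall>N<i. \<exists>s0. env s0 \<and> s0 ''x'' 0 = N \<and> \<not> built (sem build_prog s0)" by auto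
      have bs: "sem ?b s' = sem attempt_prog ?s" unfolding b using a0 by simp
      show ?thesis
      proof (cases "built (sem build_prog ?s)")
        case True
        then show ?thesis unfolding bs using attempt_spec(1)[OF e'] ebx[OF e'] by blast
      next
        case False
        then have "sem attempt_prog ?s ''ans'' 0 = 0" using attempt_spec(2)[OF e'] a0 by simp
        moreover have "\<exists>s0. env s0 \<and> s0 ''x'' 0 = i \<and> \<not> built (sem build_prog s0)"
          using e' False by (intro exI[of _ ?s]) simp
        ultimately show ?thesis unfolding bs using ebx[OF e'] w by (auto simp: less_Suc_eq)
      qed
    qed
    then show "env (upd ''N'' 0 (Suc i) (sem ?b s')) \<and>
        (upd ''N'' 0 (Suc i) (sem ?b s') ''ans'' 0 = 1 \<and> result_ok (upd ''N'' 0 (Suc i) (sem ?b s')) \<or>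
         upd ''N'' 0 (Suc i) (sem ?b s') ''ans'' 0 = 0 \<and>
        (\<forall>N<Suc i. \<exists>s0. env s0 \<and> s0 ''x'' 0 = N \<and> \<not> built (sem build_prog s0)))"
      by (simp add: ins del: sem.simps(1-4))
  qed (use e a ins in simp_all)
  then have fin: "sem loop_prog s ''ans'' 0 = 1 \<and> result_ok (sem loop_prog s) \<or>
      sem loop_prog s ''ans'' 0 = 0 \<and>
      (\<forall>N<base ^ (4 * k). \<exists>s0. env s0 \<and> s0 ''x'' 0 = N \<and> \<not> built (sem build_prog s0))"
    using e by (auto simp: env_def)
  show ?thesis
  proof (cases "\<exists>p l p' l'. solution p l p' l'")
    case True
    then obtain p l p' l' where "solution p l p' l'" by blast
    from build_complete[OF this] fin True show ?thesis by auto
  next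
    case False
    then have "\<not> result_ok (sem loop_prog s)" unfolding result_ok_def by blast
    with fin False show ?thesis by auto
  qed
qed

lemma setup_constants_spec:
  fixes s :: state
  assumes "s ''n'' 0 = n" "s ''k'' 0 = k" "s ''mul'' 0 = 0"
  defines "s' \<equiv> sem setup_constants_prog s"
  shows "\<forall>v<n. s' ''mul'' v = v * n" "s' ''K2'' 0 = 2 * k" "s' ''M'' 0 = 6 * k"
    "s' ''K4'' 0 = 4 * k" "s' ''B'' 0 = base"
proof -
  let ?b = "PStore ''mul'' (Add (var ''v'') (Const 1)) (Add (Cell ''mul'' (var ''v'')) (var ''n''))"
  let ?c = "set_var ''B'' (Add (var ''B'') (var ''K12''))"
  define s1 where "s1 = sem (PFor ''v'' ''n'' ?b) s"
  define s2 where "s2 = upd ''B'' 0 1 (upd ''K4'' 0 (4 * k) (upd ''K12'' 0 (12 * k)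
    (upd ''M'' 0 (6 * k) (upd ''K2'' 0 (2 * k) s1))))"
  have k1: "s1 ''k'' 0 = k" unfolding s1_def using assms(2) by (simp add: sem_other)
  have ar: "k + k = 2 * k" "2 * k + 2 * k = 4 * k" "4 * k + 2 * k = 6 * k" "6 * k + 6 * k = 12 * k"
    by simp_all
  have s': "s' = sem (PFor ''i'' ''k'' ?c) s2"
    unfolding s'_def setup_constants_prog_def s2_def sem.simps(3) s1_def[symmetric] using k1
    by (simp add: ar)
  \<comment> \<open>Round \<open>i\<close> fills entry \<open>i + 1\<close> from entry
    \<open>i\<close>, and entry 0 is 0 from the outset; hence the range \<open>v \<le> i\<close> of
    the invariant.\<close>
  have "\<forall>v\<le>s ''n'' 0. s1 ''mul'' v = v * n" unfolding s1_def
  proof (rule For_rule[where I = "\<lambda>i s'. \<forall>v\<le>i. s' ''mul'' v = v * n"])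
    fix i :: nat and s' :: state assume "s' ''v'' 0 = i" "\<forall>v\<le>i. s' ''mul'' v = v * n"
      "\<And>z. z \<notin> writes ?b \<Longrightarrow> z \<noteq> ''v'' \<Longrightarrow> s' z = s z"
    then show "\<forall>v\<le>Suc i. upd ''v'' 0 (Suc i) (sem ?b s') ''mul'' v = v * n"
      using assms(1) by (auto simp: le_Suc_eq)
  qed (use assms in simp_all)
  then have "\<forall>v<n. s1 ''mul'' v = v * n" using assms(1) by simp
  moreover have o: "s' z = s2 z" if "z \<notin> {''i'', ''B''}" for z
    unfolding s' by (rule sem_other) (use that in simp)
  ultimately show "\<forall>v<n. s' ''mul'' v = v * n" by (simp add: s2_def)
  show "s' ''K2'' 0 = 2 * k" "s' ''M'' 0 = 6 * k" "s' ''K4'' 0 = 4 * k"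
    using o by (simp_all add: s2_def)
  have "s' ''B'' 0 = 1 + s2 ''k'' 0 * (12 * k)" unfolding s'
  proof (rule For_rule[where I = "\<lambda>i s'. s' ''B'' 0 = 1 + i * (12 * k)"])
    fix i :: nat and s'' :: state assume "s'' ''B'' 0 = 1 + i * (12 * k)"
      "\<And>z. z \<notin> writes ?c \<Longrightarrow> z \<noteq> ''i'' \<Longrightarrow> s'' z = s2 z"
    then show "upd ''i'' 0 (Suc i) (sem ?c s'') ''B'' 0 = 1 + Suc i * (12 * k)"
      by (simp add: s2_def)
  qed (simp_all add: s2_def)
  then show "s' ''B'' 0 = base" using k1 by (simp add: s2_def base_def)
qed

lemma setup_power_spec:
  fixes s :: state
  assumes "s ''K4'' 0 = 4 * k" "s ''B'' 0 = base"
  shows "sem setup_power_prog s ''NI'' 0 = base ^ (4 * k)"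
proof -
  let ?c = "set_var ''y'' (Add (var ''y'') (var ''NI''))"
  let ?b = "set_var ''y'' (Const 0) ;; PFor ''j'' ''B'' ?c ;; set_var ''NI'' (var ''y'')"
  define s1 where "s1 = upd ''NI'' 0 1 s"
  have eq: "sem setup_power_prog s = sem (PFor ''i'' ''K4'' ?b) s1"
    by (simp add: setup_power_prog_def s1_def)
  have "sem setup_power_prog s ''NI'' 0 = base ^ s1 ''K4'' 0" unfolding eq
  proof (rule For_rule[where I = "\<lambda>i s'. s' ''NI'' 0 = base ^ i"])
    fix i :: nat and s' :: state assume J: "s' ''NI'' 0 = base ^ i"
      and fr: "\<And>z. z \<notin> writes ?b \<Longrightarrow> z \<noteq> ''i'' \<Longrightarrow> s' z = s1 z"
    define s2 where "s2 = upd ''y'' 0 0 s'"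
    have B: "s2 ''B'' 0 = base" using fr assms(2) by (simp add: s2_def s1_def)
    \<comment> \<open>Multiplication by \<open>base\<close> as repeated addition.\<close>
    have "sem (PFor ''j'' ''B'' ?c) s2 ''y'' 0 = s2 ''B'' 0 * base ^ i"
    proof (rule For_rule[where I = "\<lambda>j s''. s'' ''y'' 0 = j * base ^ i"])
      fix j :: nat and s'' :: state assume "s'' ''y'' 0 = j * base ^ i"
        "\<And>z. z \<notin> writes ?c \<Longrightarrow> z \<noteq> ''j'' \<Longrightarrow> s'' z = s2 z"
      then show "upd ''j'' 0 (Suc j) (sem ?c s'') ''y'' 0 = Suc j * base ^ i"
        using J by (simp add: s2_def)
    qed (simp_all add: s2_def)
    then show "upd ''i'' 0 (Suc i) (sem ?b s') ''NI'' 0 = base ^ Suc i"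
      using B by (simp add: s2_def)
  qed (simp_all add: s1_def)
  then show ?thesis using assms(1) by (simp add: s1_def)
qed

lemma setup_first_arcs_spec:
  fixes s :: state
  assumes n: "s ''n'' 0 = n" and mul: "\<forall>v<n. s ''mul'' v = v * n" and M: "s ''M'' 0 = 6 * k"
    and m: "\<forall>v<n. \<forall>w<n. s ''m'' (v * n + w) = m v w" and f: "\<And>i. s ''f'' i = 0"
  shows "\<forall>v<n. \<forall>w<n. 0 < sem setup_first_arcs_prog s ''f'' (v * n + w) \<longleftrightarrow> first_arc v w"
proof -
  let ?c = "PCond (pos (Cell ''m'' (arc_addr ''v'' ''w'')))
        (PCond (Less (var ''row'') (var ''M'')) (PStore ''f'' (arc_addr ''v'' ''w'') (Const 1)) PSkip ;;
         set_var ''row'' (Add (var ''row'') (Const 1)))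
        PSkip"
  let ?b = "set_var ''row'' (Const 0) ;; PFor ''w'' ''n'' ?c"
  \<comment> \<open>\<open>(a, b)\<close> is the position reached in row-major order; entries of
    \<open>f\<close> from there on still have their initial value 0.\<close>
  define J where "J a b s' \<longleftrightarrow> (\<forall>v<n. \<forall>w<n. 0 < s' ''f'' (v * n + w) \<longleftrightarrow>
      first_arc v w \<and> (v < a \<or> v = a \<and> w < b))" for a b and s' :: state
  have "J (s ''n'' 0) 0 (sem setup_first_arcs_prog s)"
    unfolding setup_first_arcs_prog_def
  proof (rule For_rule[where I = "\<lambda>a s'. J a 0 s'"])
    fix a :: nat and s' :: state assume a: "a < s ''n'' 0" "s' ''v'' 0 = a" and Ja: "J a 0 s'"
      and fr: "\<And>z. z \<notin> writes ?b \<Longrightarrow> z \<noteq> ''v'' \<Longrightarrow> s' z = s z"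
    define s1 where "s1 = upd ''row'' 0 0 s'"
    have an: "a < n" using a n by simp
    have fr1: "s1 ''n'' 0 = n" "s1 ''mul'' a = a * n" "\<And>w. w < n \<Longrightarrow> s1 ''m'' (a * n + w) = m a w"
      "s1 ''M'' 0 = 6 * k" "s1 ''v'' 0 = a"
      using fr n mul m M an a by (simp_all add: s1_def)
    have "J a (s1 ''n'' 0) (sem (PFor ''w'' ''n'' ?c) s1) \<and>
        sem (PFor ''w'' ''n'' ?c) s1 ''row'' 0 = card {x. x < s1 ''n'' 0 \<and> m a x > 0}"
    proof (rule For_rule[where I = "\<lambda>b s''. J a b s'' \<and> s'' ''row'' 0 = card {x. x < b \<and> m a x > 0}"])
      show "J a 0 (upd ''w'' 0 0 s1) \<and> upd ''w'' 0 0 s1 ''row'' 0 = card {x. x < 0 \<and> m a x > 0}"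
        using Ja by (simp add: s1_def J_def)
      fix b :: nat and s'' :: state assume b: "b < s1 ''n'' 0" "s'' ''w'' 0 = b"
        and K: "J a b s'' \<and> s'' ''row'' 0 = card {x. x < b \<and> m a x > 0}"
        and fr2: "\<And>z. z \<notin> writes ?c \<Longrightarrow> z \<noteq> ''w'' \<Longrightarrow> s'' z = s1 z"
      have bn: "b < n" using b fr1 by simp
      have fs: "s'' ''mul'' a = a * n" "s'' ''m'' (a * n + b) = m a b" "s'' ''M'' 0 = 6 * k" "s'' ''v'' 0 = a"
        using fr2 fr1 bn by simp_all
      have row: "{x. x < Suc b \<and> m a x > 0} =
          (if m a b > 0 then insert b {x. x < b \<and> m a x > 0} else {x. x < b \<and> m a x > 0})"
        by (auto simp: less_Suc_eq)
      have fa: "first_arc a b \<longleftrightarrow> m a b > 0 \<and> s'' ''row'' 0 < 6 * k" using K by (simp add: first_arc_def)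
      let ?s = "sem ?c s''"
      have f': "?s ''f'' = (if first_arc a b then (s'' ''f'')(a * n + b := 1) else s'' ''f'')"
        using b(2) fs fa by (auto simp: fun_eq_iff)
      have "J a (Suc b) ?s"
        unfolding J_def f'
      proof (intro allI impI)
        fix v w assume vw: "v < n" "w < n"
        have old: "0 < s'' ''f'' (v * n + w) \<longleftrightarrow> first_arc v w \<and> (v < a \<or> v = a \<and> w < b)"
          using K vw unfolding J_def by blast
        show "0 < (if first_arc a b then (s'' ''f'')(a * n + b := 1) else s'' ''f'') (v * n + w) \<longleftrightarrow>
            first_arc v w \<and> (v < a \<or> v = a \<and> w < Suc b)"
        proof (cases "v * n + w = a * n + b")
          case True
          then have "v = a" "w = b" using arc_index_eq_iff[OF vw(2) bn] by auto
          then show ?thesis using old by auto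
        next
          case False
          then have "\<not> (v = a \<and> w = b)" by blast
          then show ?thesis using old False by (auto simp: less_Suc_eq)
        qed
      qed
      moreover have "?s ''row'' 0 = card {x. x < Suc b \<and> m a x > 0}"
        using b(2) fs K unfolding row by auto
      ultimately show "J a (Suc b) (upd ''w'' 0 (Suc b) ?s) \<and>
          upd ''w'' 0 (Suc b) ?s ''row'' 0 = card {x. x < Suc b \<and> m a x > 0}"
        by (simp add: J_def del: sem.simps(1-4))
    qed simp
    then have "J a n (sem ?b s')" using fr1(1) by (simp add: s1_def)
    then show "J (Suc a) 0 (upd ''v'' 0 (Suc a) (sem ?b s'))"
      unfolding J_def by (simp add: less_Suc_eq)
  qed (simp_all add: J_def f)
  then show ?thesis using n unfolding J_def by simp
qed

text \<open>Besides correctness, this records the values of the loop bounds in the states between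
  the separately compiled pieces, where the time bound needs them.\<close>

lemma algorithm_spec:
  defines "s \<equiv> encode (k, n, r, m)"
  defines "s1 \<equiv> sem setup_constants_prog s"
  defines "s2 \<equiv> sem setup_power_prog s1"
  shows "correct_output (k, n, r, m) (sem algorithm s)"
    "s1 ''K4'' 0 = 4 * k" "s1 ''B'' 0 = base"
    "s2 ''n'' 0 = n" "s2 ''NI'' 0 = base ^ (4 * k)" "s2 ''K2'' 0 = 2 * k"
proof -
  define s3 where "s3 = sem setup_first_arcs_prog s2"
  have s: "s ''n'' 0 = n" "s ''k'' 0 = k" "s ''r'' 0 = r" "s ''mul'' 0 = 0" "\<And>i. s ''f'' i = 0"
    "s ''ans'' 0 = 0" "\<And>i. s ''i1'' i = 0"
    by (simp_all add: s_def)
  have sm: "\<forall>v<n. \<forall>w<n. s ''m'' (v * n + w) = m v w"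
    using arc_index_less by (simp add: s_def)
  note c = setup_constants_spec[of s, OF s(1,2,4), folded s1_def]
  have f1: "z \<notin> {''v'', ''mul'', ''K2'', ''M'', ''K12'', ''K4'', ''B'', ''i''} \<Longrightarrow> s1 z = s z" for z
    unfolding s1_def by (rule sem_other) (simp add: setup_constants_prog_def)
  have f2: "z \<notin> {''NI'', ''y'', ''i'', ''j''} \<Longrightarrow> s2 z = s1 z" for z
    unfolding s2_def by (rule sem_other) (simp add: setup_power_prog_def)
  have f3: "z \<notin> {''v'', ''w'', ''row'', ''f''} \<Longrightarrow> s3 z = s2 z" for z
    unfolding s3_def by (rule sem_other) (simp add: setup_first_arcs_prog_def)
  have ni: "s2 ''NI'' 0 = base ^ (4 * k)" unfolding s2_def by (rule setup_power_spec) (fact c)+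
  have "\<forall>v<n. \<forall>w<n. 0 < s3 ''f'' (v * n + w) \<longleftrightarrow> first_arc v w"
    unfolding s3_def by (rule setup_first_arcs_spec) (use s sm c in \<open>simp_all add: f2 f1\<close>)
  then have e: "env s3" using s sm c ni by (simp add: env_def f3 f2 f1)
  have a: "s3 ''ans'' 0 = 0" using s by (simp add: f3 f2 f1)
  let ?s = "sem algorithm s"
  have fin: "?s = sem loop_prog s3" by (simp add: algorithm_def s3_def s2_def s1_def)
  have "''i1'' \<notin> writes loop_prog" using attempt_writes by (auto simp: loop_prog_def)
  then have i1: "?s ''i1'' v = 0" for v
    using s by (simp add: fin sem_other f3 f2 f1)
  note L = loop_spec[OF e a, folded fin]
  show "correct_output (k, n, r, m) ?s"
  proof (cases "\<exists>p l p' l'. solution p l p' l'")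
    case True
    then have yes: "has_safe_packing (k, n, r, m)" by (simp only: has_safe_packing_iff)
    have "?s ''ans'' 0 = 1" "result_ok ?s" using L True by simp_all
    then have "safe_packing k (multidigraph n m) r (output_digraph n r (?s ''p1'') (?s ''i1''))
        (output_digraph n r (?s ''p2'') (?s ''i2''))"
      unfolding result_ok_def using i1 by (intro solution_imp_safe_packing) auto
    with yes \<open>?s ''ans'' 0 = 1\<close> show ?thesis by simp
  next
    case False
    then have no: "\<not> has_safe_packing (k, n, r, m)" by (simp only: has_safe_packing_iff not_False_eq_True)
    have "?s ''ans'' 0 = 0" using L False by simp
    with no show ?thesis by simp
  qed
  show "s1 ''K4'' 0 = 4 * k" "s1 ''B'' 0 = base" by (fact c)+
  show "s2 ''n'' 0 = n" "s2 ''NI'' 0 = base ^ (4 * k)" "s2 ''K2'' 0 = 2 * k"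
    using s c ni by (simp_all add: f2 f1)
qed

end

section \<open>Running time\<close>

text \<open>Compiled in three pieces: the set-up computes bounds of later loops, whereas
  \<open>exec_compile\<close> does not let a program write its own loop bounds.\<close>

definition algorithm_com :: com where
  "algorithm_com = Seq (compile setup_constants_prog)
     (Seq (compile setup_power_prog) (compile (setup_first_arcs_prog ;; loop_prog)))"

definition time_coeff :: nat where
  "time_coeff = cost_coeff setup_constants_prog + cost_coeff setup_power_prog +
     cost_coeff (setup_first_arcs_prog ;; loop_prog) + 2"

definition time_degree :: nat where
  "time_degree = cost_degree setup_constants_prog + cost_degree setup_power_prog +
     cost_degree (setup_first_arcs_prog ;; loop_prog)"

lemma setup_well_formed:
  "safe_loops setup_constants_prog" "bounds setup_constants_prog = {''n'', ''k''}"
  "bounds setup_constants_prog \<inter> writes setup_constants_prog = {}"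
  "safe_loops setup_power_prog" "bounds setup_power_prog = {''K4'', ''B''}"
  "bounds setup_power_prog \<inter> writes setup_power_prog = {}"
  by (auto simp: setup_constants_prog_def setup_power_prog_def)

lemma reach_well_formed: "safe_loops (reach_prog t)" "bounds (reach_prog t) = {''n''}"
  by (auto simp: reach_prog_def)

lemma label_well_formed: "safe_loops (label_prog l)" "bounds (label_prog l) = {}"
  by (auto simp: label_prog_def)

context packing
begin

lemma extend_well_formed:
  assumes "tree_names t p l t' p' l'"
  shows "safe_loops (extend_prog t p l t')" "bounds (extend_prog t p l t') = {''n''}"
proof -
  note nm = tree_names_neq[OF assms] tree_names_neq[OF assms, symmetric]
  have "safe_loops (try_arc_prog t p l t')" "bounds (try_arc_prog t p l t') = {''n''}"
    by (simp_all add: try_arc_prog_def reach_well_formed label_well_formed)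
  then show "safe_loops (extend_prog t p l t')" "bounds (extend_prog t p l t') = {''n''}"
    by (simp_all add: extend_prog_def try_arc_writes nm)
qed

lemma search_well_formed:
  assumes "tree_names t p l t' p' l'"
  shows "safe_loops (search_prog t p l)" "bounds (search_prog t p l) = {''K2'', ''NI'', ''n''}"
proof -
  note nm = tree_names_neq[OF assms] tree_names_neq[OF assms, symmetric]
  have "safe_loops (pick_body t p l)" "bounds (pick_body t p l) = {}"
    by (simp_all add: pick_body_def add_arc_prog_def label_well_formed)
  then have "safe_loops (pick_prog t p l)" "bounds (pick_prog t p l) = {''n''}"
    by (simp_all add: pick_prog_def pick_body_writes nm)
  moreover have "safe_loops digit_prog" "bounds digit_prog = {''NI''}"
    by (simp_all add: digit_prog_def)
  ultimately show "safe_loops (search_prog t p l)" "bounds (search_prog t p l) = {''K2'', ''NI'', ''n''}"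
    by (auto simp: search_prog_def pick_writes digit_writes nm)
qed

lemma loop_well_formed:
  "safe_loops (setup_first_arcs_prog ;; loop_prog)"
  "bounds (setup_first_arcs_prog ;; loop_prog) = {''K2'', ''NI'', ''n''}"
  "bounds (setup_first_arcs_prog ;; loop_prog) \<inter> writes (setup_first_arcs_prog ;; loop_prog) = {}"
proof -
  have c: "safe_loops reset_prog" "bounds reset_prog = {''n''}"
    "safe_loops span_check_prog" "bounds span_check_prog = {''n''}"
    "\<And>l. safe_loops (safe_check_prog l)" "\<And>l. bounds (safe_check_prog l) = {''n''}"
    "safe_loops output_prog" "bounds output_prog = {''n''}"
    by (auto simp: reset_prog_def span_check_prog_def safe_check_prog_def output_prog_def)
  note wf = c extend_well_formed[OF names1] extend_well_formed[OF names2]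
    search_well_formed[OF names1] search_well_formed[OF names2]
  have a: "safe_loops attempt_prog" "bounds attempt_prog = {''K2'', ''NI'', ''n''}"
    by (auto simp: attempt_prog_def wf)
  have w: "writes attempt_prog \<inter> {''K2'', ''NI'', ''n'', ''N''} = {}"
    using attempt_writes by (auto simp: env_vars_def)
  show "safe_loops (setup_first_arcs_prog ;; loop_prog)"
    using a w by (simp add: setup_first_arcs_prog_def loop_prog_def)
  show b: "bounds (setup_first_arcs_prog ;; loop_prog) = {''K2'', ''NI'', ''n''}"
    using a by (auto simp: setup_first_arcs_prog_def loop_prog_def)
  show "bounds (setup_first_arcs_prog ;; loop_prog) \<inter> writes (setup_first_arcs_prog ;; loop_prog) = {}"
    unfolding b using w by (simp add: setup_first_arcs_prog_def loop_prog_def)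
qed

text \<open>All loop bounds, namely \<open>n\<close>, \<open>k\<close>, \<open>2 * k\<close>,
  \<open>4 * k\<close>, \<open>base\<close> and the number of attempts, are at most
  \<open>Z = n * base ^ (4 * k)\<close>, so the nested loops cost a fixed power of
  \<open>Z\<close>.\<close>

lemma algorithm_exec:
  "\<exists>t. exec algorithm_com (encode (k, n, r, m)) t (sem algorithm (encode (k, n, r, m))) \<and>
     t \<le> time_coeff * (n * base ^ (4 * k)) ^ time_degree"
proof -
  define s where "s = encode (k, n, r, m)"
  define s1 where "s1 = sem setup_constants_prog s"
  define s2 where "s2 = sem setup_power_prog s1"
  define Z where "Z = n * base ^ (4 * k)"
  note sp = algorithm_spec(2-6)[folded s_def, folded s1_def, folded s2_def]
  have n1: "n \<ge> 1" using r_less by simp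
  have "base \<le> base ^ (4 * k)" using base_gt_1 k_pos by (intro self_le_power) auto
  moreover have "4 * k \<le> base"
  proof -
    have "k * 1 \<le> k * k" using k_pos by (intro mult_le_mono2) simp
    then show ?thesis unfolding base_def mult.assoc by linarith
  qed
  moreover have "base ^ (4 * k) \<le> Z" using n1 by (simp add: Z_def)
  ultimately have Z: "base \<le> Z" "4 * k \<le> Z" "base ^ (4 * k) \<le> Z" by linarith+
  have Z1: "Z \<ge> 1" using Z(1) base_gt_1 by linarith
  have nZ: "n \<le> Z" using base_gt_1 by (simp add: Z_def)
  have s: "s ''n'' 0 = n" "s ''k'' 0 = k" by (simp_all add: s_def)
  have b1: "s y 0 \<le> Z" if "y \<in> bounds setup_constants_prog" for y
    using that s Z nZ unfolding setup_well_formed(2) by (elim insertE emptyE) simp_all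
  have b2: "s1 y 0 \<le> Z" if "y \<in> bounds setup_power_prog" for y
    using that sp Z unfolding setup_well_formed(5) by (elim insertE emptyE) simp_all
  have b3: "s2 y 0 \<le> Z" if "y \<in> bounds (setup_first_arcs_prog ;; loop_prog)" for y
    using that sp Z nZ unfolding loop_well_formed(2) by (elim insertE emptyE) simp_all
  obtain t1 where t1: "exec (compile setup_constants_prog) s t1 s1"
      "t1 \<le> cost_coeff setup_constants_prog * Z ^ cost_degree setup_constants_prog"
    using exec_compile_poly[where s = s and Z = Z, OF setup_well_formed(1,3) b1 Z1] unfolding s1_def by blast
  obtain t2 where t2: "exec (compile setup_power_prog) s1 t2 s2"
      "t2 \<le> cost_coeff setup_power_prog * Z ^ cost_degree setup_power_prog"
    using exec_compile_poly[where s = s1 and Z = Z, OF setup_well_formed(4,6) b2 Z1] unfolding s2_def by blast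
  obtain t3 where t3: "exec (compile (setup_first_arcs_prog ;; loop_prog)) s2 t3 (sem (setup_first_arcs_prog ;; loop_prog) s2)"
      "t3 \<le> cost_coeff (setup_first_arcs_prog ;; loop_prog) * Z ^ cost_degree (setup_first_arcs_prog ;; loop_prog)"
    using exec_compile_poly[where s = s2 and Z = Z, OF loop_well_formed(1,3) b3 Z1] by blast
  have "exec algorithm_com s (t1 + (t2 + t3 + 1) + 1) (sem algorithm s)"
    unfolding algorithm_com_def
    using exec.Seq[OF t1(1) exec.Seq[OF t2(1) t3(1)]]
    by (simp add: algorithm_def s1_def s2_def)
  moreover have "t1 + (t2 + t3 + 1) + 1 \<le> time_coeff * Z ^ time_degree"
  proof -
    have p: "c * Z ^ d \<le> c * Z ^ time_degree" if "d \<le> time_degree" for c d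
      using that Z1 by (intro mult_le_mono2 power_increasing) auto
    have "cost_degree setup_constants_prog \<le> time_degree" "cost_degree setup_power_prog \<le> time_degree"
      "cost_degree (setup_first_arcs_prog ;; loop_prog) \<le> time_degree"
      unfolding time_degree_def by linarith+
    note le_trans[OF t1(2) p[OF this(1)]] le_trans[OF t2(2) p[OF this(2)]] le_trans[OF t3(2) p[OF this(3)]]
    moreover have "1 \<le> Z ^ time_degree" using Z1 by simp
    ultimately show ?thesis unfolding time_coeff_def add_mult_distrib by linarith
  qed
  ultimately show ?thesis unfolding s_def Z_def by blast
qed

end

lemma valid_instance_packing:
  assumes "k > 0" "rooted_digraph (multidigraph n m) r"
  shows "packing k n r"
  using assms by unfold_locales (simp_all add: rooted_digraph_def multidigraph_def)

lemma algorithm_correct: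
  assumes "k > 0" "rooted_digraph (multidigraph n m) r"
  shows "\<exists>t s. exec algorithm_com (encode (k, n, r, m)) t s \<and> correct_output (k, n, r, m) s \<and>
    t \<le> time_coeff * (12 * k * k + 1) ^ (4 * k * time_degree) * n ^ time_degree"
proof -
  interpret packing k n r m using assms by (rule valid_instance_packing)
  have "time_coeff * (n * base ^ (4 * k)) ^ time_degree =
      time_coeff * (12 * k * k + 1) ^ (4 * k * time_degree) * n ^ time_degree"
    by (simp add: base_def power_mult_distrib power_mult)
  with algorithm_exec algorithm_spec(1) show ?thesis by metis
qed

section \<open>The exponent of the running time\<close>

definition exponent :: "nat \<Rightarrow> real" where
  "exponent k = log 2 (real (time_coeff * (12 * k * k + 1) ^ (4 * k * time_degree)))"

lemma time_coeff_pos: "time_coeff > 0"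
  by (simp add: time_coeff_def)

lemma powr_exponent: "2 powr exponent k = real (time_coeff * (12 * k * k + 1) ^ (4 * k * time_degree))"
proof -
  have "0 < time_coeff * (12 * k * k + 1) ^ (4 * k * time_degree)" using time_coeff_pos by simp
  then have "0 < real (time_coeff * (12 * k * k + 1) ^ (4 * k * time_degree))" by (simp only: of_nat_0_less_iff)
  then show ?thesis unfolding exponent_def by (intro powr_log_cancel) simp_all
qed

text \<open>The exponent is bounded by a constant plus a multiple of \<open>k log k\<close>, and
  \<open>k \<le> k ^ 2\<close> brings this to the required form. From \<open>k = 2\<close> on the
  logarithm is at least 1, so that the constant is absorbed.\<close>

lemma exponent_bigo: "exponent \<in> O(\<lambda>k. real k ^ 2 * log 2 (real k))"
proof (rule bigoI)
  define D where "D = real time_degree"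
  define c where "c = log 2 (real time_coeff) + 24 * D"
  show "\<forall>\<^sub>F k in at_top. norm (exponent k) \<le> c * norm (real k ^ 2 * log 2 (real k))"
    using eventually_ge_at_top[of 2]
  proof eventually_elim
    case (elim k)
    let ?L = "log 2 (real k)"
    have C: "real time_coeff \<ge> 1" using time_coeff_pos by simp
    have lC: "log 2 (real time_coeff) \<ge> 0" using C by simp
    have L1: "?L \<ge> 1" using elim by simp
    have k1: "real k \<ge> 1" "real k \<le> real k ^ 2" using elim by (simp_all add: power2_eq_square)
    define B where "B = real (12 * k * k + 1)"
    have b0: "B \<ge> 1" by (simp add: B_def)
    \<comment> \<open>For \<open>k \<ge> 2\<close> one has \<open>12 k^2 + 1 \<le> 16 k^2\<close>
      and \<open>16 \<le> k^4\<close>. The power 6 turns \<open>log 2 B\<close> into at most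
      \<open>6 * ?L\<close>, whence the \<open>24 = 4 * 6\<close> in \<open>c\<close>.\<close>
    have "12 * k * k + 1 \<le> k ^ 6"
    proof -
      have "1 \<le> k * k" using elim by simp
      then have "12 * k * k + 1 \<le> 16 * (k * k)" by (simp add: mult.assoc)
      also have "16 \<le> k ^ 4" using power_mono[OF elim, of 4] by simp
      then have "16 * (k * k) \<le> k ^ 4 * (k * k)" by (rule mult_le_mono1)
      also have "\<dots> = k ^ 6" by (simp add: numeral_eq_Suc)
      finally show ?thesis .
    qed
    then have le6: "B \<le> real k ^ 6" unfolding B_def by (metis of_nat_le_iff of_nat_power)
    have "0 < B" using b0 by linarith
    then have "log 2 (B) \<le> log 2 (real k ^ 6)"
      using le6 by (rule log_mono[rotated]) simp
    also have "\<dots> = 6 * ?L" using elim by (simp add: log_nat_power)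
    finally have lb: "log 2 (B) \<le> 6 * ?L" .
    have lb0: "0 \<le> log 2 (B)" using b0 by simp
    have "exponent k = log 2 (real time_coeff) + log 2 (B ^ (4 * k * time_degree))"
      unfolding exponent_def of_nat_mult[of time_coeff] of_nat_power B_def[symmetric] using C b0 by (intro log_mult_pos) auto
    also have "log 2 (B ^ (4 * k * time_degree)) =
        real (4 * k * time_degree) * log 2 (B)"
      using b0 by (intro log_nat_power) linarith
    finally have eq: "exponent k = log 2 (real time_coeff) + 4 * real k * D * log 2 (B)"
      by (simp add: D_def)
    have nn: "0 \<le> exponent k" unfolding eq using lC lb0 by (simp add: D_def)
    have "4 * real k * D * log 2 (B) \<le> 4 * real k * D * (6 * ?L)"
      using lb by (intro mult_left_mono) (auto simp: D_def)
    also have "\<dots> = 24 * D * (real k * ?L)" by simp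
    also have "\<dots> \<le> 24 * D * (real k ^ 2 * ?L)"
      using k1 L1 by (intro mult_left_mono mult_right_mono) (auto simp: D_def)
    finally have u1: "4 * real k * D * log 2 (B) \<le> 24 * D * (real k ^ 2 * ?L)" .
    have "1 * 1 \<le> real k ^ 2 * ?L" using k1 L1 by (intro mult_mono) auto
    then have "log 2 (real time_coeff) * 1 \<le> log 2 (real time_coeff) * (real k ^ 2 * ?L)"
      using lC by (intro mult_left_mono) auto
    with u1 have "exponent k \<le> c * (real k ^ 2 * ?L)" unfolding eq c_def distrib_right by linarith
    then show ?case using nn L1 by (simp add: abs_mult)
  qed
qed

section \<open>A computable bound in the parameter\<close>

lemma sem_doubling_loop:
  assumes p: "\<And>s. s ''x'' 0 = X \<Longrightarrow> sem p s ''ans'' 0 = s ''ans'' 0 * 2 ^ e"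
    and fresh: "''x'' \<notin> writes p" "v \<notin> writes p" "v \<noteq> ''x''" "v \<noteq> ''ans''" and s: "s ''x'' 0 = X"
  shows "sem (PFor v y p) s ''ans'' 0 = s ''ans'' 0 * 2 ^ (s y 0 * e)"
proof (rule For_rule[where I = "\<lambda>i s'. s' ''ans'' 0 = s ''ans'' 0 * 2 ^ (i * e)"])
  fix i :: nat and s' :: state assume J: "s' ''ans'' 0 = s ''ans'' 0 * 2 ^ (i * e)"
    and fr: "\<And>z. z \<notin> writes p \<Longrightarrow> z \<noteq> v \<Longrightarrow> s' z = s z"
  have "s' ''x'' 0 = X" using fr[of "''x''"] fresh s by simp
  from p[of s', OF this] J show "upd v 0 (Suc i) (sem p s') ''ans'' 0 = s ''ans'' 0 * 2 ^ (Suc i * e)"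
    using fresh by (simp add: power_add)
qed (use fresh in auto)

text \<open>Four nested loops around a doubling of \<open>ans\<close>, with bounds \<open>x\<close>,
  \<open>x\<close>, \<open>x\<close> and \<open>a\<close>. Such a crude function is enough for
  fixed-parameter tractability and is easier to program than the actual time bound.\<close>

lemma computable_exp_cubic: "computable (\<lambda>x. 2 ^ (a * x * x * x))"
proof -
  define dbl where "dbl = set_var ''ans'' (Add (var ''ans'') (var ''ans''))"
  define l1 where "l1 = PFor ''u'' ''x'' dbl"
  define l2 where "l2 = PFor ''v'' ''x'' l1"
  define l3 where "l3 = PFor ''w'' ''x'' l2"
  define q where "q = PFor ''i'' ''a'' l3"
  define p where "p = set_var ''a'' (Const a) ;; set_var ''ans'' (Const 1)"
  have w: "writes l1 = {''u'', ''ans''}" "writes l2 = {''v'', ''u'', ''ans''}"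
    "writes l3 = {''w'', ''v'', ''u'', ''ans''}" "writes q = {''i'', ''w'', ''v'', ''u'', ''ans''}"
    by (simp_all add: q_def l3_def l2_def l1_def dbl_def)
  show ?thesis
    unfolding computable_def
  proof (intro exI[of _ "Seq (compile p) (compile q)"] allI)
    fix x :: nat
    let ?s = "\<lambda>y i. if y = ''x'' \<and> i = 0 then x else 0 :: nat"
    let ?s1 = "sem p ?s"
    have s1: "?s1 ''x'' 0 = x" "?s1 ''ans'' 0 = 1" "?s1 ''a'' 0 = a" by (simp_all add: p_def)
    obtain t where t: "exec (compile p) ?s t ?s1"
      using exec_compile[of p ?s] by (auto simp: p_def)
    have "safe_loops q" "bounds q \<inter> writes q = {}"
      by (simp_all add: q_def l3_def l2_def l1_def dbl_def)
    then obtain u where u: "exec (compile q) ?s1 u (sem q ?s1)"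
      using exec_compile[of q ?s1] by blast
    have d: "sem dbl s ''ans'' 0 = s ''ans'' 0 * 2 ^ 1" for s by (simp add: dbl_def)
    have "sem l1 s ''ans'' 0 = s ''ans'' 0 * 2 ^ (x * 1)" if "s ''x'' 0 = x" for s
      unfolding l1_def using sem_doubling_loop[of x dbl 1 "''u''" s "''x''"] d that by (simp add: dbl_def)
    then have "sem l2 s ''ans'' 0 = s ''ans'' 0 * 2 ^ (x * (x * 1))" if "s ''x'' 0 = x" for s
      unfolding l2_def using sem_doubling_loop[of x l1 "x * 1" "''v''" s "''x''"] that by (simp add: w)
    then have "sem l3 s ''ans'' 0 = s ''ans'' 0 * 2 ^ (x * (x * (x * 1)))" if "s ''x'' 0 = x" for s
      unfolding l3_def using sem_doubling_loop[of x l2 "x * (x * 1)" "''w''" s "''x''"] that by (simp add: w)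
    then have "sem q ?s1 ''ans'' 0 = ?s1 ''ans'' 0 * 2 ^ (?s1 ''a'' 0 * (x * (x * (x * 1))))"
      unfolding q_def using s1(1) by (intro sem_doubling_loop[where X = x]) (simp_all add: w)
    then have "sem q ?s1 ''ans'' 0 = 2 ^ (a * x * x * x)" by (simp add: s1 mult.assoc)
    with exec.Seq[OF t u]
    show "\<exists>t s'. exec (Seq (compile p) (compile q)) ?s t s' \<and> s' ''ans'' 0 = 2 ^ (a * x * x * x)" by blast
  qed
qed

text \<open>Every matrix entry contributes at least one digit, so \<open>n * n\<close>, and with it
  \<open>n\<close>, is at most the input size.\<close>

lemma instance_size_ge: "n \<le> instance_size (k, n, r, m)"
proof -
  have "n \<le> n * n" by simp
  also have "\<dots> = (\<Sum>u<n. \<Sum>v<n. 1)" by simp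
  also have "\<dots> \<le> (\<Sum>u<n. \<Sum>v<n. bit_length (m u v))" by (intro sum_mono) (simp add: bit_length_def)
  finally show ?thesis by simp
qed

lemma packing_fixed_parameter_tractable:
  "fixed_parameter_tractable valid_instances encode instance_size parameter has_safe_packing"
  unfolding fixed_parameter_tractable_def
proof (rule exI[of _ algorithm_com],
    rule exI[of _ "\<lambda>x. 2 ^ ((time_coeff + 48 * time_degree) * x * x * x)"],
    rule exI[of _ time_degree], intro conjI ballI)
  let ?a = "time_coeff + 48 * time_degree"
  show "computable (\<lambda>x. 2 ^ (?a * x * x * x))" by (rule computable_exp_cubic)
  fix I assume "I \<in> valid_instances"
  then obtain k n r m where I: "I = (k, n, r, m)" and k: "k > 0" and v: "rooted_digraph (multidigraph n m) r"
    by (auto simp: valid_instances_def)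
  from algorithm_correct[OF k v] obtain t s where ts: "exec algorithm_com (encode (k, n, r, m)) t s"
    "correct_output (k, n, r, m) s"
    "t \<le> time_coeff * (12 * k * k + 1) ^ (4 * k * time_degree) * n ^ time_degree" by blast
  have "time_coeff \<le> 2 ^ (time_coeff * k * k * k)"
  proof -
    have "time_coeff \<le> 2 ^ time_coeff" by (simp add: less_imp_le)
    also have "\<dots> \<le> 2 ^ (time_coeff * k * k * k)" using k by (intro power_increasing) auto
    finally show ?thesis .
  qed
  moreover have "(12 * k * k + 1) ^ (4 * k * time_degree) \<le> 2 ^ (48 * time_degree * k * k * k)"
  proof -
    \<comment> \<open>The estimate \<open>x + 1 \<le> 2 ^ x\<close> leads to the exponent
      \<open>48 = 12 * 4\<close> times \<open>time_degree * k ^ 3\<close>, hence the cubic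
      bound.\<close>
    have "12 * k * k + 1 \<le> 2 ^ (12 * k * k)" by (simp add: Suc_le_eq)
    then have "(12 * k * k + 1) ^ (4 * k * time_degree) \<le> (2 ^ (12 * k * k)) ^ (4 * k * time_degree)"
      by (intro power_mono) auto
    also have "\<dots> = 2 ^ (48 * time_degree * k * k * k)" by (simp flip: power_mult add: ac_simps)
    finally show ?thesis .
  qed
  ultimately have "time_coeff * (12 * k * k + 1) ^ (4 * k * time_degree) \<le>
      2 ^ (time_coeff * k * k * k) * 2 ^ (48 * time_degree * k * k * k)" by (rule mult_le_mono)
  also have "\<dots> = 2 ^ (?a * k * k * k)" by (simp add: power_add distrib_right)
  finally have "time_coeff * (12 * k * k + 1) ^ (4 * k * time_degree) * n ^ time_degree \<le>
      2 ^ (?a * k * k * k) * instance_size I ^ time_degree"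
    using instance_size_ge[of n k r m] unfolding I by (intro mult_le_mono power_mono) auto
  with ts have t: "t \<le> 2 ^ (?a * parameter I * parameter I * parameter I) * instance_size I ^ time_degree"
    unfolding I by simp
  have "s ''ans'' 0 = (if has_safe_packing (k, n, r, m) then 1 else 0)"
    using ts(2) by (simp only: correct_output.simps)
  then show "\<exists>t s'. exec algorithm_com (encode I) t s' \<and>
      t \<le> 2 ^ (?a * parameter I * parameter I * parameter I) * instance_size I ^ time_degree \<and>
      s' ''ans'' 0 = (if has_safe_packing I then 1 else 0)"
    using ts(1) t unfolding I by blast
qed

theorem theorem5:
  shows "(\<exists>(P :: com) (g :: nat \<Rightarrow> real) (c :: nat).
            g \<in> O(\<lambda>k. real k ^ 2 * log 2 (real k)) \<and>
            (\<forall>k n r m. k > 0 \<longrightarrow> rooted_digraph (multidigraph n m) r \<longrightarrow>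
               (\<exists>t s. exec P (encode (k, n, r, m)) t s \<and>
                      real t \<le> 2 powr g k * real n ^ c \<and>
                      correct_output (k, n, r, m) s)))
         \<and> fixed_parameter_tractable valid_instances encode instance_size parameter
             has_safe_packing"
proof (rule conjI, rule exI[of _ algorithm_com], rule exI[of _ exponent], rule exI[of _ time_degree],
    intro conjI allI impI)
  fix k n r :: nat and m :: "nat \<Rightarrow> nat \<Rightarrow> nat"
  assume "k > 0" "rooted_digraph (multidigraph n m) r"
  from algorithm_correct[OF this] obtain t s where ts: "exec algorithm_com (encode (k, n, r, m)) t s"
    "correct_output (k, n, r, m) s"
    "t \<le> time_coeff * (12 * k * k + 1) ^ (4 * k * time_degree) * n ^ time_degree" by blast
  have "real t \<le> real (time_coeff * (12 * k * k + 1) ^ (4 * k * time_degree) * n ^ time_degree)"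
    using ts(3) by (simp only: of_nat_le_iff)
  also have "\<dots> = 2 powr exponent k * real n ^ time_degree"
    unfolding powr_exponent by (simp only: of_nat_mult of_nat_power)
  finally show "\<exists>t s. exec algorithm_com (encode (k, n, r, m)) t s \<and>
      real t \<le> 2 powr exponent k * real n ^ time_degree \<and> correct_output (k, n, r, m) s"
    using ts(1,2) by blast
qed (rule exponent_bigo packing_fixed_parameter_tractable)+

end
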